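(* For $n\ge 2$ let $\mathcal{J}_n$ be the order ideal of the absolute order $\mathrm{Abs}(B_n)$ generated by the Coxeter elements of the hyperoctahedral group $B_n$, and let $\bar{\mathcal{J}}_n=\mathcal{J}_n\setminus\{e\}$, where $e$ is the identity. The reduced Euler characteristic of the order complex $\Delta(\bar{\mathcal{J}}_n)$ satisfies, as an identity of formal power series in $t$, $$\sum_{n\ge 2}(-1)^n\,\tilde{\chi}(\Delta(\bar{\mathcal{J}}_n))\,\frac{t^n}{n!}\;=\;1-\sqrt{C(2t)}\,\exp\{-2t\,C(2t)\}\left(1+\sum_{n\ge1}2^{n-1}\binom{2n-1}{n}\frac{t^n}{n}\right),$$ where $C(t)=\frac{1}{2t}\left(1-\sqrt{1-4t}\right)$ is the ordinary generating function for the Catalan numbers.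
   Context: Hyperoctahedral group: $B_n$ is the group of permutations $w$ of $\{\pm1,\dots,\pm n\}$ with $w(-i)=-w(i)$ for all $i$. For $a_1,\dots,a_k\in\{\pm1,\dots,\pm n\}$ with pairwise distinct absolute values, the paired $k$-cycle $(\!(a_1,\dots,a_k)\!)$ is the permutation with cycle form $(a_1\,a_2\cdots a_k)(-a_1\,-a_2\cdots -a_k)$, and the balanced $k$-cycle $[a_1,\dots,a_k]$ is the permutation with cycle form $(a_1\,a_2\cdots a_k\,-a_1\,-a_2\cdots -a_k)$. The reflections of $B_n$ are $\mathcal{T}=\{[i]:1\le i\le n\}\cup\{(\!(i,j)\!),(\!(i,-j)\!):1\le i<j\le n\}$. The Coxeter elements of $B_n$ are precisely the balanced $n$-cycles. Absolute order: the absolute length $\ell_{\mathcal T}(w)$ is the least $k$ such that $w$ is a product of $k$ elements of $\mathcal T$; $\mathrm{Abs}(B_n)$ is the partial order on $B_n$ given by $u\preceq v$ iff $\ell_{\mathcal T}(u)+\ell_{\mathcal T}(u^{-1}v)=\ell_{\mathcal T}(v)$. The order ideal generated by a subset $S$ of a poset is the set of all $x$ with $x\preceq y$ for some $y\in S$, with the induced order. The order complex $\Delta(P)$ of a finite poset $P$ is the simplicial complex of all chains of $P$; its reduced Euler characteristic is $\tilde\chi(\Delta(P))=\sum_{F\in\Delta(P)}(-1)^{|F|-1}$, the sum including $F=\varnothing$. The square root $\sqrt{C(2t)}$ is the formal power series with constant term $1$. *)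

theory Defs
  imports
    Complex_Main
    "HOL-Combinatorics.Cycles"
    "HOL-Computational_Algebra.Formal_Power_Series"
begin

section \<open>The hyperoctahedral group and its reflections\<close>

definition signed_points :: "nat \<Rightarrow> int set" where
  "signed_points n = {- int n..int n} - {0}"

text \<open>As usual for \<open>permutes\<close>, an element of the group is extended by the identity outside
  the points it acts on. The group operation is \<open>(\<circ>)\<close> and the inverse is \<open>inv\<close>.\<close>

definition hyperoctahedral :: "nat \<Rightarrow> (int \<Rightarrow> int) set" where
  "hyperoctahedral n =
     {w. w permutes signed_points n \<and> (\<forall>i \<in> signed_points n. w (- i) = - w i)}"

text \<open>The following two are meaningful for lists of nonzero integers with pairwise distinct
  absolute values.\<close>

definition paired_cycle :: "int list \<Rightarrow> int \<Rightarrow> int" where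
  "paired_cycle as = cycle_of_list as \<circ> cycle_of_list (map uminus as)"

definition balanced_cycle :: "int list \<Rightarrow> int \<Rightarrow> int" where
  "balanced_cycle as = cycle_of_list (as @ map uminus as)"

definition reflections :: "nat \<Rightarrow> (int \<Rightarrow> int) set" where
  "reflections n =
     {balanced_cycle [i] | i. 1 \<le> i \<and> i \<le> int n} \<union>
     {paired_cycle [i, j] | i j. 1 \<le> i \<and> i < j \<and> j \<le> int n} \<union>
     {paired_cycle [i, - j] | i j. 1 \<le> i \<and> i < j \<and> j \<le> int n}"

text \<open>The Coxeter elements are the balanced \<open>n\<close>-cycles.\<close>

definition coxeter_elements :: "nat \<Rightarrow> (int \<Rightarrow> int) set" where
  "coxeter_elements n =
     {balanced_cycle as | as.
        length as = n \<and> set as \<subseteq> signed_points n \<and> distinct (map abs as)}"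


section \<open>The absolute order\<close>

definition abs_length :: "nat \<Rightarrow> (int \<Rightarrow> int) \<Rightarrow> nat" where
  "abs_length n w =
     (LEAST k. \<exists>ts. length ts = k \<and> set ts \<subseteq> reflections n \<and> w = foldr (\<circ>) ts id)"

definition abs_le :: "nat \<Rightarrow> (int \<Rightarrow> int) \<Rightarrow> (int \<Rightarrow> int) \<Rightarrow> bool" where
  "abs_le n u v \<longleftrightarrow>
     u \<in> hyperoctahedral n \<and> v \<in> hyperoctahedral n \<and>
     abs_length n u + abs_length n (inv u \<circ> v) = abs_length n v"

definition generated_order_ideal :: "('a \<Rightarrow> 'a \<Rightarrow> bool) \<Rightarrow> 'a set \<Rightarrow> 'a set \<Rightarrow> 'a set" where
  "generated_order_ideal le P S = {x \<in> P. \<exists>y \<in> S. le x y}"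

definition coxeter_ideal :: "nat \<Rightarrow> (int \<Rightarrow> int) set" where
  "coxeter_ideal n = generated_order_ideal (abs_le n) (hyperoctahedral n) (coxeter_elements n)"

definition proper_coxeter_ideal :: "nat \<Rightarrow> (int \<Rightarrow> int) set" where
  "proper_coxeter_ideal n = coxeter_ideal n - {id}"


section \<open>Order complexes\<close>

definition order_complex :: "('a \<Rightarrow> 'a \<Rightarrow> bool) \<Rightarrow> 'a set \<Rightarrow> 'a set set" where
  "order_complex le P = {F. F \<subseteq> P \<and> Complete_Partial_Order.chain le F}"

text \<open>For a finite complex with finite faces. The exponent \<open>card F + 1\<close> replaces
  \<open>card F - 1\<close>, of the same parity, because of the empty face.\<close>

definition reduced_euler_char :: "'a set set \<Rightarrow> int" where
  "reduced_euler_char K = (\<Sum>F\<in>K. (- 1) ^ (card F + 1))"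


section \<open>The Catalan generating function\<close>

text \<open>For a series with constant term 1, this is its square root with constant term 1.\<close>

abbreviation fps_sqrt :: "real fps \<Rightarrow> real fps" where
  "fps_sqrt \<equiv> fps_radical root 2"

definition catalan_fps :: "real fps" where
  "catalan_fps = (1 - fps_sqrt (1 - 4 * fps_X)) / (2 * fps_X)"

lemma fps_sqrt_nth_0: "fps_nth (fps_sqrt a) 0 = 1" if "fps_nth a 0 = 1"
  using that by simp

lemma fps_sqrt_power2: "(fps_sqrt a)\<^sup>2 = a" if "fps_nth a 0 = 1"
  using power_radical[of a root 1] that by (simp add: numeral_2_eq_2)

text \<open>The division in the definition of the Catalan series is exact.\<close>

lemma catalan_fps_mult: "2 * fps_X * catalan_fps = 1 - fps_sqrt (1 - 4 * fps_X)"
proof -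
  let ?f = "1 - fps_sqrt (1 - 4 * fps_X)"
  have f0: "fps_nth ?f 0 = 0" by simp
  have "2 * fps_X dvd ?f"
  proof (cases "?f = 0")
    case False
    have "subdegree (2 * fps_X :: real fps) = 1"
      by (rule subdegreeI) (simp_all add: numeral_fps_const)
    moreover have "subdegree ?f \<ge> 1"
      using False f0 by (metis One_nat_def Suc_leI gr0I nth_subdegree_nonzero)
    ultimately show ?thesis using False by (subst fps_dvd_iff) auto
  qed auto
  then show ?thesis unfolding catalan_fps_def by (rule dvd_mult_div_cancel)
qed

end

theory Submission
  imports Defs "HOL-Library.Numeral_Type"
begin

text \<open>
  If \<open>f\<close> is the Moebius function \<open>\<mu>(e, \<cdot>)\<close> of the ideal, then the Euler characteristic is
  \<open>- (\<Sum>x. f x)\<close>. The values of \<open>f\<close> are products over the cycles of \<open>x\<close>: a paired cycle of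
  length \<open>k + 1\<close> contributes \<open>(-1)^k C_k\<close>, a balanced one \<open>-(-1)^k binom (2k + 1) (k + 1)\<close>. That
  these products sum to zero over every nontrivial principal ideal follows from a grouping of the
  factorisations \<open>y = u \<circ> v\<close>: fix a point \<open>k\<close> moved by \<open>y\<close>; if \<open>v\<close> moves \<open>k\<close>, the reflection
  interchanging \<open>k\<close> and \<open>v k\<close> can be moved from \<open>v\<close> to \<open>u\<close>. This reduces the claim to the sum over
  all reflections that cut the cycle of \<open>k\<close>, which is a convolution recurrence for the two weight
  sequences. Summing over the cycle that contains a given point turns the enumeration of the ideal
  into a linear differential equation, which the right-hand side satisfies.

  The absolute length is controlled through the odd functions \<open>\<int> \<rightarrow> \<int>/3\<close> invariant under \<open>w\<close>: they
  form a space of dimension \<open>n - \<ell>(w)\<close>.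
\<close>

text \<open>The obstacle is that a reflection can lower the absolute length in two ways: by cutting
  a cycle, or by joining two balanced cycles into one paired cycle. Only cuts fit weights that are
  products over cycles. A joining needs two balanced cycles, so it never occurs below a Coxeter
  element: the ideal consists exactly of the elements with at most one balanced cycle, and inside it
  lowering the length by a reflection and cutting a cycle are the same thing. The weights originate
  in the intervals below a single cycle, which are the noncrossing partition lattices of types A and
  B: their Moebius numbers are signed Catalan numbers and signed binomials. The quadratic equation
  of the Catalan series and its linear companion for the binomials say that the weights of a cycle
  and of all its cuts cancel. In the final formula the square root times the exponential collects
  the paired cycles, of which there may be any number. The last factor collects the at most one
  balanced cycle, and is therefore 1 plus a series rather than an exponential.\<close>

section \<open>Signed sets, signed permutations and reflections\<close>

definition signed_set :: "int set \<Rightarrow> bool" where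
  "signed_set D \<longleftrightarrow> finite D \<and> 0 \<notin> D \<and> (\<forall>i\<in>D. - i \<in> D)"

definition signed_perms :: "int set \<Rightarrow> (int \<Rightarrow> int) set" where
  "signed_perms D = {w. w permutes D \<and> (\<forall>i. w (- i) = - w i)}"

text \<open>One formula for all reflections: a paired transposition in general, the sign change of
  \<open>a\<close> if \<open>b = - a\<close>, and the identity if \<open>b = a\<close>. The guard
  for 0 makes it an odd involution for all arguments.\<close>

definition signed_swap :: "int \<Rightarrow> int \<Rightarrow> int \<Rightarrow> int" where
  "signed_swap a b i =
     (if a = 0 \<or> b = 0 then i else if i = a then b else if i = b then a
      else if i = - a then - b else if i = - b then - a else i)"

lemma signed_set_neg_iff: "signed_set D \<Longrightarrow> - i \<in> D \<longleftrightarrow> i \<in> D"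
  unfolding signed_set_def by (metis minus_minus)

lemma signed_set_nz: "signed_set D \<Longrightarrow> i \<in> D \<Longrightarrow> i \<noteq> 0 \<and> i \<noteq> - i \<and> - i \<noteq> i"
  unfolding signed_set_def by auto

lemma signed_set_points: "signed_set (signed_points n)"
  unfolding signed_set_def signed_points_def by auto

lemma hyperoctahedral_eq: "hyperoctahedral n = signed_perms (signed_points n)"
proof -
  have "w (- i) = - w i"
    if "w permutes signed_points n" "\<forall>i\<in>signed_points n. w (- i) = - w i" for w i
  proof (cases "i \<in> signed_points n")
    case False
    then have "- i \<notin> signed_points n" using signed_set_neg_iff[OF signed_set_points] by blast
    then show ?thesis using False that(1) by (simp add: permutes_def)
  qed (use that in auto)
  then show ?thesis unfolding hyperoctahedral_def signed_perms_def by blast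
qed

lemma signed_permsD:
  assumes "w \<in> signed_perms D"
  shows "w permutes D" "w (- i) = - w i" "i \<notin> D \<Longrightarrow> w i = i" "bij w" "w i = w j \<longleftrightarrow> i = j"
    "w i \<in> D \<longleftrightarrow> i \<in> D"
  using assms unfolding signed_perms_def
  by (auto simp: permutes_not_in permutes_bij permutes_inj[THEN inj_eq] permutes_in_image)

lemma id_signed_perms: "id \<in> signed_perms D"
  by (simp add: signed_perms_def permutes_id)

lemma comp_signed_perms: "u \<in> signed_perms D \<Longrightarrow> v \<in> signed_perms D \<Longrightarrow> u \<circ> v \<in> signed_perms D"
  by (auto simp: signed_perms_def intro: permutes_compose)

lemma inv_signed_perms:
  assumes "u \<in> signed_perms D" shows "inv u \<in> signed_perms D"
proof -
  have "inv u (- i) = - inv u i" for i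
    using signed_permsD[OF assms] by (metis bij_inv_eq_iff)
  then show ?thesis using permutes_inv[OF signed_permsD(1)[OF assms]] by (simp add: signed_perms_def)
qed

lemma signed_perms_inv_comp:
  assumes "u \<in> signed_perms D" shows "u \<circ> inv u = id" "inv u \<circ> u = id"
  using permutes_inv_o[OF signed_permsD(1)[OF assms]] by auto

lemma finite_signed_perms: "signed_set D \<Longrightarrow> finite (signed_perms D)"
  by (rule finite_subset[of _ "{w. w permutes D}"])
     (auto simp: signed_perms_def signed_set_def finite_permutations)

lemma signed_perms_mono: "D \<subseteq> E \<Longrightarrow> signed_perms D \<subseteq> signed_perms E"
  by (auto simp: signed_perms_def intro: permutes_subset)

lemma signed_swap_same: "signed_swap a a = id"
  by (auto simp: signed_swap_def fun_eq_iff)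

lemma signed_swap_involution: "signed_swap a b (signed_swap a b i) = i"
  by (auto simp: signed_swap_def)

lemma signed_swap_swap [simp]: "signed_swap a b \<circ> signed_swap a b = id"
  by (auto simp: signed_swap_involution)

lemma signed_swap_swap_left: "signed_swap a b \<circ> (signed_swap a b \<circ> u) = u"
  by (auto simp: signed_swap_involution)

lemma signed_swap_odd: "signed_swap a b (- i) = - signed_swap a b i"
  by (auto simp: signed_swap_def)

lemma signed_swap_commute: "signed_swap a b = signed_swap b a"
  by (auto simp: signed_swap_def fun_eq_iff)

lemma signed_swap_minus: "signed_swap (- a) (- b) = signed_swap a b"
  by (auto simp: signed_swap_def fun_eq_iff)

lemma signed_swap_left [simp]: "a \<noteq> 0 \<Longrightarrow> b \<noteq> 0 \<Longrightarrow> signed_swap a b a = b"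
  by (auto simp: signed_swap_def)

lemma signed_swap_right [simp]: "a \<noteq> 0 \<Longrightarrow> b \<noteq> 0 \<Longrightarrow> signed_swap a b b = a"
  by (auto simp: signed_swap_def)

lemma signed_swap_other:
  "i \<noteq> a \<Longrightarrow> i \<noteq> - a \<Longrightarrow> i \<noteq> b \<Longrightarrow> i \<noteq> - b \<Longrightarrow> signed_swap a b i = i"
  by (auto simp: signed_swap_def)

lemma bij_signed_swap: "bij (signed_swap a b)"
  by (rule o_bij[of "signed_swap a b"]) auto

lemma signed_swap_signed_perms:
  assumes "signed_set D" "a \<in> D" "b \<in> D" shows "signed_swap a b \<in> signed_perms D"
proof -
  have "signed_swap a b i = i" if "i \<notin> D" for i
    using that assms signed_set_neg_iff[OF assms(1)] by (auto simp: signed_swap_def)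
  then have "signed_swap a b permutes D"
    unfolding permutes_def by (metis signed_swap_involution)
  then show ?thesis by (simp add: signed_perms_def signed_swap_odd)
qed

lemma conj_signed_swap:
  assumes "\<And>i. w (- i) = - w i" "inj w"
  shows "w \<circ> signed_swap a b = signed_swap (w a) (w b) \<circ> w"
proof -
  have "w 0 = 0" using assms(1)[of 0] by simp
  then have "w x = 0 \<longleftrightarrow> x = 0" for x using inj_eq[OF assms(2), of x 0] by simp
  moreover have "w i = - w x \<longleftrightarrow> i = - x" for i x
    using inj_eq[OF assms(2), of i "- x"] assms(1) by simp
  ultimately show ?thesis
    by (simp add: signed_swap_def fun_eq_iff inj_eq[OF assms(2)] assms(1))
qed

lemma conj_signed_swap_signed_perms:
  "w \<in> signed_perms D \<Longrightarrow> w \<circ> signed_swap a b = signed_swap (w a) (w b) \<circ> w"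
  by (rule conj_signed_swap) (auto simp: signed_permsD bij_is_inj)

text \<open>Exchanging \<open>a\<close> and \<open>b\<close>, or negating both, does not change the
  reflection, so one may assume that \<open>a\<close> is positive and at most the absolute value of
  \<open>b\<close>. The three families are then \<open>b = - a\<close>, \<open>b > a\<close> and
  \<open>- b > a\<close>.\<close>

lemma reflections_eq:
  "reflections n = {signed_swap a b | a b. a \<in> signed_points n \<and> b \<in> signed_points n \<and> a \<noteq> b}"
    (is "_ = ?R")
proof -
  have b: "balanced_cycle [i] = signed_swap i (- i)" for i
    by (auto simp: balanced_cycle_def signed_swap_def fun_eq_iff transpose_def)
  have p: "paired_cycle [i, j] = signed_swap i j" if "i \<noteq> 0" "j \<noteq> 0" "i \<noteq> j" "i \<noteq> - j" for i j
    using that by (auto simp: paired_cycle_def signed_swap_def fun_eq_iff transpose_def)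
  have 1: "reflections n \<subseteq> ?R"
  proof
    fix s assume "s \<in> reflections n"
    then consider i where "s = balanced_cycle [i]" "1 \<le> i" "i \<le> int n"
      | i j where "s = paired_cycle [i, j]" "1 \<le> i" "i < j" "j \<le> int n"
      | i j where "s = paired_cycle [i, - j]" "1 \<le> i" "i < j" "j \<le> int n"
      unfolding reflections_def by blast
    then show "s \<in> ?R"
    proof cases
      case 1
      then show ?thesis unfolding b signed_points_def by fastforce
    next
      case 2
      then have "s = signed_swap i j" using p by auto
      then show ?thesis using 2 unfolding signed_points_def by fastforce
    next
      case 3
      then have "s = signed_swap i (- j)" using p[of i "- j"] by auto
      then show ?thesis using 3 unfolding signed_points_def by fastforce
    qed
  qed
  have 2: "signed_swap a b \<in> reflections n"
    if "1 \<le> a" "a \<le> int n" "b \<in> signed_points n" "a \<le> \<bar>b\<bar>" "a \<noteq> b" for a b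
  proof (cases "b = - a")
    case True
    then show ?thesis using that b unfolding reflections_def by auto
  next
    case nb: False
    then have lt: "a < \<bar>b\<bar>" using that by (auto simp: abs_if split: if_splits)
    show ?thesis
    proof (cases "b > 0")
      case True
      then have "signed_swap a b = paired_cycle [a, b]" using p[of a b] that nb by auto
      moreover have "1 \<le> a" "a < b" "b \<le> int n" using that True lt unfolding signed_points_def by auto
      ultimately show ?thesis unfolding reflections_def by blast
    next
      case False
      then have "signed_swap a b = paired_cycle [a, - (- b)]" using p[of a b] that nb
        unfolding signed_points_def by auto
      moreover have "a < - b" "- b \<le> int n" using that False lt unfolding signed_points_def by auto
      ultimately show ?thesis using that unfolding reflections_def by blast
    qed
  qed
  have 3: "signed_swap a b \<in> reflections n"
    if "a \<in> signed_points n" "b \<in> signed_points n" "\<bar>a\<bar> \<le> \<bar>b\<bar>" "a \<noteq> b" for a b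
  proof (cases "a > 0")
    case True
    then show ?thesis using that 2[of a b] unfolding signed_points_def by auto
  next
    case False
    then have "signed_swap (- a) (- b) \<in> reflections n"
      using that by (intro 2) (auto simp: signed_points_def)
    then show ?thesis by (simp add: signed_swap_minus)
  qed
  have "?R \<subseteq> reflections n"
    using 3 signed_swap_commute by (smt (verit) mem_Collect_eq subsetI)
  with 1 show ?thesis by blast
qed

section \<open>Absolute length\<close>

text \<open>Over a finite field a dimension can be read off from a cardinality, a power of 3 here,
  without linear algebra. Characteristic other than 2 is essential: on a balanced cycle a value
  equals its own negative and must vanish, so only the paired cycles contribute to the
  dimension.\<close>

definition odd_fix :: "int set \<Rightarrow> (int \<Rightarrow> int) \<Rightarrow> (int \<Rightarrow> 3) set" where
  "odd_fix D w = {\<phi>. (\<forall>i. \<phi> (- i) = - \<phi> i) \<and> (\<forall>i. i \<notin> D \<longrightarrow> \<phi> i = 0) \<and> (\<forall>i. \<phi> (w i) = \<phi> i)}"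

lemma three_torsion_free: "a + a = 0 \<longleftrightarrow> a = 0" for a :: 3
proof -
  have "a + a + a = 3 * a" by (simp add: algebra_simps)
  also have "(3 :: 3) = 0" by simp
  finally have "a + a + a = 0" by simp
  then show ?thesis by (metis add_0)
qed

lemma three_eq_minus_iff: "a = - a \<longleftrightarrow> a = 0" for a :: 3
  using three_torsion_free[of a] by (metis add.right_inverse neg_equal_0_iff_equal)

lemma finite_odd_fix: assumes "finite D" shows "finite (odd_fix D w)"
proof -
  have "finite {\<phi>. \<forall>i. (i \<in> D \<longrightarrow> \<phi> i \<in> (UNIV :: 3 set)) \<and> (i \<notin> D \<longrightarrow> \<phi> i = 0)}"
    by (rule finite_set_of_finite_funs) (use assms in auto)
  then show ?thesis by (rule finite_subset[rotated]) (auto simp: odd_fix_def)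
qed

lemma card_odd_fix_pos: assumes "finite D" shows "card (odd_fix D w) > 0"
proof -
  have "(\<lambda>_. 0) \<in> odd_fix D w" by (simp add: odd_fix_def)
  then show ?thesis using finite_odd_fix[OF assms] by (auto simp: card_gt_0_iff)
qed

text \<open>The difference of the values at \<open>a\<close> and \<open>b\<close> is a linear
  functional with three possible values, and each nonempty fibre is a translate of its
  kernel.\<close>

lemma card_odd_fix_le_eq_values:
  assumes "finite D"
  shows "card (odd_fix D w) \<le> 3 * card {\<phi> \<in> odd_fix D w. \<phi> a = \<phi> b}" (is "_ \<le> 3 * card ?E")
proof -
  let ?F = "\<lambda>c. {\<phi> \<in> odd_fix D w. \<phi> a - \<phi> b = c}"
  have fin: "finite (?F c)" for c using finite_odd_fix[OF assms] by simp
  have "odd_fix D w = (\<Union>c. ?F c)" by auto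
  then have "card (odd_fix D w) = card (\<Union>c. ?F c)" by simp
  also have "\<dots> \<le> (\<Sum>c\<in>UNIV. card (?F c))"
    by (rule card_UN_le) simp
  also have "\<dots> \<le> (\<Sum>c\<in>(UNIV :: 3 set). card ?E)"
  proof (rule sum_mono)
    fix c :: 3
    show "card (?F c) \<le> card ?E"
    proof (cases "?F c = {}")
      case False
      then obtain \<psi> where \<psi>: "\<psi> \<in> ?F c" by blast
      show ?thesis
      proof (rule card_inj_on_le[where f = "\<lambda>\<phi> i. \<phi> i - \<psi> i"])
        show "inj_on (\<lambda>\<phi> i. \<phi> i - \<psi> i) (?F c)"
          by (auto simp: inj_on_def fun_eq_iff)
        show "(\<lambda>\<phi> i. \<phi> i - \<psi> i) ` ?F c \<subseteq> ?E"
          using \<psi> by (auto simp: odd_fix_def algebra_simps)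
        show "finite ?E" using finite_odd_fix[OF assms] by simp
      qed
    qed (simp only: card.empty le0)
  qed
  finally show ?thesis by simp
qed

lemma odd_fix_swap_invariant:
  "\<phi> \<in> odd_fix D w \<Longrightarrow> \<phi> a = \<phi> b \<Longrightarrow> \<phi> (signed_swap a b i) = \<phi> i"
  by (auto simp: odd_fix_def signed_swap_def)

text \<open>Invariant functions that agree at \<open>a\<close> and \<open>b\<close> stay invariant
  after composition with the reflection, and they form a subspace of codimension at most one. So a
  reflection lowers the dimension by at most one.\<close>

lemma card_odd_fix_swap_comp:
  assumes "finite D"
  shows "card (odd_fix D w) \<le> 3 * card (odd_fix D (signed_swap a b \<circ> w))"
proof -
  have "card (odd_fix D w) \<le> 3 * card {\<phi> \<in> odd_fix D w. \<phi> a = \<phi> b}"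
    by (rule card_odd_fix_le_eq_values[OF assms])
  also have "card {\<phi> \<in> odd_fix D w. \<phi> a = \<phi> b} \<le> card (odd_fix D (signed_swap a b \<circ> w))"
  proof (rule card_mono[OF finite_odd_fix[OF assms]], clarify)
    fix \<phi> assume "\<phi> \<in> odd_fix D w" "\<phi> a = \<phi> b"
    then show "\<phi> \<in> odd_fix D (signed_swap a b \<circ> w)"
      using odd_fix_swap_invariant[of \<phi> D w a b] by (simp add: odd_fix_def)
  qed
  finally show ?thesis by simp
qed

text \<open>The element \<open>signed_swap n (v n) \<circ> v\<close> fixes \<open>n\<close>, so the value of an invariant function
  at \<open>n\<close> is free for it, whereas for \<open>v\<close> it is forced to be the value at \<open>v n\<close>.\<close>

lemma card_odd_fix_remove_point:
  assumes D: "signed_set D" and v: "v \<in> signed_perms D" and n: "v n \<noteq> n"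
  shows "card (odd_fix D (signed_swap n (v n) \<circ> v)) = 3 * card (odd_fix D v)"
proof -
  define j where "j = v n"
  define w where "w = signed_swap n j \<circ> v"
  have vo: "v (- i) = - v i" for i by (rule signed_permsD(2)[OF v])
  have vj: "v i = v k \<longleftrightarrow> i = k" for i k by (rule signed_permsD(5)[OF v])
  have nD: "n \<in> D" using n signed_permsD(3)[OF v] by blast
  then have jD: "j \<in> D" using signed_permsD(6)[OF v] j_def by simp
  have nz: "n \<noteq> 0" "n \<noteq> - n" "- n \<noteq> n" "j \<noteq> 0" "j \<noteq> - j"
    using signed_set_nz[OF D] nD jD by auto
  have jn: "j \<noteq> n" using n j_def by simp
  have wP: "w \<in> signed_perms D"
    unfolding w_def by (intro comp_signed_perms signed_swap_signed_perms D nD jD v)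
  have wn: "w n = n" "w (- n) = - n"
    using signed_permsD(2)[OF wP, of n] by (simp_all add: w_def vo signed_swap_odd nz(1,4) flip: j_def)
  have wi: "w i = n \<longleftrightarrow> i = n" "w i = - n \<longleftrightarrow> i = - n" for i
    using wn signed_permsD(5)[OF wP] by metis+
  define ext where "ext = (\<lambda>(\<phi> :: int \<Rightarrow> 3, c). \<phi>(n := c, - n := - c))"
  have "bij_betw ext (odd_fix D v \<times> UNIV) (odd_fix D w)"
  proof (rule bij_betwI')
    fix x y assume x: "x \<in> odd_fix D v \<times> (UNIV :: 3 set)" and y: "y \<in> odd_fix D v \<times> (UNIV :: 3 set)"
    obtain \<phi> c \<psi> d where xy: "x = (\<phi>, c)" "y = (\<psi>, d)" by (cases x, cases y)
    have o: "\<phi> (- i) = - \<phi> i" "\<psi> (- i) = - \<psi> i" "\<phi> (v i) = \<phi> i" "\<psi> (v i) = \<psi> i" for i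
      using x y xy by (auto simp: odd_fix_def)
    have e: "\<phi> n = \<phi> j" "\<psi> n = \<psi> j" using o(3,4)[of n] by (auto simp: j_def)
    show "(ext x = ext y) = (x = y)"
    proof
      assume "ext x = ext y"
      then have eq: "(\<phi>(n := c, - n := - c)) i = (\<psi>(n := d, - n := - d)) i" for i
        by (simp add: ext_def xy)
      have "c = d" using eq[of n] nz by (simp split: if_splits)
      moreover have off: "\<phi> i = \<psi> i" if "i \<noteq> n" "i \<noteq> - n" for i using eq[of i] that by simp
      \<comment> \<open>The value at \<open>n\<close> was overwritten by \<open>ext\<close>.
        Invariance under \<open>v\<close> recovers it from the value at \<open>j\<close>; if
        \<open>j = - n\<close>, it equals its own negative and is 0.\<close>
      moreover have "\<phi> n = \<psi> n"
      proof (cases "j = - n")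
        case True
        then have "\<phi> n = 0" "\<psi> n = 0" using e o by (metis three_eq_minus_iff)+
        then show ?thesis by simp
      next
        case False
        then show ?thesis using off[of j] jn e by simp
      qed
      moreover have "\<phi> (- n) = \<psi> (- n)" using calculation(3) o by simp
      ultimately show "x = y" unfolding xy prod.inject fun_eq_iff by metis
    qed simp
  next
    fix x assume x: "x \<in> odd_fix D v \<times> (UNIV :: 3 set)"
    obtain \<phi> c where xy: "x = (\<phi>, c)" by (cases x)
    have o: "\<phi> (- i) = - \<phi> i" "\<phi> (v i) = \<phi> i" "i \<notin> D \<Longrightarrow> \<phi> i = 0" for i
      using x xy by (auto simp: odd_fix_def)
    have e: "\<phi> n = \<phi> j" using o(2)[of n] by (auto simp: j_def)
    have m: "\<phi> (w i) = \<phi> i" for i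
      unfolding w_def using odd_fix_swap_invariant[of \<phi> D v n j] e x xy o(2) by simp
    show "ext x \<in> odd_fix D w"
      using nz nD signed_set_neg_iff[OF D, of n] m o by (auto simp: ext_def xy odd_fix_def wn wi)
  next
    fix \<psi> assume p: "\<psi> \<in> odd_fix D w"
    \<comment> \<open>The only value at \<open>n\<close> that makes the function
      \<open>v\<close>-invariant: the one at \<open>j\<close>, which has to be 0 when
      \<open>j = - n\<close>.\<close>
    define c where "c = (if j = - n then 0 else \<psi> j)"
    define \<phi> where "\<phi> = \<psi>(n := c, - n := - c)"
    have o: "\<psi> (- i) = - \<psi> i" "\<psi> (w i) = \<psi> i" "i \<notin> D \<Longrightarrow> \<psi> i = 0" for i
      using p by (auto simp: odd_fix_def)
    have "\<phi> (- i) = - \<phi> i" for i using o nz by (auto simp: \<phi>_def)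
    moreover have "\<phi> i = 0" if "i \<notin> D" for i
      using that o nD signed_set_neg_iff[OF D, of n] by (auto simp: \<phi>_def)
    moreover have w\<phi>: "\<phi> (w i) = \<phi> i" for i using o by (auto simp: \<phi>_def wn wi)
    ultimately have "\<phi> \<in> odd_fix D w" by (simp add: odd_fix_def)
    moreover have "\<phi> n = \<phi> j" using nz jn by (auto simp: \<phi>_def c_def)
    ultimately have "\<phi> (signed_swap n j i) = \<phi> i" for i using odd_fix_swap_invariant by blast
    then have "\<phi> (v i) = \<phi> i" for i
      using w\<phi>[of i] by (simp add: w_def)
    then have "\<phi> \<in> odd_fix D v" using \<open>\<phi> \<in> odd_fix D w\<close> by (simp add: odd_fix_def)
    moreover have "ext (\<phi>, \<psi> n) = \<psi>" using o nz by (auto simp: ext_def \<phi>_def fun_eq_iff)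
    ultimately show "\<exists>x\<in>odd_fix D v \<times> UNIV. \<psi> = ext x" by (metis SigmaI UNIV_I)
  qed
  then have "card (odd_fix D w) = card (odd_fix D v \<times> (UNIV :: 3 set))"
    by (metis bij_betw_same_card)
  then show ?thesis by (simp add: w_def j_def card_cartesian_product)
qed

section \<open>Words in the reflections and the length formula\<close>

lemma foldr_comp_append: "foldr (\<circ>) (xs @ ys) id = foldr (\<circ>) xs id \<circ> foldr (\<circ>) ys id"
  by (induction xs) (auto simp: o_assoc)

lemma card_odd_fix_foldr:
  assumes "set ts \<subseteq> reflections n"
  shows "card (odd_fix (signed_points n) id)
    \<le> 3 ^ length ts * card (odd_fix (signed_points n) (foldr (\<circ>) ts id))"
  using assms
proof (induction ts)
  case (Cons t ts)
  let ?D = "signed_points n"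
  from Cons.prems obtain a b where t: "t = signed_swap a b" by (auto simp: reflections_eq)
  have fin: "finite ?D" using signed_set_points by (auto simp: signed_set_def)
  have "card (odd_fix ?D id) \<le> 3 ^ length ts * card (odd_fix ?D (foldr (\<circ>) ts id))"
    using Cons.prems by (intro Cons.IH) simp
  also have "\<dots> \<le> 3 ^ length ts * (3 * card (odd_fix ?D (t \<circ> foldr (\<circ>) ts id)))"
    unfolding t by (intro mult_le_mono order_refl card_odd_fix_swap_comp[OF fin])
  also have "\<dots> = 3 ^ length (t # ts) * card (odd_fix ?D (foldr (\<circ>) (t # ts) id))"
    by simp
  finally show ?case .
qed simp

text \<open>Detaching a moved point \<open>k\<close> by the reflection of \<open>k\<close> and
  \<open>w k\<close> creates no new moved point and raises the dimension by exactly one. Repeating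
  this down to the identity gives a word whose length meets the lower bound of
  \<open>card_odd_fix_foldr\<close>.\<close>

lemma ex_reduced_word:
  assumes "w \<in> signed_perms (signed_points n)"
  shows "\<exists>ts. set ts \<subseteq> reflections n \<and> w = foldr (\<circ>) ts id \<and>
    card (odd_fix (signed_points n) id) = 3 ^ length ts * card (odd_fix (signed_points n) w)"
  using assms
proof (induction "card {i. w i \<noteq> i}" arbitrary: w rule: less_induct)
  case less
  let ?D = "signed_points n"
  note w = less.prems
  have D: "signed_set ?D" by (rule signed_set_points)
  show ?case
  proof (cases "w = id")
    case True
    then show ?thesis by (intro exI[of _ "[]"]) auto
  next
    case False
    then obtain k where k: "w k \<noteq> k" by (auto simp: fun_eq_iff)
    let ?s = "signed_swap k (w k)"
    have kD: "k \<in> ?D" "w k \<in> ?D" using k signed_permsD(3,6)[OF w] by auto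
    have sw: "?s \<circ> w \<in> signed_perms ?D"
      by (intro comp_signed_perms signed_swap_signed_perms D kD w)
    have "{i. (?s \<circ> w) i \<noteq> i} \<subset> {i. w i \<noteq> i}"
    proof
      show "{i. (?s \<circ> w) i \<noteq> i} \<subseteq> {i. w i \<noteq> i}"
      proof clarify
        fix i assume i: "(?s \<circ> w) i \<noteq> i" and "w i = i"
        have "w (w k) \<noteq> w k" "w (- k) \<noteq> - k" "w (- w k) \<noteq> - w k"
          using k signed_permsD(5,2)[OF w] by simp_all
        with k \<open>w i = i\<close> have "i \<noteq> k" "i \<noteq> w k" "i \<noteq> - k" "i \<noteq> - w k" by auto
        then show False using i \<open>w i = i\<close> by (simp add: signed_swap_other)
      qed
      have "(?s \<circ> w) k = k" using signed_set_nz[OF D] kD by simp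
      then show "{i. (?s \<circ> w) i \<noteq> i} \<noteq> {i. w i \<noteq> i}" using k by blast
    qed
    moreover have "finite {i. w i \<noteq> i}"
      using D signed_permsD(3)[OF w] by (auto simp: signed_set_def intro: finite_subset[of _ ?D])
    ultimately have "card {i. (?s \<circ> w) i \<noteq> i} < card {i. w i \<noteq> i}" by (rule psubset_card_mono[rotated])
    from less.hyps[OF this sw] obtain ts where ts: "set ts \<subseteq> reflections n"
      "?s \<circ> w = foldr (\<circ>) ts id"
      "card (odd_fix ?D id) = 3 ^ length ts * card (odd_fix ?D (?s \<circ> w))" by blast
    have "w = ?s \<circ> (?s \<circ> w)" by (simp add: signed_swap_swap_left)
    then have "w = foldr (\<circ>) (?s # ts) id" using ts by simp
    moreover have "?s \<in> reflections n" using kD not_sym[OF k] unfolding reflections_eq by blast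
    moreover have "card (odd_fix ?D (?s \<circ> w)) = 3 * card (odd_fix ?D w)"
      by (rule card_odd_fix_remove_point[OF D w k])
    ultimately show ?thesis using ts by (intro exI[of _ "?s # ts"]) auto
  qed
qed

lemma abs_length_foldr_le: "set ts \<subseteq> reflections n \<Longrightarrow> abs_length n (foldr (\<circ>) ts id) \<le> length ts"
  unfolding abs_length_def by (rule Least_le) auto

lemma abs_length_word:
  assumes "w \<in> signed_perms (signed_points n)"
  obtains ts where "length ts = abs_length n w" "set ts \<subseteq> reflections n" "w = foldr (\<circ>) ts id"
proof -
  have "\<exists>k ts. length ts = k \<and> set ts \<subseteq> reflections n \<and> w = foldr (\<circ>) ts id"
    using ex_reduced_word[OF assms] by blast
  from LeastI_ex[OF this] that show ?thesis unfolding abs_length_def by blast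
qed

lemma card_odd_fix_abs_length:
  assumes w: "w \<in> signed_perms (signed_points n)"
  shows "3 ^ abs_length n w * card (odd_fix (signed_points n) w) = card (odd_fix (signed_points n) id)"
    (is "_ * ?c = ?K")
proof (rule antisym)
  obtain ts where ts: "set ts \<subseteq> reflections n" "w = foldr (\<circ>) ts id" "?K = 3 ^ length ts * ?c"
    using ex_reduced_word[OF w] by blast
  have "abs_length n w \<le> length ts" using abs_length_foldr_le[OF ts(1)] ts(2) by simp
  then show "3 ^ abs_length n w * ?c \<le> ?K" using ts(3) by (simp add: power_increasing)
  show "?K \<le> 3 ^ abs_length n w * ?c"
    by (rule abs_length_word[OF w]) (metis card_odd_fix_foldr)
qed

lemma abs_length_remove_point:
  assumes v: "v \<in> signed_perms (signed_points n)" and k: "v k \<noteq> k"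
  shows "abs_length n v = Suc (abs_length n (signed_swap k (v k) \<circ> v))"
proof -
  let ?D = "signed_points n" and ?w = "signed_swap k (v k) \<circ> v"
  have D: "signed_set ?D" by (rule signed_set_points)
  have kD: "k \<in> ?D" "v k \<in> ?D" using k signed_permsD(3,6)[OF v] by auto
  have w: "?w \<in> signed_perms ?D"
    by (intro comp_signed_perms signed_swap_signed_perms D kD v)
  have "3 ^ abs_length n v * card (odd_fix ?D v) = 3 ^ abs_length n ?w * (3 * card (odd_fix ?D v))"
    using card_odd_fix_abs_length[OF v] card_odd_fix_abs_length[OF w]
      card_odd_fix_remove_point[OF D v k] by simp
  moreover have "card (odd_fix ?D v) > 0"
    by (rule card_odd_fix_pos) (use D in \<open>simp add: signed_set_def\<close>)
  ultimately have "(3::nat) ^ abs_length n v = 3 ^ Suc (abs_length n ?w)" by simp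
  then show ?thesis by (subst (asm) power_inject_exp) auto
qed

lemma abs_length_remove_point_right:
  assumes v: "v \<in> signed_perms (signed_points n)" and k: "v k \<noteq> k"
  shows "abs_length n v = Suc (abs_length n (v \<circ> signed_swap k (v k)))"
proof -
  have k': "v (v k) \<noteq> v k" using k signed_permsD(5)[OF v] by blast
  have "v \<circ> signed_swap k (v k) = signed_swap (v k) (v (v k)) \<circ> v"
    by (rule conj_signed_swap_signed_perms[OF v])
  then show ?thesis using abs_length_remove_point[OF v k'] by simp
qed

lemma abs_length_comp_le:
  assumes "u \<in> signed_perms (signed_points n)" "v \<in> signed_perms (signed_points n)"
  shows "abs_length n (u \<circ> v) \<le> abs_length n u + abs_length n v"
proof -
  obtain ts where ts: "length ts = abs_length n u" "set ts \<subseteq> reflections n" "u = foldr (\<circ>) ts id"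
    using abs_length_word[OF assms(1)] .
  obtain ss where ss: "length ss = abs_length n v" "set ss \<subseteq> reflections n" "v = foldr (\<circ>) ss id"
    using abs_length_word[OF assms(2)] .
  have "u \<circ> v = foldr (\<circ>) (ts @ ss) id" using ts ss by (simp only: foldr_comp_append)
  then show ?thesis using abs_length_foldr_le[of "ts @ ss" n] ts ss by simp
qed

lemma abs_length_id: "abs_length n id = 0"
  using abs_length_foldr_le[of "[]" n] by simp

lemma abs_length_eq_0:
  assumes "w \<in> signed_perms (signed_points n)" "abs_length n w = 0" shows "w = id"
  using abs_length_word[OF assms(1)] assms(2) by (metis foldr.simps(1) id_apply length_0_conv)

lemma abs_length_swap:
  assumes "a \<in> signed_points n" "b \<in> signed_points n"
  shows "abs_length n (signed_swap a b) \<le> 1"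
proof (cases "a = b")
  case True
  then show ?thesis by (simp add: signed_swap_same abs_length_id)
next
  case False
  then show ?thesis using abs_length_foldr_le[of "[signed_swap a b]" n] assms
    by (auto simp: reflections_eq)
qed

text \<open>If the reflection lowers the length, it raises the dimension by one. The invariants of
  the product that agree at \<open>a\<close> and \<open>b\<close> lose at most this one dimension
  and are invariant under \<open>u\<close>, so by counting they exhaust the invariants of
  \<open>u\<close>.\<close>

lemma abs_length_comp_swap_imp_values_eq:
  assumes u: "u \<in> signed_perms (signed_points n)" and ab: "a \<in> signed_points n" "b \<in> signed_points n"
    and l: "Suc (abs_length n (u \<circ> signed_swap a b)) = abs_length n u"
    and \<phi>: "\<phi> \<in> odd_fix (signed_points n) u"
  shows "\<phi> a = \<phi> b"
proof -
  let ?D = "signed_points n" and ?s = "signed_swap a b"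
  let ?E = "{\<phi> \<in> odd_fix ?D u. \<phi> a = \<phi> b}" and ?E' = "{\<phi> \<in> odd_fix ?D (u \<circ> ?s). \<phi> a = \<phi> b}"
  have D: "signed_set ?D" and fin: "finite ?D"
    using signed_set_points by (auto simp: signed_set_def)
  have us: "u \<circ> ?s \<in> signed_perms ?D"
    by (intro comp_signed_perms signed_swap_signed_perms D ab u)
  have "3 ^ abs_length n (u \<circ> ?s) * card (odd_fix ?D (u \<circ> ?s))
      = 3 ^ abs_length n (u \<circ> ?s) * (3 * card (odd_fix ?D u))"
    using card_odd_fix_abs_length[OF u] card_odd_fix_abs_length[OF us]
    by (simp flip: l)
  then have "3 * card (odd_fix ?D u) = card (odd_fix ?D (u \<circ> ?s))" by simp
  also have "\<dots> \<le> 3 * card ?E'" by (rule card_odd_fix_le_eq_values[OF fin])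
  also have "card ?E' \<le> card ?E"
  proof (rule card_mono)
    show "finite ?E" using finite_odd_fix[OF fin] by simp
    show "?E' \<subseteq> ?E"
    proof clarify
      fix \<psi> assume p: "\<psi> \<in> odd_fix ?D (u \<circ> ?s)" and e: "\<psi> a = \<psi> b"
      have inv: "\<psi> (u i) = \<psi> i" for i
      proof -
        have "\<psi> (u i) = \<psi> ((u \<circ> ?s) (?s i))" by (simp add: signed_swap_involution)
        also have "\<dots> = \<psi> (?s i)" using p by (simp add: odd_fix_def)
        also have "\<dots> = \<psi> i" by (rule odd_fix_swap_invariant[OF p e])
        finally show ?thesis .
      qed
      show "\<psi> \<in> odd_fix ?D u" using p inv by (simp add: odd_fix_def)
    qed
  qed
  finally have le: "card (odd_fix ?D u) \<le> card ?E" by simp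
  have "?E = odd_fix ?D u"
    by (rule card_seteq[OF finite_odd_fix[OF fin] _ le]) blast
  then show ?thesis using \<phi> by blast
qed

section \<open>Signed cycles\<close>

text \<open>The flag is True for balanced cycles. A cycle is defined by its factorisation into
  reflections of neighbouring entries, closed by the sign change of the last entry in the balanced
  case; cutting identities thus become conjugation of reflections.\<close>

fun signed_cycle :: "bool \<Rightarrow> int list \<Rightarrow> int \<Rightarrow> int" where
  "signed_cycle \<beta> [] = id"
| "signed_cycle \<beta> [a] = (if \<beta> then signed_swap a (- a) else id)"
| "signed_cycle \<beta> (a # b # bs) = signed_swap a b \<circ> signed_cycle \<beta> (b # bs)"

definition abs_distinct :: "int list \<Rightarrow> bool" where
  "abs_distinct as \<longleftrightarrow> distinct (map abs as) \<and> 0 \<notin> set as"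

definition signed_support :: "int list \<Rightarrow> int set" where
  "signed_support as = set as \<union> uminus ` set as"

lemma abs_distinct_Nil [simp]: "abs_distinct []"
  by (simp add: abs_distinct_def)

lemma mem_signed_support: "i \<in> signed_support as \<longleftrightarrow> i \<in> set as \<or> - i \<in> set as"
  unfolding signed_support_def by (auto simp: image_iff) (metis minus_minus)

lemma signed_support_Cons: "signed_support (a # as) = {a, - a} \<union> signed_support as"
  by (auto simp: signed_support_def)

lemma signed_support_append: "signed_support (as @ bs) = signed_support as \<union> signed_support bs"
  by (auto simp: signed_support_def)

lemma signed_support_Nil [simp]: "signed_support [] = {}"
  by (simp add: signed_support_def)

lemma signed_support_minus: "signed_support (map uminus as) = signed_support as"
  by (auto simp: signed_support_def image_image)

lemma abs_mem_image: "\<bar>a\<bar> \<in> abs ` S \<longleftrightarrow> a \<in> S \<or> - a \<in> S" for a :: int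
  unfolding image_iff by (metis abs_eq_iff abs_minus)

lemma abs_distinct_Cons [simp]:
  "abs_distinct (a # as) \<longleftrightarrow> a \<noteq> 0 \<and> a \<notin> set as \<and> - a \<notin> set as \<and> abs_distinct as"
  by (auto simp: abs_distinct_def abs_mem_image)

lemma abs_distinct_append [simp]:
  "abs_distinct (as @ bs) \<longleftrightarrow>
     abs_distinct as \<and> abs_distinct bs \<and> (\<forall>i\<in>set as. i \<notin> set bs \<and> - i \<notin> set bs)"
  by (induction as) auto

lemma abs_distinct_Cons_minus: "abs_distinct (n # map uminus as) \<longleftrightarrow> abs_distinct (n # as)"
  by (auto simp: abs_distinct_def comp_def image_image simp del: abs_distinct_Cons)

lemma abs_distinct_imp_distinct: "abs_distinct as \<Longrightarrow> distinct as"
  by (induction as) auto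

lemma abs_distinct_neg: "abs_distinct as \<Longrightarrow> i \<in> set as \<Longrightarrow> - i \<notin> set as"
  by (induction as) (auto simp: minus_equation_iff)

lemma distinct_append_minus:
  assumes "abs_distinct as" shows "distinct (as @ map uminus as)"
proof -
  have "set as \<inter> uminus ` set as = {}"
    using abs_distinct_neg[OF assms] by (auto simp: image_iff)
  then show ?thesis using abs_distinct_imp_distinct[OF assms] by (simp add: distinct_map)
qed

lemma signed_set_support: "0 \<notin> set as \<Longrightarrow> signed_set (signed_support as)"
  by (auto simp: signed_set_def signed_support_def)

lemma card_signed_support: "abs_distinct as \<Longrightarrow> card (signed_support as) = 2 * length as"
proof (induction as)
  case (Cons a as)
  then have "a \<notin> signed_support as" "- a \<notin> signed_support as" "a \<noteq> - a"
    by (auto simp: mem_signed_support)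
  moreover have "finite (signed_support as)" by (simp add: signed_support_def)
  ultimately show ?case using Cons by (simp add: signed_support_Cons)
qed simp

lemma signed_set_Diff: "signed_set D \<Longrightarrow> signed_set (D - signed_support as)"
  by (auto simp: signed_set_def mem_signed_support)

lemma signed_support_subset: "signed_set D \<Longrightarrow> set as \<subseteq> D \<Longrightarrow> signed_support as \<subseteq> D"
  by (auto simp: signed_set_def signed_support_def)

section \<open>Signed cycles under conjugation\<close>

lemma signed_cycle_signed_perms:
  assumes "signed_set D" "set as \<subseteq> D" shows "signed_cycle \<beta> as \<in> signed_perms D"
  using assms(2)
proof (induction \<beta> as rule: signed_cycle.induct)
  case (1 \<beta>)
  show "signed_cycle \<beta> [] \<in> signed_perms D" by (simp add: id_signed_perms)
next
  case (2 \<beta> a)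
  then show "signed_cycle \<beta> [a] \<in> signed_perms D"
    using assms(1) signed_set_neg_iff[OF assms(1), of a]
    by (auto simp: id_signed_perms signed_swap_signed_perms)
next
  case (3 \<beta> a b bs)
  then have "signed_cycle \<beta> (b # bs) \<in> signed_perms D" "signed_swap a b \<in> signed_perms D"
    using signed_swap_signed_perms[OF assms(1)] by auto
  then show "signed_cycle \<beta> (a # b # bs) \<in> signed_perms D"
    using comp_signed_perms by simp
qed

lemma bij_signed_cycle: "bij (signed_cycle \<beta> as)"
proof (induction \<beta> as rule: signed_cycle.induct)
  case (1 \<beta>)
  show "bij (signed_cycle \<beta> [])" by simp
next
  case (2 \<beta> a)
  show "bij (signed_cycle \<beta> [a])" by (simp add: bij_signed_swap)
next
  case (3 \<beta> a b bs)
  then show "bij (signed_cycle \<beta> (a # b # bs))"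
    unfolding signed_cycle.simps by (rule bij_comp[OF _ bij_signed_swap])
qed

lemma signed_cycle_outside: "i \<notin> signed_support as \<Longrightarrow> signed_cycle \<beta> as i = i"
  by (induction \<beta> as rule: signed_cycle.induct)
    (auto simp: mem_signed_support signed_swap_def)

lemma signed_cycle_in_support:
  assumes "0 \<notin> set as"
  shows "signed_cycle \<beta> as i \<in> signed_support as \<longleftrightarrow> i \<in> signed_support as"
  by (rule signed_permsD(6), rule signed_cycle_signed_perms[OF signed_set_support[OF assms]])
     (auto simp: signed_support_def)

lemma conj_signed_cycle:
  assumes "\<And>i. w (- i) = - w i" "inj w"
  shows "w \<circ> signed_cycle \<beta> as = signed_cycle \<beta> (map w as) \<circ> w"
proof (induction \<beta> as rule: signed_cycle.induct)
  case (1 \<beta>)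
  show "w \<circ> signed_cycle \<beta> [] = signed_cycle \<beta> (map w []) \<circ> w" by simp
next
  case (2 \<beta> a)
  show "w \<circ> signed_cycle \<beta> [a] = signed_cycle \<beta> (map w [a]) \<circ> w"
    using conj_signed_swap[OF assms, of a "- a"] by (simp add: assms(1))
next
  case (3 \<beta> a b bs)
  have IH: "w \<circ> signed_cycle \<beta> (b # bs) = signed_cycle \<beta> (map w (b # bs)) \<circ> w" by (rule 3)
  have "w \<circ> (signed_swap a b \<circ> signed_cycle \<beta> (b # bs))
      = signed_swap (w a) (w b) \<circ> (w \<circ> signed_cycle \<beta> (b # bs))"
    using conj_signed_swap[OF assms, of a b] by (simp add: o_assoc)
  then show "w \<circ> signed_cycle \<beta> (a # b # bs) = signed_cycle \<beta> (map w (a # b # bs)) \<circ> w"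
    by (simp add: IH) (simp add: o_assoc)
qed

lemma conj_signed_cycle_swap:
  "signed_swap a b \<circ> signed_cycle \<beta> as = signed_cycle \<beta> (map (signed_swap a b) as) \<circ> signed_swap a b"
  by (rule conj_signed_cycle) (auto simp: signed_swap_odd bij_signed_swap bij_is_inj)

lemma signed_cycle_minus: "signed_cycle \<beta> (map uminus as) = signed_cycle \<beta> as"
proof (induction \<beta> as rule: signed_cycle.induct)
  case (1 \<beta>)
  show "signed_cycle \<beta> (map uminus []) = signed_cycle \<beta> []" by simp
next
  case (2 \<beta> a)
  show "signed_cycle \<beta> (map uminus [a]) = signed_cycle \<beta> [a]"
    using signed_swap_commute[of a "- a"] by simp
next
  case (3 \<beta> a b bs)
  have "signed_cycle \<beta> (map uminus (b # bs)) = signed_cycle \<beta> (b # bs)" by (rule 3)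
  then show "signed_cycle \<beta> (map uminus (a # b # bs)) = signed_cycle \<beta> (a # b # bs)"
    by (simp add: signed_swap_minus)
qed

lemma signed_perms_commute_cycle:
  assumes "w \<in> signed_perms E" "E \<inter> signed_support as = {}"
  shows "w \<circ> signed_cycle \<beta> as = signed_cycle \<beta> as \<circ> w"
proof -
  have "map w as = as"
    using assms(2) by (intro map_idI signed_permsD(3)[OF assms(1)]) (auto simp: mem_signed_support)
  then show ?thesis
    using conj_signed_cycle[of w \<beta> as] signed_permsD(2,4)[OF assms(1)] by (simp add: bij_is_inj)
qed

lemma signed_swap_commute_cycle:
  assumes "{a, b, - a, - b} \<inter> signed_support as = {}"
  shows "signed_swap a b \<circ> signed_cycle \<beta> as = signed_cycle \<beta> as \<circ> signed_swap a b"
proof -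
  have "map (signed_swap a b) as = as"
    using assms by (intro map_idI signed_swap_other) (auto simp: mem_signed_support)
  then show ?thesis using conj_signed_cycle_swap[of a b \<beta> as] by simp
qed

lemma map_swap_other:
  assumes "{a, b, - a, - b} \<inter> set as = {}" shows "map (signed_swap a b) as = as"
  using assms by (intro map_idI signed_swap_other) auto

section \<open>Products of a cycle and a reflection of two of its entries\<close>

lemma swap_comp_cycle:
  assumes "abs_distinct (n # a # ys)"
  shows "signed_swap n a \<circ> signed_cycle \<beta> (a # ys) = signed_cycle \<beta> (n # ys) \<circ> signed_swap n a"
proof -
  have "map (signed_swap n a) ys = ys" using assms by (intro map_swap_other) auto
  then show ?thesis using conj_signed_cycle_swap[of n a \<beta> "a # ys"] assms by simp
qed

text \<open>The piece that starts at \<open>n\<close> inherits the flag and the piece that starts at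
  \<open>a\<close> is always paired. By induction on the segment in between: the first factor, the
  reflection of \<open>n\<close> and \<open>x\<close>, is moved to the right, which renames the head
  of one piece and leaves the other alone.\<close>

lemma signed_cycle_split:
  assumes "abs_distinct (n # xs @ a # ys)"
  shows "signed_cycle \<beta> (n # xs @ a # ys)
    = signed_cycle \<beta> (n # ys) \<circ> signed_cycle False (a # xs) \<circ> signed_swap n a"
  using assms
proof (induction xs arbitrary: n)
  case Nil
  then show "signed_cycle \<beta> (n # [] @ a # ys)
    = signed_cycle \<beta> (n # ys) \<circ> signed_cycle False [a] \<circ> signed_swap n a"
    using swap_comp_cycle[of n a ys \<beta>] by simp
next
  case (Cons x xs)
  have IH: "signed_cycle \<beta> (x # xs @ a # ys)
    = signed_cycle \<beta> (x # ys) \<circ> signed_cycle False (a # xs) \<circ> signed_swap x a"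
    by (rule Cons.IH) (use Cons.prems in simp)
  have "signed_cycle \<beta> (n # (x # xs) @ a # ys)
      = signed_swap n x \<circ> signed_cycle \<beta> (x # ys) \<circ> signed_cycle False (a # xs) \<circ> signed_swap x a"
    by (simp add: IH) (simp add: o_assoc)
  also have "\<dots> = signed_cycle \<beta> (n # ys) \<circ> (signed_swap n x \<circ> signed_cycle False (a # xs)) \<circ> signed_swap x a"
    using swap_comp_cycle[of n x ys \<beta>] Cons.prems by (simp add: o_assoc)
  also have "signed_swap n x \<circ> signed_cycle False (a # xs) = signed_cycle False (a # xs) \<circ> signed_swap n x"
    using Cons.prems by (intro signed_swap_commute_cycle) (auto simp: mem_signed_support)
  also have "signed_cycle \<beta> (n # ys) \<circ> (signed_cycle False (a # xs) \<circ> signed_swap n x) \<circ> signed_swap x a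
      = signed_cycle \<beta> (n # ys) \<circ> signed_cycle False (a # xs) \<circ> (signed_swap n x \<circ> signed_swap x a)"
    by (simp add: o_assoc)
  \<comment> \<open>Conjugation by the reflection of \<open>x\<close> and \<open>a\<close>, which
    fixes \<open>n\<close> and sends \<open>a\<close> to \<open>x\<close>.\<close>
  also have "signed_swap n x \<circ> signed_swap x a = signed_swap x a \<circ> signed_swap n a"
  proof -
    have "signed_swap x a n = n" "signed_swap x a a = x"
      using Cons.prems by (auto intro!: signed_swap_other)
    then show ?thesis
      using conj_signed_swap[of "signed_swap x a" n a]
      by (simp add: signed_swap_odd bij_signed_swap bij_is_inj)
  qed
  also have "signed_cycle \<beta> (n # ys) \<circ> signed_cycle False (a # xs) \<circ> (signed_swap x a \<circ> signed_swap n a)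
      = signed_cycle \<beta> (n # ys) \<circ> (signed_cycle False (a # xs) \<circ> signed_swap a x) \<circ> signed_swap n a"
    by (simp add: o_assoc signed_swap_commute)
  also have "signed_cycle False (a # xs) \<circ> signed_swap a x = signed_cycle False (a # x # xs)"
  proof -
    have "abs_distinct (a # x # xs)" using Cons.prems unfolding abs_distinct_def by auto
    then show ?thesis using swap_comp_cycle[of a x xs False] by simp
  qed
  finally show ?case .
qed

lemma signed_cycle_split_same:
  assumes "abs_distinct (n # xs @ a # ys)"
  shows "signed_cycle \<beta> (n # xs @ a # ys) \<circ> signed_swap n a
    = signed_cycle \<beta> (n # ys) \<circ> signed_cycle False (a # xs)"
  unfolding signed_cycle_split[OF assms] by (simp flip: o_assoc)

text \<open>By definition the sign change sits at the last entry; conjugation by the neighbouring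
  reflections carries it to the head.\<close>

lemma balanced_eq_swap_paired:
  assumes "abs_distinct (n # as)"
  shows "signed_cycle True (n # as) = signed_swap n (- n) \<circ> signed_cycle False (n # as)"
  using assms
proof (induction as arbitrary: n)
  case Nil
  show "signed_cycle True [n] = signed_swap n (- n) \<circ> signed_cycle False [n]" by simp
next
  case (Cons a as)
  have IH: "signed_cycle True (a # as) = signed_swap a (- a) \<circ> signed_cycle False (a # as)"
    by (rule Cons.IH) (use Cons.prems in simp)
  have "signed_cycle True (n # a # as)
      = (signed_swap n a \<circ> signed_swap a (- a)) \<circ> signed_cycle False (a # as)"
    by (simp add: IH) (simp add: o_assoc)
  also have "signed_swap n a \<circ> signed_swap a (- a) = signed_swap n (- n) \<circ> signed_swap n a"
    using conj_signed_swap[of "signed_swap n a" a "- a"] Cons.prems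
    by (simp add: signed_swap_odd bij_signed_swap bij_is_inj)
  finally have "signed_cycle True (n # a # as)
      = (signed_swap n (- n) \<circ> signed_swap n a) \<circ> signed_cycle False (a # as)" .
  then show "signed_cycle True (n # a # as)
      = signed_swap n (- n) \<circ> signed_cycle False (n # a # as)"
    by (simp add: o_assoc)
qed

lemma map_swap_neg:
  assumes "abs_distinct (n # as)"
  shows "map (signed_swap n (- n)) (n # as) = - n # as"
  using assms map_swap_other[of n "- n" as] by simp

text \<open>With the sign change applied first, \<open>n\<close> is sent to where the cycle sends
  \<open>- n\<close>. Read from \<open>n\<close>, the remaining entries therefore appear with
  opposite signs.\<close>

lemma paired_comp_neg:
  assumes "abs_distinct (n # as)"
  shows "signed_cycle False (n # as) \<circ> signed_swap n (- n) = signed_cycle True (n # map uminus as)"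
proof -
  have "signed_swap n (- n) \<circ> signed_cycle False (n # as)
      = signed_cycle False (- n # as) \<circ> signed_swap n (- n)" if "abs_distinct (n # as)" for as
    using conj_signed_cycle_swap[of n "- n" False "n # as"] map_swap_neg[OF that] by simp
  from this[of "map uminus as"] assms
  have "signed_cycle True (n # map uminus as) = signed_cycle False (- n # map uminus as) \<circ> signed_swap n (- n)"
    by (simp only: balanced_eq_swap_paired abs_distinct_Cons_minus)
  then show ?thesis using signed_cycle_minus[of False "n # as"] by simp
qed

lemma balanced_comp_neg:
  assumes "abs_distinct (n # as)"
  shows "signed_cycle True (n # as) \<circ> signed_swap n (- n) = signed_cycle False (n # map uminus as)"
proof -
  have "abs_distinct (n # map uminus as)" using assms by (simp only: abs_distinct_Cons_minus)
  from paired_comp_neg[OF this] have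
    "signed_cycle True (n # as) = signed_cycle False (n # map uminus as) \<circ> signed_swap n (- n)"
    by (simp add: comp_def)
  then show ?thesis by (simp flip: o_assoc)
qed

text \<open>A balanced cycle passes through \<open>a\<close> and \<open>- a\<close>, so the
  reflection of \<open>n\<close> and \<open>- a\<close> cuts it as well. The products of the
  reflections at \<open>n\<close>, \<open>a\<close> and at \<open>n\<close>, \<open>- a\<close> and
  of the sign changes of \<open>n\<close> and \<open>a\<close> coincide, so this is the cut at
  \<open>a\<close> followed by a sign change in each piece: the balanced piece becomes paired and
  the paired one balanced.\<close>

lemma signed_cycle_split_opposite:
  assumes d: "abs_distinct (n # xs @ a # ys)"
  shows "signed_cycle True (n # xs @ a # ys) \<circ> signed_swap n (- a)
    = signed_cycle False (n # map uminus ys) \<circ> signed_cycle True (a # map uminus xs)"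
proof -
  have dn: "abs_distinct (n # ys)" and da: "abs_distinct (a # xs)" using d by auto
  have "signed_swap n a \<circ> signed_swap n (- a) = signed_swap n (- n) \<circ> signed_swap a (- a)"
  proof
    fix i
    have nz: "n \<noteq> 0" "a \<noteq> 0" "n \<noteq> a" "n \<noteq> - a" using d by auto
    consider "i = n" | "i = - n" | "i = a" | "i = - a" | "i \<notin> {n, - n, a, - a}" by blast
    then show "(signed_swap n a \<circ> signed_swap n (- a)) i = (signed_swap n (- n) \<circ> signed_swap a (- a)) i"
      by cases (use nz in \<open>simp_all add: signed_swap_def\<close>)
  qed
  then have "signed_cycle True (n # xs @ a # ys) \<circ> signed_swap n (- a)
      = signed_cycle True (n # ys) \<circ> (signed_cycle False (a # xs) \<circ> signed_swap n (- n)) \<circ> signed_swap a (- a)"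
    unfolding signed_cycle_split[OF d] by (simp flip: o_assoc)
  also have "signed_cycle False (a # xs) \<circ> signed_swap n (- n) = signed_swap n (- n) \<circ> signed_cycle False (a # xs)"
    using d by (intro signed_swap_commute_cycle[symmetric]) (auto simp: mem_signed_support)
  also have "signed_cycle True (n # ys) \<circ> (signed_swap n (- n) \<circ> signed_cycle False (a # xs)) \<circ> signed_swap a (- a)
      = (signed_cycle True (n # ys) \<circ> signed_swap n (- n)) \<circ> (signed_cycle False (a # xs) \<circ> signed_swap a (- a))"
    by (simp add: o_assoc)
  finally show ?thesis unfolding balanced_comp_neg[OF dn] paired_comp_neg[OF da] .
qed

text \<open>An unsigned cycle may be rotated. Bringing \<open>- a\<close> to the front lets the
  transposition of \<open>- a\<close> and \<open>- b\<close> be split off, and together with that of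
  \<open>a\<close> and \<open>b\<close> it forms a reflection.\<close>

lemma balanced_cycle_eq:
  "abs_distinct as \<Longrightarrow> balanced_cycle as = signed_cycle True as"
proof (induction True as rule: signed_cycle.induct)
  case 1
  show "balanced_cycle [] = signed_cycle True []" by (simp add: balanced_cycle_def)
next
  case (2 a)
  then show "balanced_cycle [a] = signed_cycle True [a]" by (auto simp: balanced_cycle_def fun_eq_iff transpose_def signed_swap_def)
next
  case (3 a b bs)
  have IH: "balanced_cycle (b # bs) = signed_cycle True (b # bs)" using 3 by simp
  have d: "distinct ((b # bs) @ - a # map uminus (b # bs))"
    using distinct_append_minus[OF 3(2)] by auto
  have rot: "cycle_of_list (xs @ ys) = cycle_of_list (ys @ xs)" if "distinct (xs @ ys)" for xs ys :: "int list"
    using cycle_of_list_rotate_independent[OF that, of "length xs"] by (simp add: rotate_append)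
  have "cycle_of_list ((b # bs) @ - a # map uminus (b # bs))
      = cycle_of_list ((- a # - b # map uminus bs) @ b # bs)"
    using rot[OF d] by simp
  also have "\<dots> = transpose (- a) (- b) \<circ> cycle_of_list (map uminus (b # bs) @ b # bs)"
    by simp
  also have "cycle_of_list (map uminus (b # bs) @ b # bs) = cycle_of_list ((b # bs) @ map uminus (b # bs))"
    using d by (intro rot) auto
  finally have "cycle_of_list ((b # bs) @ - a # map uminus (b # bs)) =
      transpose (- a) (- b) \<circ> cycle_of_list ((b # bs) @ map uminus (b # bs))" .
  then have "balanced_cycle (a # b # bs) =
      transpose a b \<circ> (transpose (- a) (- b) \<circ> balanced_cycle (b # bs))"
    by (simp add: balanced_cycle_def)
  also have "\<dots> = (transpose a b \<circ> transpose (- a) (- b)) \<circ> balanced_cycle (b # bs)"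
    by (simp add: o_assoc)
  also have "transpose a b \<circ> transpose (- a) (- b) = signed_swap a b"
  proof
    fix i
    have nz: "a \<noteq> 0" "b \<noteq> 0" "a \<noteq> b" "a \<noteq> - b" "b \<noteq> - a" using 3(2) by auto
    consider "i = a" | "i = - a" | "i = b" | "i = - b" | "i \<notin> {a, - a, b, - b}" by blast
    then show "(transpose a b \<circ> transpose (- a) (- b)) i = signed_swap a b i"
      by cases (use nz in \<open>simp_all add: signed_swap_def transpose_def\<close>)
  qed
  finally have "balanced_cycle (a # b # bs) = signed_swap a b \<circ> balanced_cycle (b # bs)" .
  then show "balanced_cycle (a # b # bs) = signed_cycle True (a # b # bs)"
    by (simp add: IH)
qed

lemma signed_cycle_apply:
  "abs_distinct (xs @ a # b # ys) \<Longrightarrow> signed_cycle \<beta> (xs @ a # b # ys) a = b"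
proof (induction xs)
  case Nil
  then have "signed_cycle \<beta> (b # ys) a = a" by (intro signed_cycle_outside) (auto simp: mem_signed_support)
  then show ?case using Nil by simp
next
  case (Cons x xs)
  then obtain h t where h: "xs @ a # b # ys = h # t" by (cases xs) auto
  have "signed_swap x h b = b"
  proof (rule signed_swap_other)
    have "h \<in> set (xs @ [a])" using h by (cases xs) auto
    then show "b \<noteq> h" "b \<noteq> - h" using Cons.prems by auto
  qed (use Cons.prems in auto)
  then show ?case using Cons h by auto
qed

lemma signed_cycle_apply_last:
  "abs_distinct (as @ [z]) \<Longrightarrow> signed_cycle \<beta> (as @ [z]) z = (if \<beta> then - hd (as @ [z]) else hd (as @ [z]))"
proof (induction as)
  case (Cons x xs)
  then obtain h t where h: "xs @ [z] = h # t" by (cases xs) auto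
  have hz: "h \<noteq> 0" using Cons.prems h by (metis abs_distinct_Cons append_Cons)
  show ?case using Cons h hz by (auto simp: signed_swap_odd)
qed auto

lemma signed_cycle_apply_Cons:
  assumes "abs_distinct (n # as)"
  shows "signed_cycle \<beta> (n # as) n = (case as of [] \<Rightarrow> if \<beta> then - n else n | a # _ \<Rightarrow> a)"
  using assms signed_cycle_apply[of "[]" n _ _ \<beta>] by (auto split: list.split)

section \<open>Decomposition along the cycle through a given point\<close>

text \<open>Detach \<open>n\<close> by the reflection of \<open>n\<close> and \<open>u n\<close>,
  decompose the rest along the cycle through \<open>u n\<close>, and put \<open>n\<close> in front.
  This is the recursion that defines \<open>signed_cycle\<close>.\<close>

lemma signed_perms_cycle_decomp:
  assumes "signed_set D" "u \<in> signed_perms D" "n \<in> D"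
  obtains \<beta> as u' where "abs_distinct (n # as)" "set as \<subseteq> D"
    "u' \<in> signed_perms (D - signed_support (n # as))" "u = signed_cycle \<beta> (n # as) \<circ> u'"
proof -
  have "\<exists>\<beta> as u'. abs_distinct (n # as) \<and> set as \<subseteq> D \<and>
    u' \<in> signed_perms (D - signed_support (n # as)) \<and> u = signed_cycle \<beta> (n # as) \<circ> u'"
    using assms
  proof (induction "card D" arbitrary: D u n rule: less_induct)
    case less
    note D = less.prems(1) and u = less.prems(2) and nD = less.prems(3)
    let ?E = "D - signed_support [n]"
    have nz: "n \<noteq> 0" "- n \<in> D" using D nD by (auto simp: signed_set_def)
    have uI: "w \<in> signed_perms ?E" if "w \<in> signed_perms D" "w n = n" for w
    proof -
      have "w permutes ?E"
      proof (rule permutes_superset[OF signed_permsD(1)[OF that(1)]])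
        fix x assume "x \<in> D - ?E"
        then have "x = n \<or> x = - n" by (auto simp: mem_signed_support)
        then show "w x = x" using that signed_permsD(2)[OF that(1), of n] by auto
      qed
      then show ?thesis using that by (simp add: signed_perms_def)
    qed
    show ?case
    proof (cases "u n = n")
      case True
      \<comment> \<open>A fixed point is the paired cycle with empty tail, which is the
        identity.\<close>
      then show ?thesis using u nz uI by (intro exI[of _ False] exI[of _ "[]"] exI[of _ u]) auto
    next
      case False
      define j w where "j = u n" and "w = signed_swap n j \<circ> u"
      have jD: "j \<in> D" using signed_permsD(6)[OF u] nD by (simp add: j_def)
      then have jz: "j \<noteq> 0" using signed_set_nz[OF D] by blast
      have "w n = n" using nz jz by (simp add: w_def flip: j_def)
      moreover have "w \<in> signed_perms D"
        unfolding w_def by (intro comp_signed_perms signed_swap_signed_perms D nD jD u)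
      ultimately have w: "w \<in> signed_perms ?E" by (rule uI[rotated])
      have uw: "u = signed_swap n j \<circ> w" by (simp add: w_def signed_swap_swap_left)
      show ?thesis
      proof (cases "j = - n")
        case True
        then show ?thesis using w uw nz
          by (intro exI[of _ True] exI[of _ "[]"] exI[of _ w]) auto
      next
        case False
        then have jE: "j \<in> ?E" using jD \<open>u n \<noteq> n\<close> j_def by (auto simp: mem_signed_support)
        have "?E \<subset> D" using nD by (auto simp: mem_signed_support)
        then have "card ?E < card D" using D by (intro psubset_card_mono) (auto simp: signed_set_def)
        from less.hyps[OF this signed_set_Diff[OF D] w jE] obtain \<beta> as u' where
          I: "abs_distinct (j # as)" "set as \<subseteq> ?E" "u' \<in> signed_perms (?E - signed_support (j # as))"
          "w = signed_cycle \<beta> (j # as) \<circ> u'" by blast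
        have "?E - signed_support (j # as) = D - signed_support (n # j # as)"
          by (auto simp: mem_signed_support)
        moreover have "abs_distinct (n # j # as)"
          using I(1,2) nz jE by (auto simp: mem_signed_support)
        moreover have "u = signed_cycle \<beta> (n # j # as) \<circ> u'" using uw I(4) by (simp add: o_assoc)
        ultimately show ?thesis using I(2,3) jD by (metis Diff_subset insert_subset list.simps(15) subset_trans)
      qed
    qed
  qed
  then show ?thesis using that by blast
qed

lemma cycle_decomp_unique:
  assumes "abs_distinct (n # as)" "abs_distinct (n # bs)"
    and "\<And>i. i \<in> signed_support (n # as) \<Longrightarrow> u i = i" "\<And>i. i \<in> signed_support (n # bs) \<Longrightarrow> v i = i"
    and "signed_cycle \<beta> (n # as) \<circ> u = signed_cycle \<gamma> (n # bs) \<circ> v"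
  shows "\<beta> = \<gamma> \<and> as = bs \<and> u = v"
  using assms
proof (induction as arbitrary: n bs)
  case Nil
  have "signed_cycle \<beta> [n] n = signed_cycle \<gamma> (n # bs) n"
    using fun_cong[OF Nil(5), of n] Nil(3,4)[of n] by (simp add: mem_signed_support)
  then have "bs = [] \<and> \<beta> = \<gamma>"
    unfolding signed_cycle_apply_Cons[OF Nil(1)] signed_cycle_apply_Cons[OF Nil(2)]
    using Nil(2) by (auto split: list.splits if_splits)
  moreover from this have "u = v" using Nil(5) bij_signed_cycle[of \<beta> "[n]"]
    by (auto simp: fun_eq_iff bij_is_inj[THEN inj_eq])
  ultimately show ?case by auto
next
  case (Cons a as)
  have "a = signed_cycle \<gamma> (n # bs) n"
    using fun_cong[OF Cons.prems(5), of n] Cons.prems(3,4)[of n] signed_cycle_apply_Cons[OF Cons.prems(1), of \<beta>]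
    by (simp add: mem_signed_support)
  then obtain bs' where bs: "bs = a # bs'"
    unfolding signed_cycle_apply_Cons[OF Cons.prems(2)] using Cons.prems(1)
    by (auto split: list.splits if_splits)
  have "signed_cycle \<beta> (n # a # as) \<circ> u = signed_cycle \<gamma> (n # bs) \<circ> v"
    by (rule Cons.prems(5))
  then have "signed_swap n a \<circ> (signed_cycle \<beta> (a # as) \<circ> u) = signed_swap n a \<circ> (signed_cycle \<gamma> (a # bs') \<circ> v)"
    using bs by (simp add: o_assoc)
  then have "signed_cycle \<beta> (a # as) \<circ> u = signed_cycle \<gamma> (a # bs') \<circ> v"
    by (metis signed_swap_swap_left)
  then have "\<beta> = \<gamma> \<and> as = bs' \<and> u = v"
    using Cons.prems(1-4) bs by (intro Cons.IH[of a]) (auto simp: mem_signed_support)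
  then show ?case using bs by simp
qed

text \<open>Each step along the list detaches one entry and lowers the length by one. A balanced
  cycle still has the sign change of its last entry left, at the cost of one more
  reflection.\<close>

lemma abs_length_signed_cycle:
  assumes "abs_distinct (k # as)" "set (k # as) \<subseteq> signed_points n"
    "u \<in> signed_perms (signed_points n - signed_support (k # as))"
  shows "abs_length n (signed_cycle \<beta> (k # as) \<circ> u) = length as + of_bool \<beta> + abs_length n u"
  using assms
proof (induction as arbitrary: k)
  case Nil
  have kD: "k \<in> signed_points n" and kz: "k \<noteq> 0" using Nil by auto
  have u: "u \<in> signed_perms (signed_points n)" using Nil(3) signed_perms_mono by blast
  have uk: "u k = k" by (rule signed_permsD(3)[OF Nil(3)]) (simp add: mem_signed_support)
  show "abs_length n (signed_cycle \<beta> [k] \<circ> u) = length [] + of_bool \<beta> + abs_length n u"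
  proof (cases \<beta>)
    case True
    let ?v = "signed_swap k (- k) \<circ> u"
    have "?v \<in> signed_perms (signed_points n)"
      using kD signed_set_neg_iff[OF signed_set_points, of k]
      by (intro comp_signed_perms signed_swap_signed_perms signed_set_points u) auto
    moreover have "?v k = - k" using uk kz by simp
    moreover have "- k \<noteq> k" using kz by simp
    ultimately have "abs_length n ?v = Suc (abs_length n (signed_swap k (- k) \<circ> ?v))"
      using abs_length_remove_point[of ?v n k] by simp
    then show ?thesis using True by (simp add: signed_swap_swap_left)
  qed simp
next
  case (Cons a as)
  let ?v = "signed_cycle \<beta> (k # a # as) \<circ> u" and ?D = "signed_points n"
  have u: "u \<in> signed_perms ?D" using Cons.prems(3) signed_perms_mono by blast
  have uk: "u k = k" by (rule signed_permsD(3)[OF Cons.prems(3)]) (simp add: mem_signed_support)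
  have v: "?v \<in> signed_perms ?D"
    by (intro comp_signed_perms signed_cycle_signed_perms signed_set_points Cons.prems(2) u)
  have vk: "?v k = a"
    using uk signed_cycle_apply[of "[]" k a as \<beta>] Cons.prems(1) by simp
  have "?D - signed_support (k # a # as) \<subseteq> ?D - signed_support (a # as)"
    by (auto simp: mem_signed_support)
  then have "u \<in> signed_perms (?D - signed_support (a # as))"
    using signed_perms_mono Cons.prems(3) by blast
  then have "abs_length n (signed_cycle \<beta> (a # as) \<circ> u) = length as + of_bool \<beta> + abs_length n u"
    using Cons.prems by (intro Cons.IH) auto
  moreover have "signed_swap k a \<circ> ?v = signed_cycle \<beta> (a # as) \<circ> u"
    by (simp add: o_assoc)
  moreover have "a \<noteq> k" using Cons.prems(1) by auto
  ultimately show "abs_length n ?v = length (a # as) + of_bool \<beta> + abs_length n u"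
    using abs_length_remove_point[OF v, of k] vk by simp
qed

section \<open>Generating functions\<close>

lemma catalan_fps_eq: "catalan_fps = 1 + fps_X * catalan_fps\<^sup>2"
proof -
  let ?C = "catalan_fps" and ?r = "fps_sqrt (1 - 4 * fps_X)"
  have "?r = 1 - 2 * fps_X * ?C" using catalan_fps_mult by simp
  moreover have "?r\<^sup>2 = 1 - 4 * fps_X" by (rule fps_sqrt_power2) simp
  ultimately have "(1 - 2 * fps_X * ?C)\<^sup>2 = 1 - 4 * fps_X" by simp
  then have "(4 * fps_X) * ?C = (4 * fps_X) * (1 + fps_X * ?C\<^sup>2)"
    by (simp add: power2_eq_square algebra_simps)
  then show ?thesis by (subst (asm) mult_cancel_left) (auto simp: fps_X_neq_zero)
qed

lemma catalan_nth_0: "fps_nth catalan_fps 0 = 1"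
  by (subst catalan_fps_eq) simp

lemma catalan_nth_Suc:
  "fps_nth catalan_fps (Suc k) = (\<Sum>i\<le>k. fps_nth catalan_fps i * fps_nth catalan_fps (k - i))"
  by (subst catalan_fps_eq, simp add: power2_eq_square) (simp add: fps_mult_nth atMost_atLeast0)

lemma central_binomial_Suc:
  "Suc k * (2 * Suc k choose Suc k) = 2 * (2 * k + 1) * (2 * k choose k)"
proof -
  have "Suc k * (2 * Suc k choose Suc k) = 2 * Suc k * (2 * k + 1 choose k)"
    using Suc_times_binomial[of k "2 * k + 1"] by simp
  also have "2 * k + 1 choose k = 2 * k + 1 choose Suc k"
    using binomial_symmetric[of k "2 * k + 1"] by simp
  also have "2 * Suc k * (2 * k + 1 choose Suc k) = 2 * (Suc k * (2 * k + 1 choose Suc k))"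
    by (simp only: mult.assoc)
  also have "Suc k * (2 * k + 1 choose Suc k) = (2 * k + 1) * (2 * k choose k)"
    using Suc_times_binomial[of k "2 * k"] by simp
  finally show ?thesis by (simp only: mult.assoc)
qed

definition odd_central_fps :: "real fps" where
  "odd_central_fps = Abs_fps (\<lambda>k. real (2 * k + 1 choose Suc k))"

text \<open>Let \<open>G\<close> be the series of the central binomial coefficients and
  \<open>d = 1 - 2 * fps_X * catalan_fps\<close>, the square root of \<open>1 - 4 * fps_X\<close>.
  Then \<open>G * d = 1\<close>, and \<open>G = 1 + 2 * fps_X * odd_central_fps\<close> by Pascal's
  rule and symmetry. Expanding the product and cancelling \<open>2 * fps_X\<close> gives the
  equation.\<close>

lemma odd_central_fps_eq:
  "odd_central_fps = catalan_fps + 2 * fps_X * odd_central_fps * catalan_fps"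
proof -
  let ?C = "catalan_fps" and ?b = odd_central_fps
  define G :: "real fps" where "G = Abs_fps (\<lambda>k. real (2 * k choose k))"
  define d where "d = 1 - 2 * fps_X * ?C"
  have d2: "d\<^sup>2 = 1 - 4 * fps_X"
    using catalan_fps_mult fps_sqrt_power2[of "1 - 4 * fps_X"] by (simp add: d_def)
  have d0: "d \<noteq> 0" unfolding d_def by (auto simp: fps_eq_iff intro!: exI[of _ 0])
  have "2 * d * fps_deriv d = - 4"
    using arg_cong[OF d2, of fps_deriv] by (simp add: power2_eq_square algebra_simps)
  have G': "(1 - 4 * fps_X) * fps_deriv G = 2 * G"
  proof (rule fps_ext)
    fix k
    have c: "real (Suc k) * fps_nth G (Suc k) = 2 * (2 * real k + 1) * fps_nth G k" for k
    proof -
      have "real (Suc k * (2 * Suc k choose Suc k)) = real (2 * (2 * k + 1) * (2 * k choose k))"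
        by (simp only: central_binomial_Suc)
      then show ?thesis
        by (simp only: G_def fps_nth_Abs_fps of_nat_mult of_nat_add of_nat_numeral of_nat_1)
    qed
    show "fps_nth ((1 - 4 * fps_X) * fps_deriv G) k = fps_nth (2 * G) k"
    proof (cases k)
      case 0
      then show ?thesis using c[of 0] by (simp add: left_diff_distrib numeral_fps_const mult.assoc)
    next
      case (Suc j)
      have "fps_nth ((1 - 4 * fps_X) * fps_deriv G) k
          = real (Suc k) * fps_nth G (Suc k) - 4 * (real (Suc j) * fps_nth G (Suc j))"
        by (simp add: left_diff_distrib numeral_fps_const mult.assoc Suc)
      also have "\<dots> = 2 * fps_nth G k" unfolding c[of k] using Suc by (simp add: algebra_simps)
      finally show ?thesis by (simp add: numeral_fps_const)
    qed
  qed
  \<comment> \<open>The product \<open>G * d\<close> is constant: the equations for \<open>G\<close>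
    and \<open>d\<close> make its derivative vanish once the factor
    \<open>d\<^sup>2 = 1 - 4 * fps_X\<close> is supplied.\<close>
  have "d\<^sup>2 * (2 * fps_deriv (G * d)) = 2 * (d\<^sup>2 * fps_deriv G) * d + G * (d * (2 * d * fps_deriv d))"
    by (simp add: power2_eq_square algebra_simps)
  also have "\<dots> = 0"
    unfolding d2 G' \<open>2 * d * fps_deriv d = - 4\<close> by (simp add: algebra_simps)
  finally have "fps_deriv (G * d) = 0" using d0 by (simp del: fps_deriv_mult)
  then have "G * d = fps_const (fps_nth (G * d) 0)" by (simp only: fps_deriv_eq_0_iff)
  then have Gd: "G * d = 1" by (simp add: G_def d_def)
  have "G = 1 + 2 * fps_X * ?b"
  proof (rule fps_ext)
    fix k show "fps_nth G k = fps_nth (1 + 2 * fps_X * ?b) k"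
    proof (cases k)
      case (Suc j)
      have "2 * Suc j choose Suc j = (2 * j + 1 choose j) + (2 * j + 1 choose Suc j)"
        by simp
      also have "2 * j + 1 choose j = 2 * j + 1 choose Suc j"
        using binomial_symmetric[of j "2 * j + 1"] by simp
      finally show ?thesis
        by (simp add: Suc G_def odd_central_fps_def numeral_fps_const mult.assoc)
    qed (simp add: G_def mult.assoc numeral_fps_const)
  qed
  with Gd have "(1 + 2 * fps_X * ?b) * (1 - 2 * fps_X * ?C) = 1" by (simp only: d_def)
  moreover have "(1 + y) * (1 - z) = 1 \<Longrightarrow> y = z + y * z" for y z :: "real fps"
    by (simp add: algebra_simps)
  ultimately have "2 * fps_X * ?b = 2 * fps_X * ?C + 2 * fps_X * ?b * (2 * fps_X * ?C)" by blast
  also have "\<dots> = (2 * fps_X) * (?C + 2 * fps_X * ?b * ?C)" by (simp only: distrib_left mult_ac)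
  finally have "(2 * fps_X) * ?b = (2 * fps_X) * (?C + 2 * fps_X * ?b * ?C)" .
  then show ?thesis by (subst (asm) mult_cancel_left) (auto simp: fps_X_neq_zero)
qed

text \<open>Weights of the cycles \<open>signed_cycle \<beta> (n # as)\<close> as a function of \<open>length as\<close>. They are the
  values of the Moebius function on paired and balanced cycles.\<close>

definition paired_weight :: "nat \<Rightarrow> real" where
  "paired_weight k = (- 1) ^ k * fps_nth catalan_fps k"

definition balanced_weight :: "nat \<Rightarrow> real" where
  "balanced_weight k = - ((- 1) ^ k * real (2 * k + 1 choose Suc k))"

lemma paired_weight_0 [simp]: "paired_weight 0 = 1"
  by (simp add: paired_weight_def catalan_nth_0)

lemma minus_one_power_diff: "i < k \<Longrightarrow> (- 1) ^ (k - Suc i) * (- 1) ^ i = - ((- 1) ^ k :: real)"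
  by (simp flip: power_add) (metis One_nat_def Suc_pred less_nat_zero_code neq0_conv power_minus1_odd
    power_Suc mult_minus1 minus_minus)

text \<open>The Catalan recurrence; the sign is right because the exponents of the two pieces add up
  to \<open>k - 1\<close>.\<close>

lemma paired_weight_rec:
  assumes "k > 0"
  shows "paired_weight k + (\<Sum>i<k. paired_weight (k - Suc i) * paired_weight i) = 0"
proof -
  obtain j where k: "k = Suc j" using assms by (cases k) auto
  have "(\<Sum>i<k. paired_weight (k - Suc i) * paired_weight i)
      = (\<Sum>i<k. ((- 1) ^ (k - Suc i) * (- 1) ^ i) * (fps_nth catalan_fps i * fps_nth catalan_fps (k - Suc i)))"
    by (simp add: paired_weight_def mult_ac)
  also have "\<dots> = (\<Sum>i<k. - ((- 1) ^ k) * (fps_nth catalan_fps i * fps_nth catalan_fps (k - Suc i)))"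
    by (intro sum.cong refl) (simp add: minus_one_power_diff)
  also have "\<dots> = - ((- 1) ^ k) * fps_nth catalan_fps k"
    unfolding k catalan_nth_Suc by (simp add: sum_distrib_left lessThan_Suc_atMost sum_negf)
  finally show ?thesis by (simp add: paired_weight_def)
qed

text \<open>The coefficients of \<open>odd_central_fps_eq\<close> with signs. Its factor 2 is split
  into the two sums, one for cuts at an entry and one for cuts at a negated entry; the single paired
  weight stands for the sign change at the head.\<close>

lemma balanced_weight_rec:
  "balanced_weight k + paired_weight k +
    (\<Sum>i<k. balanced_weight (k - Suc i) * paired_weight i + paired_weight (k - Suc i) * balanced_weight i) = 0"
proof -
  let ?C = "fps_nth catalan_fps" and ?b = "fps_nth odd_central_fps"
  have bw: "balanced_weight k = - ((- 1) ^ k * ?b k)" for k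
    by (simp add: balanced_weight_def odd_central_fps_def)
  have b_rec: "?b k = ?C k + 2 * (\<Sum>i<k. ?b (k - Suc i) * ?C i)"
  proof (cases k)
    case 0
    then show ?thesis by (subst odd_central_fps_eq) (simp add: mult.assoc numeral_fps_const)
  next
    case (Suc j)
    have "?b k = ?C k + 2 * fps_nth (odd_central_fps * catalan_fps) j"
      by (subst odd_central_fps_eq) (simp add: mult.assoc numeral_fps_const Suc)
    also have "fps_nth (odd_central_fps * catalan_fps) j = (\<Sum>i<k. ?b (k - Suc i) * ?C i)"
      unfolding mult.commute[of odd_central_fps]
      by (simp add: fps_mult_nth Suc lessThan_Suc_atMost atMost_atLeast0) (simp add: mult.commute)
    finally show ?thesis .
  qed
  have "(\<Sum>i<k. balanced_weight (k - Suc i) * paired_weight i)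
      = (\<Sum>i<k. - ((- 1) ^ (k - Suc i) * (- 1) ^ i) * (?b (k - Suc i) * ?C i))"
    by (simp add: bw paired_weight_def mult_ac)
  also have "\<dots> = (\<Sum>i<k. (- 1) ^ k * (?b (k - Suc i) * ?C i))"
    by (intro sum.cong refl) (simp add: minus_one_power_diff)
  also have "\<dots> = (- 1) ^ k * (\<Sum>i<k. ?b (k - Suc i) * ?C i)"
    by (simp only: sum_distrib_left)
  finally have "(\<Sum>i<k. balanced_weight (k - Suc i) * paired_weight i) = (- 1) ^ k * (\<Sum>i<k. ?b (k - Suc i) * ?C i)" .
  moreover have "(\<Sum>i<k. paired_weight (k - Suc i) * balanced_weight i)
      = (\<Sum>i<k. balanced_weight (k - Suc i) * paired_weight i)"
    by (subst sum.nat_diff_reindex[symmetric]) (simp add: mult.commute)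
  ultimately have S: "(\<Sum>i<k. balanced_weight (k - Suc i) * paired_weight i
      + paired_weight (k - Suc i) * balanced_weight i) = 2 * ((- 1) ^ k * (\<Sum>i<k. ?b (k - Suc i) * ?C i))"
    by (simp only: sum.distrib)
  show ?thesis unfolding S bw[of k] paired_weight_def[of k] b_rec by (simp add: algebra_simps)
qed

section \<open>The series of the theorem and their differential equations\<close>

abbreviation (input) catalan2_fps :: "real fps" where
  "catalan2_fps \<equiv> fps_compose catalan_fps (2 * fps_X)"

text \<open>Up to the sign \<open>(- 1) ^ m\<close>, the exponential generating function of the
  weights of elements without balanced cycle.\<close>

definition paired_fps :: "real fps" where
  "paired_fps = fps_sqrt catalan2_fps * fps_compose (fps_exp 1) (- 2 * fps_X * catalan2_fps)"

text \<open>The constant 1 stands for no balanced cycle. The other terms count a single one: there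
  are \<open>2 ^ (n - 1) * fact (n - 1)\<close> balanced cycles on \<open>n\<close> pairs of points,
  each of weight \<open>(- 1) ^ n\<close> times the binomial.\<close>

definition balanced_fps :: "real fps" where
  "balanced_fps = 1 + Abs_fps (\<lambda>n. if n \<ge> 1 then 2 ^ (n - 1) * real ((2 * n - 1) choose n) / real n else 0)"

lemma catalan2_nth: "fps_nth catalan2_fps k = 2 ^ k * fps_nth catalan_fps k"
  using fps_compose_linear[of catalan_fps 2] by (simp add: numeral_fps_const)

lemma catalan2_eq: "catalan2_fps = 1 + 2 * fps_X * catalan2_fps\<^sup>2"
proof -
  have "fps_compose catalan_fps (2 * fps_X) = fps_compose (1 + fps_X * catalan_fps\<^sup>2) (2 * fps_X)"
    using catalan_fps_eq by simp
  also have "\<dots> = 1 + 2 * fps_X * catalan2_fps\<^sup>2"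
    by (simp add: fps_compose_add_distrib fps_compose_mult_distrib power2_eq_square)
  finally show ?thesis .
qed

lemma paired_fps_0: "fps_nth paired_fps 0 = 1"
  by (simp add: paired_fps_def catalan_nth_0)

text \<open>With \<open>c = catalan2_fps\<close>, the logarithmic derivative is
  \<open>c' / (2 * c) - 2 * c - 2 * fps_X * c'\<close>. The derivative of the quadratic equation for
  \<open>c\<close> turns the first term into \<open>c + 2 * fps_X * c'\<close>, and
  \<open>- c\<close> remains.\<close>

lemma paired_fps_deriv: "fps_deriv paired_fps = - catalan2_fps * paired_fps"
proof -
  define c where "c = catalan2_fps"
  define r where "r = fps_sqrt c"
  define g where "g = - 2 * fps_X * c"
  define E where "E = fps_compose (fps_exp (1::real)) g"
  have c0: "fps_nth c 0 = 1" by (simp add: c_def catalan_nth_0)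
  have r2: "r\<^sup>2 = c" unfolding r_def by (rule fps_sqrt_power2[OF c0])
  have r0: "r \<noteq> 0" using r2 c0 by auto
  have c': "fps_deriv c = 2 * c\<^sup>2 + 4 * fps_X * c * fps_deriv c"
    using arg_cong[OF catalan2_eq[folded c_def], of fps_deriv] by (simp add: power2_eq_square algebra_simps)
  have r': "2 * r * fps_deriv r = fps_deriv c"
    using arg_cong[OF r2, of fps_deriv] by (simp add: power2_eq_square algebra_simps)
  have "fps_nth g 0 = 0" by (simp add: g_def mult.assoc)
  then have E': "fps_deriv E = E * fps_deriv g"
    unfolding E_def by (simp add: fps_compose_deriv)
  have g': "fps_deriv g = - 2 * c - 2 * fps_X * fps_deriv c"
    by (simp add: g_def algebra_simps)
  have A: "paired_fps = r * E" by (simp add: paired_fps_def r_def E_def g_def c_def)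
  \<comment> \<open>The factor \<open>2 * r\<close> avoids dividing by the square root; it is
    cancelled at the end.\<close>
  have "2 * r * fps_deriv (r * E) = E * (2 * r * fps_deriv r + 2 * r\<^sup>2 * fps_deriv g)"
    by (simp add: E' power2_eq_square algebra_simps)
  also have "\<dots> = E * (fps_deriv c - 4 * c\<^sup>2 - 4 * fps_X * c * fps_deriv c)"
    unfolding r' r2 g' by (simp add: power2_eq_square algebra_simps)
  also have "fps_deriv c - 4 * c\<^sup>2 - 4 * fps_X * c * fps_deriv c = - 2 * c\<^sup>2"
    using c' by (simp add: algebra_simps)
  also have "E * (- 2 * c\<^sup>2) = 2 * r * (- c * (r * E))"
    unfolding r2[symmetric] by (simp add: power2_eq_square algebra_simps)
  finally have "fps_deriv (r * E) = - c * (r * E)" using r0 by (subst (asm) mult_cancel_left) simp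
  then show ?thesis by (simp add: A c_def)
qed

lemma balanced_fps_deriv_nth:
  "fps_nth (fps_deriv balanced_fps) k = 2 ^ k * real (2 * k + 1 choose Suc k)"
  by (simp add: balanced_fps_def)

text \<open>The total weight of all elements on \<open>m\<close> pairs of points, with at most one
  balanced cycle if \<open>b\<close> holds and none otherwise; see
  \<open>sum_weight_balanced_at_most\<close>.\<close>

definition ideal_weight :: "bool \<Rightarrow> nat \<Rightarrow> real" where
  "ideal_weight b m = (- 1) ^ m * fact m * fps_nth (if b then paired_fps * balanced_fps else paired_fps) m"

lemma ideal_weight_0 [simp]: "ideal_weight b 0 = 1"
  by (simp add: ideal_weight_def paired_fps_0 balanced_fps_def)

lemma minus_one_power_split: "k \<le> m \<Longrightarrow> (- 1) ^ m = (- 1) ^ k * ((- 1) ^ (m - k) :: real)"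
  by (simp flip: power_add)

text \<open>The differential equations, coefficient by coefficient. Here \<open>k\<close> is the
  number of further entries in the cycle through a chosen point, and the quotient of factorials with
  \<open>2 ^ k\<close> counts the choices of these entries. A balanced cycle uses up the only one
  allowed, hence \<open>False\<close> for the rest.\<close>

lemma ideal_weight_Suc:
  "ideal_weight b (Suc m) = (\<Sum>k\<le>m. 2 ^ k * fact m / fact (m - k) *
     (paired_weight k * ideal_weight b (m - k) + of_bool b * balanced_weight k * ideal_weight False (m - k)))"
proof -
  define f where "f = (if b then paired_fps * balanced_fps else paired_fps)"
  have "fps_deriv f = - catalan2_fps * f + of_bool b * (fps_deriv balanced_fps * paired_fps)"
    by (simp add: f_def paired_fps_deriv algebra_simps)
  then have "fps_nth (fps_deriv f) m = (\<Sum>k\<le>m. - fps_nth catalan2_fps k * fps_nth f (m - k)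
      + of_bool b * (fps_nth (fps_deriv balanced_fps) k * fps_nth paired_fps (m - k)))"
    by (cases b) (simp_all add: fps_mult_nth atMost_atLeast0 sum_subtractf sum_negf)
  then have "(- 1) ^ Suc m * fact m * (real (Suc m) * fps_nth f (Suc m)) =
      (- 1) ^ Suc m * fact m * (\<Sum>k\<le>m. - fps_nth catalan2_fps k * fps_nth f (m - k)
      + of_bool b * (fps_nth (fps_deriv balanced_fps) k * fps_nth paired_fps (m - k)))"
    by simp
  also have "\<dots> = (\<Sum>k\<le>m. 2 ^ k * fact m / fact (m - k) *
     (paired_weight k * ideal_weight b (m - k) + of_bool b * balanced_weight k * ideal_weight False (m - k)))"
    unfolding sum_distrib_left
  proof (intro sum.cong refl)
    fix k assume "k \<in> {..m}"
    then have "k \<le> m" by simp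
    show "(- 1) ^ Suc m * fact m * (- fps_nth catalan2_fps k * fps_nth f (m - k)
        + of_bool b * (fps_nth (fps_deriv balanced_fps) k * fps_nth paired_fps (m - k)))
      = 2 ^ k * fact m / fact (m - k) *
     (paired_weight k * ideal_weight b (m - k) + of_bool b * balanced_weight k * ideal_weight False (m - k))"
      unfolding paired_weight_def balanced_weight_def ideal_weight_def f_def[symmetric]
        balanced_fps_deriv_nth catalan2_nth power_Suc minus_one_power_split[OF \<open>k \<le> m\<close>]
      by (simp add: algebra_simps)
  qed
  finally show ?thesis by (simp add: ideal_weight_def f_def algebra_simps)
qed

section \<open>Orbits and weights\<close>

definition orb :: "(int \<Rightarrow> int) \<Rightarrow> int \<Rightarrow> int set" where
  "orb u i = range (\<lambda>k. (u ^^ k) i)"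

definition signed_block :: "(int \<Rightarrow> int) \<Rightarrow> int \<Rightarrow> int set" where
  "signed_block u i = orb u i \<union> uminus ` orb u i"

definition blocks :: "int set \<Rightarrow> (int \<Rightarrow> int) \<Rightarrow> int set set" where
  "blocks D u = signed_block u ` D"

definition balanced_block :: "(int \<Rightarrow> int) \<Rightarrow> int set \<Rightarrow> bool" where
  "balanced_block u B \<longleftrightarrow> (\<exists>i\<in>B. - i \<in> orb u i)"

definition num_balanced :: "int set \<Rightarrow> (int \<Rightarrow> int) \<Rightarrow> nat" where
  "num_balanced D u = card {B \<in> blocks D u. balanced_block u B}"

definition cycle_weight :: "bool \<Rightarrow> nat \<Rightarrow> real" where
  "cycle_weight \<beta> k = (if \<beta> then balanced_weight k else paired_weight k)"

text \<open>Defined by orbits, so that it does not depend on the order in which cycles are split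
  off. A block with \<open>2 * (k + 1)\<close> points is a cycle with \<open>k\<close> entries after
  the head; fixed points contribute the factor 1.\<close>

definition weight :: "int set \<Rightarrow> (int \<Rightarrow> int) \<Rightarrow> real" where
  "weight D u = (\<Prod>B\<in>blocks D u. cycle_weight (balanced_block u B) (card B div 2 - 1))"

lemma orb_self: "i \<in> orb u i"
  unfolding orb_def by (rule range_eqI[of _ _ 0]) simp

lemma orb_step: assumes "j \<in> orb u i" shows "u j \<in> orb u i"
proof -
  obtain k where "j = (u ^^ k) i" using assms unfolding orb_def by blast
  then have "u j = (u ^^ Suc k) i" by simp
  then show ?thesis unfolding orb_def by blast
qed

lemma orb_subset:
  assumes "i \<in> S" "\<And>j. j \<in> S \<Longrightarrow> u j \<in> S" shows "orb u i \<subseteq> S"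
proof -
  have "(u ^^ k) i \<in> S" for k by (induction k) (use assms in auto)
  then show ?thesis unfolding orb_def by blast
qed

lemma orb_trans: "j \<in> orb u i \<Longrightarrow> orb u j \<subseteq> orb u i"
  by (intro orb_subset orb_step)

lemma orb_sym:
  assumes "finite D" "u permutes D" "j \<in> orb u i" shows "i \<in> orb u j"
proof -
  have "permutation u" using assms by (auto simp: permutation_permutes)
  then obtain n where n: "u ^^ n = id" "n > 0" using permutation_is_nilpotent by blast
  obtain k where k: "j = (u ^^ k) i" using assms(3) unfolding orb_def by blast
  \<comment> \<open>Since \<open>u ^^ n\<close> is the identity and \<open>n > 0\<close>, this power
    undoes \<open>u ^^ k\<close>.\<close>
  have "(u ^^ (n * k - k)) j = (u ^^ (n * k - k + k)) i"
    by (simp only: k funpow_add comp_apply)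
  also have "n * k - k + k = n * k" using n(2) by (cases n) auto
  also have "u ^^ (n * k) = id" unfolding funpow_mult[symmetric] n(1) by simp
  finally show ?thesis unfolding orb_def by (metis id_apply rangeI)
qed

lemma orb_eq:
  "finite D \<Longrightarrow> u permutes D \<Longrightarrow> j \<in> orb u i \<Longrightarrow> orb u j = orb u i"
  by (intro equalityI orb_trans) (auto intro: orb_sym)

lemma orb_minus:
  assumes "\<And>i. u (- i) = - u i" shows "orb u (- i) = uminus ` orb u i"
proof -
  have "(u ^^ k) (- i) = - (u ^^ k) i" for k by (induction k) (auto simp: assms)
  then show ?thesis unfolding orb_def by (auto simp: image_image)
qed

lemma orb_in:
  assumes "u \<in> signed_perms D" "i \<in> D" shows "orb u i \<subseteq> D"
  by (rule orb_subset) (use assms signed_permsD(6)[OF assms(1)] in auto)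

lemma blocks_subset:
  assumes "signed_set D" "u \<in> signed_perms D" "B \<in> blocks D u" shows "B \<subseteq> D" "B \<noteq> {}"
proof -
  obtain i where i: "i \<in> D" "B = signed_block u i" using assms(3) unfolding blocks_def by blast
  show "B \<subseteq> D" using orb_in[OF assms(2) i(1)] assms(1) unfolding i signed_block_def signed_set_def by auto
  show "B \<noteq> {}" using orb_self[of i u] unfolding i signed_block_def by auto
qed

lemma blocks_empty [simp]: "blocks {} u = {}"
  by (simp add: blocks_def)

lemma num_balanced_empty [simp]: "num_balanced {} u = 0"
  by (simp add: num_balanced_def)

lemma weight_empty [simp]: "weight {} u = 1"
  by (simp add: weight_def)

section \<open>Splitting one cycle off an element\<close>

context
  fixes D :: "int set" and n :: int and as :: "int list" and u' :: "int \<Rightarrow> int" and \<beta> :: bool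
  assumes D: "signed_set D" and d: "abs_distinct (n # as)" and sub: "set (n # as) \<subseteq> D"
    and u': "u' \<in> signed_perms (D - signed_support (n # as))"
begin

private abbreviation u where "u \<equiv> signed_cycle \<beta> (n # as) \<circ> u'"

private lemma u_perm: "u \<in> signed_perms D"
proof -
  have "u' \<in> signed_perms D" using u' signed_perms_mono[of "D - signed_support (n # as)" D] by blast
  then show ?thesis by (intro comp_signed_perms signed_cycle_signed_perms D sub)
qed

private lemma u_support: "i \<in> signed_support (n # as) \<Longrightarrow> u i = signed_cycle \<beta> (n # as) i"
  using signed_permsD(3)[OF u', of i] by simp

private lemma u_outside:
  assumes "i \<in> D - signed_support (n # as)" shows "u i = u' i"
proof -
  have "u' i \<in> D - signed_support (n # as)" using assms signed_permsD(6)[OF u'] by blast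
  then show ?thesis by (simp add: signed_cycle_outside)
qed

private lemma mem_orb_head: "xs @ ys = n # as \<Longrightarrow> set xs \<subseteq> orb u n"
proof (induction xs arbitrary: ys rule: rev_induct)
  case (snoc x xs)
  have IH: "set xs \<subseteq> orb u n" using snoc.prems by (intro snoc.IH[of "x # ys"]) simp
  moreover have "x \<in> orb u n"
  proof (cases xs rule: rev_cases)
    case Nil
    then show ?thesis using snoc.prems orb_self by simp
  next
    case (snoc zs z)
    have e: "zs @ z # x # ys = n # as" using snoc \<open>(xs @ [x]) @ ys = n # as\<close> by simp
    have "u z = signed_cycle \<beta> (n # as) z"
      by (rule u_support) (auto simp: mem_signed_support simp flip: e)
    also have "\<dots> = x" using signed_cycle_apply[of zs z x ys \<beta>] e d by simp
    finally have "u z = x" .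
    moreover have "z \<in> orb u n" using IH snoc by simp
    ultimately show ?thesis using orb_step by metis
  qed
  ultimately show "set (xs @ [x]) \<subseteq> orb u n" by simp
qed simp

private lemma set_subset_orb: "set (n # as) \<subseteq> orb u n"
  using mem_orb_head[of "n # as" "[]"] by simp

lemma orb_cycle_head: "orb u n = (if \<beta> then signed_support (n # as) else set (n # as))"
proof -
  have 0: "0 \<notin> set (n # as)" using sub D unfolding signed_set_def by blast
  obtain ys z where yz: "n # as = ys @ [z]" by (cases "n # as" rule: rev_cases) auto
  have uz: "u z = (if \<beta> then - n else n)"
  proof -
    have "u z = signed_cycle \<beta> (n # as) z"
      by (rule u_support) (simp only: yz, simp add: mem_signed_support)
    also have "\<dots> = (if \<beta> then - hd (n # as) else hd (n # as))"
      unfolding yz by (rule signed_cycle_apply_last) (use d yz in simp)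
    finally show ?thesis by simp
  qed
  show ?thesis
  proof (cases \<beta>)
    case True
    have closed: "u i \<in> signed_support (n # as)" if "i \<in> signed_support (n # as)" for i
      using u_support[OF that] signed_cycle_in_support[OF 0, of \<beta> i] that by simp
    have "orb u n \<subseteq> signed_support (n # as)"
      by (rule orb_subset[OF _ closed]) (simp add: mem_signed_support)
    moreover have "uminus ` set (n # as) \<subseteq> orb u n"
    proof -
      have "z \<in> orb u n" using set_subset_orb yz by auto
      then have "- n \<in> orb u n" using orb_step uz True by metis
      then have "orb u (- n) \<subseteq> orb u n" by (rule orb_trans)
      then show ?thesis
        using set_subset_orb orb_minus[of u n, OF signed_permsD(2)[OF u_perm]] by auto
    qed
    ultimately show ?thesis using True set_subset_orb unfolding signed_support_def by auto
  next
    case False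
    have closed: "u i \<in> set (n # as)" if i: "i \<in> set (n # as)" for i
    proof (cases "i = z")
      case True
      then show ?thesis using uz False by simp
    next
      case neq: False
      obtain xs ws where x: "n # as = xs @ i # ws" using split_list[OF i] by blast
      then obtain w ws' where w: "ws = w # ws'" using neq yz
        by (cases ws) auto
      have "u i = signed_cycle \<beta> (n # as) i" by (rule u_support) (use i in \<open>auto simp: mem_signed_support\<close>)
      also have "\<dots> = w" unfolding x w by (rule signed_cycle_apply) (use d x w in simp)
      finally show ?thesis unfolding x w by simp
    qed
    then have "orb u n \<subseteq> set (n # as)" by (intro orb_subset) auto
    then show ?thesis using False set_subset_orb by auto
  qed
qed

private lemma fin: "finite D"
  using D by (simp add: signed_set_def)

private lemma orb_u_minus: "orb u (- i) = uminus ` orb u i"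
  using orb_minus[of u i] signed_permsD(2)[OF u_perm] by blast

private lemma orb_u_set: "i \<in> set (n # as) \<Longrightarrow> orb u i = orb u n"
  using orb_eq[OF fin signed_permsD(1)[OF u_perm]] set_subset_orb by blast

private lemma signed_block_support:
  assumes "i \<in> signed_support (n # as)" shows "signed_block u i = signed_support (n # as)"
proof -
  have "orb u i = orb u n \<or> orb u i = uminus ` orb u n"
    using assms orb_u_set[of i] orb_u_set[of "- i"] orb_u_minus[of "- i"]
    by (auto simp only: mem_signed_support minus_minus)
  then have "signed_block u i = orb u n \<union> uminus ` orb u n"
    unfolding signed_block_def by (auto simp: image_image)
  then show ?thesis unfolding orb_cycle_head by (auto simp: signed_support_def)
qed

private lemma orb_outside:
  assumes "i \<in> D - signed_support (n # as)" shows "orb u i = orb u' i"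
proof -
  have s: "(f ^^ Suc k) x = f ((f ^^ k) x)" for f :: "int \<Rightarrow> int" and k x by simp
  have "(u ^^ k) i = (u' ^^ k) i \<and> (u' ^^ k) i \<in> D - signed_support (n # as)" for k
  proof (induction k)
    case (Suc k)
    then show ?case
      unfolding s using u_outside[of "(u' ^^ k) i"] signed_permsD(6)[OF u', of "(u' ^^ k) i"]
      by metis
  qed (use assms in simp)
  then show ?thesis unfolding orb_def by simp
qed

private lemma blocks_cycle:
  "blocks D u = insert (signed_support (n # as)) (blocks (D - signed_support (n # as)) u')"
proof -
  have "D = signed_support (n # as) \<union> (D - signed_support (n # as))"
    using signed_support_subset[OF D sub] by blast
  then have "blocks D u = signed_block u ` signed_support (n # as)
      \<union> signed_block u ` (D - signed_support (n # as))"
    unfolding blocks_def by (metis image_Un)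
  moreover have "signed_block u ` signed_support (n # as) = {signed_support (n # as)}"
    using signed_block_support by (auto simp: signed_support_Cons)
  moreover have "signed_block u ` (D - signed_support (n # as)) = blocks (D - signed_support (n # as)) u'"
    unfolding blocks_def signed_block_def using orb_outside by auto
  ultimately show ?thesis by simp
qed

private lemma support_not_block: "signed_support (n # as) \<notin> blocks (D - signed_support (n # as)) u'"
  using blocks_subset(1)[OF signed_set_Diff[OF D] u'] by (auto simp: signed_support_Cons)

private lemma balanced_block_support: "balanced_block u (signed_support (n # as)) \<longleftrightarrow> \<beta>"
proof
  assume "balanced_block u (signed_support (n # as))"
  then obtain i where i: "i \<in> signed_support (n # as)" "- i \<in> orb u i" unfolding balanced_block_def by blast
  show \<beta>
  proof (rule ccontr)
    assume "\<not> \<beta>"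
    have neg: "j \<in> set (n # as) \<Longrightarrow> - j \<notin> set (n # as)" for j by (rule abs_distinct_neg[OF d])
    have o: "orb u n = set (n # as)" using orb_cycle_head \<open>\<not> \<beta>\<close> by simp
    show False
    proof (cases "i \<in> set (n # as)")
      case True
      then show False using neg[of i] i(2) orb_u_set[of i] o by simp
    next
      case False
      then have mi: "- i \<in> set (n # as)" using i(1) unfolding mem_signed_support by blast
      then have "orb u i = uminus ` set (n # as)"
        using orb_u_minus[of "- i"] orb_u_set[of "- i"] o by simp
      then have "i \<in> set (n # as)" using i(2) by (metis imageE minus_equation_iff neg_equal_iff_equal)
      then show False using False by blast
    qed
  qed
next
  assume \<beta>
  then show "balanced_block u (signed_support (n # as))"
    unfolding balanced_block_def using orb_cycle_head
    by (intro bexI[of _ n]) (auto simp: mem_signed_support)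
qed

private lemma balanced_block_outside:
  assumes "B \<in> blocks (D - signed_support (n # as)) u'"
  shows "balanced_block u B \<longleftrightarrow> balanced_block u' B"
proof -
  have "B \<subseteq> D - signed_support (n # as)" by (rule blocks_subset(1)[OF signed_set_Diff[OF D] u' assms])
  then show ?thesis unfolding balanced_block_def using orb_outside by blast
qed

private lemma fin_blocks: "finite (blocks (D - signed_support (n # as)) u')"
  using fin by (simp add: blocks_def)

text \<open>The support of the cycle is one new block and all other blocks, with their type, are
  those of \<open>u'\<close>.\<close>

lemma weight_cycle:
  "weight D u = cycle_weight \<beta> (length as) * weight (D - signed_support (n # as)) u'"
proof -
  have "(\<Prod>B\<in>blocks (D - signed_support (n # as)) u'. cycle_weight (balanced_block u B) (card B div 2 - 1))
      = weight (D - signed_support (n # as)) u'"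
    unfolding weight_def by (intro prod.cong refl) (simp add: balanced_block_outside)
  then show ?thesis
    unfolding weight_def[of D] blocks_cycle prod.insert[OF fin_blocks support_not_block]
    using card_signed_support[OF d] by (simp add: balanced_block_support)
qed

lemma num_balanced_cycle:
  "num_balanced D u = of_bool \<beta> + num_balanced (D - signed_support (n # as)) u'"
proof -
  let ?S = "{B \<in> blocks (D - signed_support (n # as)) u'. balanced_block u' B}"
  have "{B \<in> blocks D u. balanced_block u B} = (if \<beta> then insert (signed_support (n # as)) ?S else ?S)"
    unfolding blocks_cycle using balanced_block_support balanced_block_outside by auto
  moreover have "finite ?S" "signed_support (n # as) \<notin> ?S" using fin_blocks support_not_block by auto
  ultimately show ?thesis unfolding num_balanced_def by simp
qed

lemma cycle_comp_signed_perms: "u \<in> signed_perms D"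
  by (rule u_perm)

end

section \<open>Cutting a cycle by a reflection\<close>

lemma fixes_support_comp_swap:
  assumes "u \<in> signed_perms (D - signed_support as)" "a \<in> signed_support as" "b \<in> signed_support as"
  shows "(w \<circ> u) \<circ> signed_swap a b = (w \<circ> signed_swap a b) \<circ> u"
proof -
  have "u a = a" "u b = b" using assms by (auto intro: signed_permsD(3))
  then have "u \<circ> signed_swap a b = signed_swap a b \<circ> u"
    using conj_signed_swap_signed_perms[OF assms(1), of a b] by simp
  then show ?thesis by (simp add: comp_assoc)
qed

text \<open>Cutting at a negated entry negates both tails. Distinctness and support ignore signs, so
  the facts about the whole cycle carry over to such pieces.\<close>

lemma abs_distinct_minus_parts:
  "abs_distinct (a # map uminus xs @ b # map uminus ys) \<longleftrightarrow> abs_distinct (a # xs @ b # ys)"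
  by (auto simp: abs_distinct_def comp_def image_image simp del: abs_distinct_Cons abs_distinct_append)

lemma signed_support_minus_parts:
  "signed_support (a # map uminus xs @ b # map uminus ys) = signed_support (a # xs @ b # ys)"
  by (simp add: signed_support_Cons signed_support_append signed_support_minus)

section \<open>The two pieces of a cut cycle\<close>

context
  fixes D :: "int set" and a b :: int and xs ys :: "int list" and u :: "int \<Rightarrow> int"
  assumes D: "signed_set D" and d: "abs_distinct (a # xs @ b # ys)" and sub: "set (a # xs @ b # ys) \<subseteq> D"
    and u: "u \<in> signed_perms (D - signed_support (a # xs @ b # ys))"
begin

private lemma dist: "abs_distinct (a # ys)" "abs_distinct (b # xs)"
  using d unfolding abs_distinct_def by auto

private lemma subs: "set (a # ys) \<subseteq> D" "set (b # xs) \<subseteq> D - signed_support (a # ys)"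
proof -
  show "set (a # ys) \<subseteq> D" using sub by auto
  have "x \<notin> signed_support (a # ys)" if "x \<in> set (b # xs)" for x
    using d that by (auto simp: mem_signed_support)
  then show "set (b # xs) \<subseteq> D - signed_support (a # ys)" using sub by auto
qed

private lemma diff: "D - signed_support (a # xs @ b # ys) = D - signed_support (a # ys) - signed_support (b # xs)"
  by (auto simp: mem_signed_support)

private lemma inner: "signed_cycle \<gamma>' (b # xs) \<circ> u \<in> signed_perms (D - signed_support (a # ys))"
  using cycle_comp_signed_perms[OF signed_set_Diff[OF D] dist(2) subs(2)] u[unfolded diff] by blast

lemma weight_two_cycles:
  "weight D (signed_cycle \<gamma> (a # ys) \<circ> (signed_cycle \<gamma>' (b # xs) \<circ> u)) =
    cycle_weight \<gamma> (length ys) * (cycle_weight \<gamma>' (length xs) * weight (D - signed_support (a # xs @ b # ys)) u)"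
  unfolding weight_cycle[OF D dist(1) subs(1) inner]
    weight_cycle[OF signed_set_Diff[OF D] dist(2) subs(2) u[unfolded diff]] diff ..

lemma num_balanced_two_cycles:
  "num_balanced D (signed_cycle \<gamma> (a # ys) \<circ> (signed_cycle \<gamma>' (b # xs) \<circ> u)) =
    of_bool \<gamma> + (of_bool \<gamma>' + num_balanced (D - signed_support (a # xs @ b # ys)) u)"
  unfolding num_balanced_cycle[OF D dist(1) subs(1) inner]
    num_balanced_cycle[OF signed_set_Diff[OF D] dist(2) subs(2) u[unfolded diff]] diff ..

lemma abs_length_two_cycles:
  assumes n: "D = signed_points n"
  shows "abs_length n (signed_cycle \<gamma> (a # ys) \<circ> (signed_cycle \<gamma>' (b # xs) \<circ> u)) =
    length ys + of_bool \<gamma> + (length xs + of_bool \<gamma>' + abs_length n u)"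
proof -
  have "D - signed_support (a # xs @ b # ys) \<subseteq> D - signed_support (b # xs)"
    by (auto simp: mem_signed_support)
  then have "u \<in> signed_perms (D - signed_support (b # xs))" using u signed_perms_mono by blast
  then have "abs_length n (signed_cycle \<gamma>' (b # xs) \<circ> u) = length xs + of_bool \<gamma>' + abs_length n u"
    by (intro abs_length_signed_cycle) (use dist(2) sub n in auto)
  then show ?thesis
    using abs_length_signed_cycle[OF dist(1) subs(1)[unfolded n] inner[unfolded n]] by simp
qed

lemma cycle_comp_swap_same:
  "(signed_cycle \<beta> (a # xs @ b # ys) \<circ> u) \<circ> signed_swap a b
    = signed_cycle \<beta> (a # ys) \<circ> (signed_cycle False (b # xs) \<circ> u)"
proof -
  have "(signed_cycle \<beta> (a # xs @ b # ys) \<circ> u) \<circ> signed_swap a b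
      = (signed_cycle \<beta> (a # xs @ b # ys) \<circ> signed_swap a b) \<circ> u"
    by (rule fixes_support_comp_swap[OF u]) (simp_all add: mem_signed_support)
  then show ?thesis unfolding signed_cycle_split_same[OF d] by (simp only: comp_assoc)
qed

lemma cycle_comp_swap_opposite:
  "(signed_cycle True (a # xs @ b # ys) \<circ> u) \<circ> signed_swap a (- b)
    = signed_cycle False (a # map uminus ys) \<circ> (signed_cycle True (b # map uminus xs) \<circ> u)"
proof -
  have "(signed_cycle True (a # xs @ b # ys) \<circ> u) \<circ> signed_swap a (- b)
      = (signed_cycle True (a # xs @ b # ys) \<circ> signed_swap a (- b)) \<circ> u"
    by (rule fixes_support_comp_swap[OF u]) (simp_all add: mem_signed_support)
  then show ?thesis unfolding signed_cycle_split_opposite[OF d] by (simp only: comp_assoc)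
qed

end

lemma cycle_comp_swap_neg:
  assumes "abs_distinct (a # as)" "u \<in> signed_perms (D - signed_support (a # as))"
  shows "(signed_cycle True (a # as) \<circ> u) \<circ> signed_swap a (- a) = signed_cycle False (a # map uminus as) \<circ> u"
proof -
  have "(signed_cycle True (a # as) \<circ> u) \<circ> signed_swap a (- a)
      = (signed_cycle True (a # as) \<circ> signed_swap a (- a)) \<circ> u"
    by (rule fixes_support_comp_swap[OF assms(2)]) (simp_all add: mem_signed_support)
  then show ?thesis unfolding balanced_comp_neg[OF assms(1)] .
qed

lemma sum_set_nth:
  assumes "distinct as" shows "(\<Sum>b\<in>set as. f b) = (\<Sum>i<length as. f (as ! i))"
  by (rule sum.reindex_bij_betw[symmetric]) (simp add: bij_betw_nth assms)

lemma orb_cycle_minus_head: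
  assumes D: "signed_set D" and d: "abs_distinct (a # as)" and sub: "set (a # as) \<subseteq> D"
    and u: "u \<in> signed_perms (D - signed_support (a # as))"
  shows "orb (signed_cycle \<beta> (a # as) \<circ> u) a - {a} =
    (if \<beta> then insert (- a) (set as \<union> uminus ` set as) else set as)"
proof -
  have "a \<notin> set as" "- a \<notin> set as" "a \<noteq> - a" using d by auto
  then show ?thesis unfolding orb_cycle_head[OF D d sub u] by (auto simp: signed_support_def)
qed

text \<open>The sum over all reflections cutting the cycle of \<open>a\<close> unfolds to the recurrences of the
  two weight sequences.\<close>

lemma weight_cut_sum:
  assumes D: "signed_set D" and u: "u \<in> signed_perms D" and a: "a \<in> D" "u a \<noteq> a"
  shows "weight D u + (\<Sum>b\<in>orb u a - {a}. weight D (u \<circ> signed_swap a b)) = 0"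
proof -
  obtain \<beta> as u' where dec: "abs_distinct (a # as)" "set as \<subseteq> D"
    "u' \<in> signed_perms (D - signed_support (a # as))" "u = signed_cycle \<beta> (a # as) \<circ> u'"
    using signed_perms_cycle_decomp[OF D u a(1)] .
  have sub: "set (a # as) \<subseteq> D" using dec(2) a by simp
  define W where "W = weight (D - signed_support (a # as)) u'"
  let ?k = "length as"
  have dist: "distinct as" using abs_distinct_imp_distinct[OF dec(1)] by simp
  have split: "a # as = a # take i as @ as ! i # drop (Suc i) as"
    "length (drop (Suc i) as) = ?k - Suc i" "length (take i as) = i" if "i < ?k" for i
    using that id_take_nth_drop[OF that] by auto
  \<comment> \<open>Cutting at the entry with index \<open>i\<close>: the piece of \<open>a\<close>
    keeps the flag and has \<open>?k - Suc i\<close> further entries, the other is paired with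
    \<open>i\<close> further entries.\<close>
  have same: "weight D (u \<circ> signed_swap a (as ! i))
      = cycle_weight \<beta> (?k - Suc i) * paired_weight i * W" if "i < ?k" for i
  proof -
    note s = split[OF that]
    note r = dec(1)[unfolded s(1)] sub[unfolded s(1)] dec(3)[unfolded s(1)]
    have "u \<circ> signed_swap a (as ! i) = signed_cycle \<beta> (a # drop (Suc i) as) \<circ> (signed_cycle False (as ! i # take i as) \<circ> u')"
      unfolding dec(4) using cycle_comp_swap_same[OF D r] by (simp only: s(1)[symmetric])
    then show ?thesis
      using weight_two_cycles[OF D r] unfolding s(1)[symmetric]
      by (simp add: s(2,3) W_def cycle_weight_def del: length_take length_drop)
  qed
  \<comment> \<open>Cutting at a negated entry, possible in a balanced cycle only: now the piece of
    \<open>a\<close> is paired and the other one balanced.\<close>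
  have opp: "weight D (u \<circ> signed_swap a (- (as ! i)))
      = paired_weight (?k - Suc i) * balanced_weight i * W" if "i < ?k" \<beta> for i
  proof -
    note s = split[OF that(1)]
    note r = dec(1)[unfolded s(1)] sub[unfolded s(1)] dec(3)[unfolded s(1)]
    let ?xs = "map uminus (take i as)" and ?ys = "map uminus (drop (Suc i) as)"
    have e: "u \<circ> signed_swap a (- (as ! i)) = signed_cycle False (a # ?ys) \<circ> (signed_cycle True (as ! i # ?xs) \<circ> u')"
      unfolding dec(4) using cycle_comp_swap_opposite[OF D r] that(2) by (simp only: s(1)[symmetric])
    have "set (a # ?xs @ as ! i # ?ys) \<subseteq> D"
      using r(2) signed_set_neg_iff[OF D] by auto
    from weight_two_cycles[OF D _ this, of u' False True] r(1,3) show ?thesis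
      unfolding e abs_distinct_minus_parts signed_support_minus_parts s(1)[symmetric]
      by (simp add: s(2,3) W_def cycle_weight_def del: length_take length_drop)
  qed
  have w0: "weight D u = cycle_weight \<beta> ?k * W"
    unfolding dec(4) W_def by (rule weight_cycle[OF D dec(1) sub dec(3)])
  show ?thesis
  proof (cases \<beta>)
    case False
    \<comment> \<open>The paired recurrence fails for a cycle of one entry, which is where
      \<open>u a \<noteq> a\<close> enters.\<close>
    have "?k > 0"
    proof (rule ccontr)
      assume "\<not> ?k > 0"
      then have "u a = u' a" using dec(4) False by simp
      also have "\<dots> = a" by (rule signed_permsD(3)[OF dec(3)]) (simp add: mem_signed_support)
      finally show False using a(2) by simp
    qed
    have "orb u a - {a} = set as"
      unfolding dec(4) orb_cycle_minus_head[OF D dec(1) sub dec(3)] using False by simp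
    then have "(\<Sum>b\<in>orb u a - {a}. weight D (u \<circ> signed_swap a b))
        = (\<Sum>i<?k. paired_weight (?k - Suc i) * paired_weight i * W)"
      by (simp add: sum_set_nth[OF dist] same False cycle_weight_def)
    then have "weight D u + (\<Sum>b\<in>orb u a - {a}. weight D (u \<circ> signed_swap a b))
        = (paired_weight ?k + (\<Sum>i<?k. paired_weight (?k - Suc i) * paired_weight i)) * W"
      using w0 False by (simp add: cycle_weight_def sum_distrib_left algebra_simps)
    then show ?thesis using paired_weight_rec[OF \<open>?k > 0\<close>] by simp
  next
    case True
    have "weight D (u \<circ> signed_swap a (- a)) = paired_weight ?k * W"
    proof -
      have d: "abs_distinct (a # map uminus as)" using dec(1) by (simp only: abs_distinct_Cons_minus)
      have s: "signed_support (a # map uminus as) = signed_support (a # as)"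
        by (simp add: signed_support_Cons signed_support_minus)
      have "set (a # map uminus as) \<subseteq> D" using sub signed_set_neg_iff[OF D] by auto
      from weight_cycle[OF D d this, of u' False] dec(3) have
        "weight D (signed_cycle False (a # map uminus as) \<circ> u') = paired_weight ?k * W"
        unfolding s W_def by (simp add: cycle_weight_def)
      then show ?thesis using dec(4) True cycle_comp_swap_neg[OF dec(1,3)] by simp
    qed
    moreover have "(\<Sum>b\<in>set as. weight D (u \<circ> signed_swap a b))
        = (\<Sum>i<?k. balanced_weight (?k - Suc i) * paired_weight i * W)"
      by (simp add: sum_set_nth[OF dist] same True cycle_weight_def)
    moreover have "(\<Sum>b\<in>uminus ` set as. weight D (u \<circ> signed_swap a b))
        = (\<Sum>i<?k. paired_weight (?k - Suc i) * balanced_weight i * W)"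
      by (simp add: sum.reindex sum_set_nth[OF dist] opp True)
    moreover have "(\<Sum>b\<in>orb u a - {a}. weight D (u \<circ> signed_swap a b)) = weight D (u \<circ> signed_swap a (- a))
        + ((\<Sum>b\<in>set as. weight D (u \<circ> signed_swap a b)) + (\<Sum>b\<in>uminus ` set as. weight D (u \<circ> signed_swap a b)))"
    proof -
      have "orb u a - {a} = insert (- a) (set as \<union> uminus ` set as)"
        unfolding dec(4) orb_cycle_minus_head[OF D dec(1) sub dec(3)] using True by simp
      moreover have "- a \<notin> set as \<union> uminus ` set as" using dec(1) by auto
      moreover have "set as \<inter> uminus ` set as = {}"
        using abs_distinct_neg[of as] dec(1) by auto
      ultimately show ?thesis by (simp add: sum.union_disjoint)
    qed
    ultimately have "weight D u + (\<Sum>b\<in>orb u a - {a}. weight D (u \<circ> signed_swap a b))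
        = (balanced_weight ?k + paired_weight ?k + (\<Sum>i<?k. balanced_weight (?k - Suc i) * paired_weight i
          + paired_weight (?k - Suc i) * balanced_weight i)) * W"
      using w0 True by (simp add: cycle_weight_def sum_distrib_left sum.distrib algebra_simps)
    then show ?thesis using balanced_weight_rec by simp
  qed
qed

text \<open>A cut produces two paired cycles, or a paired and a balanced one, or turns a balanced
  cycle into a paired one of the same size. In each case the length formula loses one, and no
  balanced cycle is added.\<close>

lemma cut_lowers_length:
  assumes u: "u \<in> signed_perms (signed_points n)" and a: "a \<in> signed_points n"
    and b: "b \<in> orb u a - {a}"
  shows "abs_length n u = Suc (abs_length n (u \<circ> signed_swap a b))"
    and "num_balanced (signed_points n) (u \<circ> signed_swap a b) \<le> num_balanced (signed_points n) u"
proof -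
  let ?D = "signed_points n"
  let ?P = "abs_length n u = Suc (abs_length n (u \<circ> signed_swap a b)) \<and>
    num_balanced ?D (u \<circ> signed_swap a b) \<le> num_balanced ?D u"
  have D: "signed_set ?D" by (rule signed_set_points)
  obtain \<beta> as u' where dec: "abs_distinct (a # as)" "set as \<subseteq> ?D"
    "u' \<in> signed_perms (?D - signed_support (a # as))" "u = signed_cycle \<beta> (a # as) \<circ> u'"
    using signed_perms_cycle_decomp[OF D u a(1)] .
  have sub: "set (a # as) \<subseteq> ?D" using dec(2) a by simp
  have l: "abs_length n u = length as + of_bool \<beta> + abs_length n u'"
    unfolding dec(4) by (rule abs_length_signed_cycle[OF dec(1) sub dec(3)])
  have nb: "num_balanced ?D u = of_bool \<beta> + num_balanced (?D - signed_support (a # as)) u'"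
    unfolding dec(4) by (rule num_balanced_cycle[OF D dec(1) sub dec(3)])
  consider "b \<in> set as" | c where "c \<in> set as" "b = - c" \<beta> | "b = - a" \<beta>
    using b unfolding dec(4) orb_cycle_minus_head[OF D dec(1) sub dec(3)] by (auto split: if_splits)
  then have ?P
  proof cases
    case 1
    then obtain xs ys where s: "a # as = a # xs @ b # ys" by (metis split_list)
    note r = dec(1)[unfolded s] sub[unfolded s] dec(3)[unfolded s]
    have "u \<circ> signed_swap a b = signed_cycle \<beta> (a # ys) \<circ> (signed_cycle False (b # xs) \<circ> u')"
      unfolding dec(4) s by (rule cycle_comp_swap_same[OF D r])
    then show ?thesis
      using abs_length_two_cycles[OF D r refl] num_balanced_two_cycles[OF D r] l nb s by simp
  next
    case 2
    then obtain xs ys where s: "a # as = a # xs @ c # ys" by (metis split_list)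
    note r = dec(1)[unfolded s] sub[unfolded s] dec(3)[unfolded s]
    let ?xs = "map uminus xs" and ?ys = "map uminus ys"
    have e: "u \<circ> signed_swap a b = signed_cycle False (a # ?ys) \<circ> (signed_cycle True (c # ?xs) \<circ> u')"
      unfolding dec(4) s 2(2) using cycle_comp_swap_opposite[OF D r] 2(3) by simp
    have sub': "set (a # ?xs @ c # ?ys) \<subseteq> ?D"
      using r(2) signed_set_neg_iff[OF D] by auto
    have d': "abs_distinct (a # ?xs @ c # ?ys)" using r(1) by (simp only: abs_distinct_minus_parts)
    have u'': "u' \<in> signed_perms (?D - signed_support (a # ?xs @ c # ?ys))"
      using r(3) by (simp only: signed_support_minus_parts)
    show ?thesis
      using abs_length_two_cycles[OF D d' sub' u'' refl] num_balanced_two_cycles[OF D d' sub' u'']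
      unfolding e signed_support_minus_parts s[symmetric] using l nb 2(3) s by simp
  next
    case 3
    have d': "abs_distinct (a # map uminus as)" using dec(1) by (simp only: abs_distinct_Cons_minus)
    have s: "signed_support (a # map uminus as) = signed_support (a # as)"
      by (simp add: signed_support_Cons signed_support_minus)
    have sub': "set (a # map uminus as) \<subseteq> ?D" using sub signed_set_neg_iff[OF D] by auto
    have e: "u \<circ> signed_swap a b = signed_cycle False (a # map uminus as) \<circ> u'"
      using dec(4) 3 cycle_comp_swap_neg[OF dec(1,3)] by simp
    show ?thesis
      using abs_length_signed_cycle[OF d' sub', of u' False] num_balanced_cycle[OF D d' sub', of u' False]
      unfolding e s using dec(3) l nb 3 by simp
  qed
  then show "abs_length n u = Suc (abs_length n (u \<circ> signed_swap a b))"
    "num_balanced ?D (u \<circ> signed_swap a b) \<le> num_balanced ?D u" by auto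
qed

text \<open>The signed indicator of a paired cycle: it is well defined and odd because the orbit and
  its negative are disjoint.\<close>

lemma unbalanced_indicator_odd_fix:
  assumes D: "signed_set D" and u: "u \<in> signed_perms D" and c: "c \<in> D" "- c \<notin> orb u c"
  shows "(\<lambda>i. if i \<in> orb u c then 1 else if - i \<in> orb u c then - 1 else 0) \<in> odd_fix D u"
proof -
  have fin: "finite D" using D by (simp add: signed_set_def)
  note uD = signed_permsD(1)[OF u]
  have no: "\<not> (i \<in> orb u c \<and> - i \<in> orb u c)" for i
  proof
    assume i: "i \<in> orb u c \<and> - i \<in> orb u c"
    have "orb u (- i) = uminus ` orb u i" using orb_minus signed_permsD(2)[OF u] by blast
    moreover have "orb u i = orb u c" "orb u (- i) = orb u c" using i orb_eq[OF fin uD] by auto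
    ultimately have "orb u c = uminus ` orb u c" by simp
    then have "- c \<in> orb u c" using orb_self[of c u] by blast
    then show False using c by blast
  qed
  have step: "u i \<in> orb u c \<longleftrightarrow> i \<in> orb u c" for i
  proof
    assume "u i \<in> orb u c"
    moreover have "i \<in> orb u (u i)" using orb_sym[OF fin uD orb_step[OF orb_self]] .
    ultimately show "i \<in> orb u c" using orb_trans by blast
  qed (rule orb_step)
  have "i \<in> D" if "i \<in> orb u c \<or> - i \<in> orb u c" for i
    using that orb_in[OF u c(1)] signed_set_neg_iff[OF D] by blast
  moreover have "- u i \<in> orb u c \<longleftrightarrow> - i \<in> orb u c" for i
    using step[of "- i"] signed_permsD(2)[OF u, of i] by simp
  ultimately show ?thesis using no step by (auto simp: odd_fix_def)
qed

text \<open>A converse of \<open>cut_lowers_length\<close>. All invariant odd functions agree at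
  \<open>a\<close> and \<open>b\<close>; the indicator of a paired cycle through either point would
  separate them, so both lie on balanced cycles, hence on the same one. With two balanced cycles
  this breaks down, since joining them lowers the length.\<close>

lemma lower_length_imp_cut:
  assumes u: "u \<in> signed_perms (signed_points n)"
    and nb: "num_balanced (signed_points n) u \<le> 1"
    and ab: "a \<in> signed_points n" "b \<in> signed_points n"
    and l: "abs_length n u = Suc (abs_length n (u \<circ> signed_swap a b))"
  shows "b \<in> orb u a"
proof (rule ccontr)
  let ?D = "signed_points n"
  assume b: "b \<notin> orb u a"
  have D: "signed_set ?D" and fin: "finite ?D" using signed_set_points by (auto simp: signed_set_def)
  note uD = signed_permsD(1)[OF u]
  have a: "a \<notin> orb u b" using b orb_sym[OF fin uD] by blast
  have eq: "\<phi> a = \<phi> b" if "\<phi> \<in> odd_fix ?D u" for \<phi>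
    by (rule abs_length_comp_swap_imp_values_eq[OF u ab l[symmetric] that])
  have ne: "(1 :: 3) \<noteq> - 1" using three_eq_minus_iff[of 1] by simp
  have bal: "- a \<in> orb u a"
  proof (rule ccontr)
    assume "- a \<notin> orb u a"
    from eq[OF unbalanced_indicator_odd_fix[OF D u ab(1) this]] show False
      using b orb_self[of a u] ne by (simp split: if_splits)
  qed
  moreover have bal': "- b \<in> orb u b"
  proof (rule ccontr)
    assume "- b \<notin> orb u b"
    from eq[OF unbalanced_indicator_odd_fix[OF D u ab(2) this]] show False
      using a orb_self[of b u] ne by (simp split: if_splits)
  qed
  have blk: "signed_block u c = orb u c" if "- c \<in> orb u c" for c
  proof -
    have "uminus ` orb u c = orb u (- c)" using orb_minus signed_permsD(2)[OF u] by metis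
    also have "\<dots> = orb u c" by (rule orb_eq[OF fin uD that])
    finally show ?thesis by (simp add: signed_block_def)
  qed
  have bb: "orb u c \<in> {B \<in> blocks ?D u. balanced_block u B}" if "- c \<in> orb u c" "c \<in> ?D" for c
    using blk[OF that(1)] that orb_self[of c u] unfolding blocks_def balanced_block_def by auto
  have "finite {B \<in> blocks ?D u. balanced_block u B}" using fin by (simp add: blocks_def)
  then have "orb u a = orb u b"
    using nb bb[OF bal ab(1)] bb[OF bal' ab(2)] unfolding num_balanced_def
    by (metis (no_types, lifting) One_nat_def card_le_Suc0_iff_eq)
  then show False using b orb_self[of b u] by simp
qed

section \<open>The absolute order and the ideal\<close>

lemma abs_le_iff:
  "abs_le n u v \<longleftrightarrow> u \<in> signed_perms (signed_points n) \<and> v \<in> signed_perms (signed_points n) \<and>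
     abs_length n u + abs_length n (inv u \<circ> v) = abs_length n v"
  by (simp add: abs_le_def hyperoctahedral_eq)

text \<open>Together with \<open>abs_leE\<close> this expresses the order by factorisations with
  additive lengths, so that inverses can be avoided.\<close>

lemma abs_le_compI:
  assumes "u \<in> signed_perms (signed_points n)" "v \<in> signed_perms (signed_points n)"
    "abs_length n (u \<circ> v) = abs_length n u + abs_length n v"
  shows "abs_le n u (u \<circ> v)"
proof -
  have "inv u \<circ> (u \<circ> v) = v" using signed_perms_inv_comp(2)[OF assms(1)] by (simp add: o_assoc)
  then show ?thesis using assms comp_signed_perms[OF assms(1,2)] by (simp add: abs_le_iff)
qed

lemma abs_leE:
  assumes "abs_le n u w"
  obtains v where "u \<in> signed_perms (signed_points n)" "v \<in> signed_perms (signed_points n)"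
    "w = u \<circ> v" "abs_length n w = abs_length n u + abs_length n v"
proof (rule that[of "inv u \<circ> w"])
  have u: "u \<in> signed_perms (signed_points n)" and w: "w \<in> signed_perms (signed_points n)"
    using assms by (auto simp: abs_le_iff)
  show "u \<in> signed_perms (signed_points n)" by (rule u)
  show "inv u \<circ> w \<in> signed_perms (signed_points n)" by (rule comp_signed_perms[OF inv_signed_perms[OF u] w])
  show "w = u \<circ> (inv u \<circ> w)" using signed_perms_inv_comp(1)[OF u] by (simp add: o_assoc)
  show "abs_length n w = abs_length n u + abs_length n (inv u \<circ> w)" using assms by (simp add: abs_le_iff)
qed

lemma abs_le_refl: "u \<in> signed_perms (signed_points n) \<Longrightarrow> abs_le n u u"
  using abs_le_compI[of u n id] by (simp add: id_signed_perms abs_length_id)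

lemma abs_le_id: "u \<in> signed_perms (signed_points n) \<Longrightarrow> abs_le n id u"
  using abs_le_compI[of id n u] by (simp add: id_signed_perms abs_length_id)

lemma abs_le_antisym:
  assumes "abs_le n u w" "abs_le n w u" shows "u = w"
proof -
  obtain v where v: "v \<in> signed_perms (signed_points n)" "w = u \<circ> v"
    "abs_length n w = abs_length n u + abs_length n v" using abs_leE[OF assms(1)] .
  moreover have "abs_length n w \<le> abs_length n u" using assms(2) by (simp add: abs_le_iff)
  ultimately have "v = id" by (intro abs_length_eq_0) auto
  then show ?thesis using v by simp
qed

lemma abs_le_trans:
  assumes "abs_le n u v" "abs_le n v w" shows "abs_le n u w"
proof -
  obtain x where x: "u \<in> signed_perms (signed_points n)" "x \<in> signed_perms (signed_points n)" "v = u \<circ> x"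
    "abs_length n v = abs_length n u + abs_length n x" using abs_leE[OF assms(1)] .
  obtain y where y: "y \<in> signed_perms (signed_points n)" "w = v \<circ> y"
    "abs_length n w = abs_length n v + abs_length n y" using abs_leE[OF assms(2)] .
  have w: "w = u \<circ> (x \<circ> y)" using x y by (simp add: o_assoc)
  have xy: "x \<circ> y \<in> signed_perms (signed_points n)" by (rule comp_signed_perms[OF x(2) y(1)])
  have "abs_length n w \<le> abs_length n u + abs_length n (x \<circ> y)"
    unfolding w by (rule abs_length_comp_le[OF x(1) xy])
  moreover have "abs_length n (x \<circ> y) \<le> abs_length n x + abs_length n y"
    by (rule abs_length_comp_le[OF x(2) y(1)])
  ultimately show ?thesis unfolding w using x y w by (intro abs_le_compI xy) auto
qed

lemma signed_swap_in_points:
  "a \<in> signed_points n \<Longrightarrow> b \<in> signed_points n \<Longrightarrow> signed_swap a b \<in> signed_perms (signed_points n)"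
  by (rule signed_swap_signed_perms[OF signed_set_points])

lemma abs_length_comp_swap_ge:
  assumes "u \<in> signed_perms (signed_points n)" "a \<in> signed_points n" "b \<in> signed_points n"
  shows "abs_length n u \<le> Suc (abs_length n (u \<circ> signed_swap a b))"
proof -
  have "abs_length n ((u \<circ> signed_swap a b) \<circ> signed_swap a b)
      \<le> abs_length n (u \<circ> signed_swap a b) + abs_length n (signed_swap a b)"
    by (intro abs_length_comp_le comp_signed_perms signed_swap_in_points assms)
  then show ?thesis using abs_length_swap[OF assms(2,3)] by (simp add: comp_assoc)
qed

lemma abs_le_comp_swap:
  assumes "c \<in> signed_perms (signed_points n)" "a \<in> signed_points n" "b \<in> signed_points n"
    "abs_length n c = Suc (abs_length n (c \<circ> signed_swap a b))"
  shows "abs_le n (c \<circ> signed_swap a b) c"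
proof -
  let ?u = "c \<circ> signed_swap a b"
  have u: "?u \<in> signed_perms (signed_points n)"
    by (intro comp_signed_perms signed_swap_in_points assms)
  have s: "signed_swap a b \<in> signed_perms (signed_points n)"
    by (intro signed_swap_in_points assms)
  have c: "c = ?u \<circ> signed_swap a b" by (simp add: comp_assoc)
  have "abs_length n c \<le> abs_length n ?u + abs_length n (signed_swap a b)"
    using abs_length_comp_le[OF u s] c by simp
  then have "abs_length n (?u \<circ> signed_swap a b) = abs_length n ?u + abs_length n (signed_swap a b)"
    using abs_length_swap[OF assms(2,3)] assms(4) c by simp
  from abs_le_compI[OF u s this] c show ?thesis by simp
qed

text \<open>Write the upper element as \<open>u \<circ> v\<close> and remove reflections from the
  right of \<open>v\<close>. Each one lowers the length of the product, so it cuts a cycle as long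
  as at most one is balanced, and a cut preserves this bound.\<close>

lemma num_balanced_mono:
  assumes "abs_le n u w" "num_balanced (signed_points n) w \<le> 1"
  shows "num_balanced (signed_points n) u \<le> 1"
proof -
  let ?D = "signed_points n"
  have "num_balanced ?D u \<le> 1"
    if "u \<in> signed_perms ?D" "v \<in> signed_perms ?D" "abs_length n (u \<circ> v) = abs_length n u + abs_length n v"
      "num_balanced ?D (u \<circ> v) \<le> 1" for v
    using that
  proof (induction "abs_length n v" arbitrary: v)
    case 0
    have "v = id" by (rule abs_length_eq_0) (use 0 in auto)
    then show ?case using 0 by simp
  next
    case (Suc m)
    then have "v \<noteq> id" by (metis abs_length_id old.nat.distinct(2))
    then obtain k where k: "v k \<noteq> k" by (auto simp: fun_eq_iff)
    let ?s = "signed_swap k (v k)"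
    note u = \<open>u \<in> signed_perms ?D\<close> and v = \<open>v \<in> signed_perms ?D\<close>
    have kD: "k \<in> ?D" "v k \<in> ?D" using k signed_permsD(3,6)[OF v] by auto
    have uv: "u \<circ> v \<in> signed_perms ?D" by (rule comp_signed_perms[OF u v])
    have vs: "v \<circ> ?s \<in> signed_perms ?D" by (intro comp_signed_perms signed_swap_in_points kD v)
    have lv: "abs_length n v = Suc (abs_length n (v \<circ> ?s))" by (rule abs_length_remove_point_right[OF v k])
    have e: "(u \<circ> v) \<circ> ?s = u \<circ> (v \<circ> ?s)" by (simp only: comp_assoc)
    \<comment> \<open>Subadditivity bounds the new length from above and a single reflection bounds
      it from below; both bounds are attained.\<close>
    have "abs_length n (u \<circ> (v \<circ> ?s)) \<le> abs_length n u + abs_length n (v \<circ> ?s)"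
      by (rule abs_length_comp_le[OF u vs])
    moreover have "abs_length n (u \<circ> v) \<le> Suc (abs_length n ((u \<circ> v) \<circ> ?s))"
      by (rule abs_length_comp_swap_ge[OF uv kD])
    ultimately have l: "abs_length n (u \<circ> (v \<circ> ?s)) = abs_length n u + abs_length n (v \<circ> ?s)"
      and l': "abs_length n (u \<circ> v) = Suc (abs_length n ((u \<circ> v) \<circ> ?s))"
      using Suc(5) lv unfolding e by linarith+
    have "v k \<in> orb (u \<circ> v) k" by (rule lower_length_imp_cut[OF uv Suc(6) kD l'])
    then have "num_balanced ?D ((u \<circ> v) \<circ> ?s) \<le> num_balanced ?D (u \<circ> v)"
      using k by (intro cut_lowers_length(2)[OF uv kD(1)]) simp
    then have "num_balanced ?D (u \<circ> (v \<circ> ?s)) \<le> 1" unfolding e using Suc(6) by linarith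
    then show ?case using Suc(1)[of "v \<circ> ?s"] Suc(2) lv u vs l by simp
  qed
  then show ?thesis using abs_leE[OF assms(1)] assms(2) by metis
qed

lemma card_signed_points: "card (signed_points n) = 2 * n"
  by (simp add: signed_points_def)

lemma signed_perms_empty: "signed_perms {} = {id}"
  by (auto simp: signed_perms_def)

lemma coxeter_elements_eq:
  "coxeter_elements n = {signed_cycle True as | as. length as = n \<and> set as \<subseteq> signed_points n \<and> abs_distinct as}"
proof -
  have "set as \<subseteq> signed_points n \<Longrightarrow> distinct (map abs as) \<longleftrightarrow> abs_distinct as" for as
    using signed_set_points[of n] unfolding abs_distinct_def signed_set_def by blast
  then show ?thesis unfolding coxeter_elements_def using balanced_cycle_eq by metis
qed

lemma coxeter_element_cases:
  assumes "n \<ge> 1" "c \<in> coxeter_elements n"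
  shows "c \<in> signed_perms (signed_points n)" "num_balanced (signed_points n) c \<le> 1"
proof -
  let ?D = "signed_points n"
  obtain as where as: "c = signed_cycle True as" "length as = n" "set as \<subseteq> ?D" "abs_distinct as"
    using assms(2) unfolding coxeter_elements_eq by blast
  then obtain a as' where a: "as = a # as'" using assms(1) by (cases as) auto
  have D: "signed_set ?D" by (rule signed_set_points)
  show "c \<in> signed_perms ?D" unfolding as by (rule signed_cycle_signed_perms[OF D as(3)])
  have "card (signed_support as) = card ?D" using card_signed_support[OF as(4)] as(2) by (simp add: card_signed_points)
  then have "signed_support as = ?D"
    using signed_support_subset[OF D as(3)] D by (intro card_subset_eq) (auto simp: signed_set_def)
  then show "num_balanced ?D c \<le> 1"
    using num_balanced_cycle[OF D, of a as' id True] as(1,3,4) id_signed_perms unfolding a by simp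
qed

text \<open>Undo cuts: merge another cycle into the one through \<open>a\<close>, which raises the
  length by one, until no points are left outside. A remaining paired cycle is made balanced by a
  sign change.\<close>

lemma ex_coxeter_element_above:
  assumes "abs_distinct (a # as)" "set (a # as) \<subseteq> signed_points n"
    "u' \<in> signed_perms (signed_points n - signed_support (a # as))" "u = signed_cycle \<beta> (a # as) \<circ> u'"
    "num_balanced (signed_points n) u \<le> 1"
  shows "\<exists>c\<in>coxeter_elements n. abs_le n u c"
  using assms
proof (induction "card (signed_points n - signed_support (a # as))" arbitrary: a as u u' \<beta> rule: less_induct)
  case less
  let ?D = "signed_points n"
  let ?E = "?D - signed_support (a # as)"
  note d = less.prems(1) and sub = less.prems(2) and u' = less.prems(3)
  have D: "signed_set ?D" by (rule signed_set_points)
  have u: "u \<in> signed_perms ?D"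
    using cycle_comp_signed_perms[OF D d sub u', of \<beta>] less.prems(4) by simp
  have lu: "abs_length n u = length as + of_bool \<beta> + abs_length n u'"
    using abs_length_signed_cycle[OF d sub u', of \<beta>] less.prems(4) by simp
  show ?case
  proof (cases "?E = {}")
    case True
    then have u'_id: "u' = id" using u' unfolding True signed_perms_empty by blast
    then have ueq: "u = signed_cycle \<beta> (a # as)" using less.prems(4) by simp
    have "signed_support (a # as) = ?D" using True signed_support_subset[OF D sub] by blast
    then have len: "length (a # as) = n"
      using card_signed_support[OF d] by (simp add: card_signed_points)
    show ?thesis
    proof (cases \<beta>)
      case True
      then have "u = signed_cycle True (a # as)" using ueq by simp
      then have "u \<in> coxeter_elements n" unfolding coxeter_elements_eq using len sub d by blast
      then show ?thesis using abs_le_refl[OF u] by blast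
    next
      case False
      \<comment> \<open>The tail is negated in advance because removing the sign change negates it
        again.\<close>
      define c where "c = signed_cycle True (a # map uminus as)"
      have d': "abs_distinct (a # map uminus as)" using d by (simp only: abs_distinct_Cons_minus)
      have sub': "set (a # map uminus as) \<subseteq> ?D" using sub signed_set_neg_iff[OF D] by auto
      have "c \<in> coxeter_elements n" unfolding coxeter_elements_eq c_def using d' sub' len
        by (intro CollectI exI[of _ "a # map uminus as"]) (simp del: abs_distinct_Cons)
      moreover have uc: "u = c \<circ> signed_swap a (- a)"
        using balanced_comp_neg[OF d'] False unfolding c_def ueq by (simp add: comp_def)
      moreover have "abs_le n (c \<circ> signed_swap a (- a)) c"
      proof (rule abs_le_comp_swap)
        show "c \<in> signed_perms ?D" unfolding c_def by (rule signed_cycle_signed_perms[OF D sub'])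
        show "a \<in> ?D" "- a \<in> ?D" using sub signed_set_neg_iff[OF D] by auto
        have "abs_length n (signed_cycle True (a # map uminus as) \<circ> id) = Suc (length as)"
          using abs_length_signed_cycle[OF d' sub' id_signed_perms, of True] by (simp add: abs_length_id)
        then have "abs_length n c = Suc (length as)" unfolding c_def by (simp only: comp_id)
        then show "abs_length n c = Suc (abs_length n (c \<circ> signed_swap a (- a)))"
          using lu False u'_id unfolding uc[symmetric] by (simp add: abs_length_id)
      qed
      ultimately show ?thesis by metis
    qed
  next
    case False
    then obtain m where m: "m \<in> ?E" by blast
    obtain \<gamma> bs u'' where dec: "abs_distinct (m # bs)" "set bs \<subseteq> ?E"
      "u'' \<in> signed_perms (?E - signed_support (m # bs))" "u' = signed_cycle \<gamma> (m # bs) \<circ> u''"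
      using signed_perms_cycle_decomp[OF signed_set_Diff[OF D] u' m] .
    have subE: "set (m # bs) \<subseteq> ?E" using dec(2) m by simp
    have nb: "num_balanced ?D u = of_bool \<beta> + (of_bool \<gamma> + num_balanced (?E - signed_support (m # bs)) u'')"
      using num_balanced_cycle[OF D d sub u', of \<beta>] less.prems(4)
        num_balanced_cycle[OF signed_set_Diff[OF D] dec(1) subE dec(3), of \<gamma>] dec(4) by simp
    have disj: "i \<notin> set (a # as) \<and> - i \<notin> set (a # as)" if "i \<in> set (m # bs)" for i
    proof -
      have "i \<in> ?E" using subE that by blast
      then show ?thesis by (simp add: mem_signed_support)
    qed
    have da: "abs_distinct ((m # bs) @ a # as)"
      unfolding abs_distinct_append using d dec(1) disj by blast
    \<comment> \<open>The induction step for either order of the two cycles. The cycle through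
      \<open>y\<close> must be paired, since a cut at an entry leaves the flag with the piece of the
      head \<open>x\<close>.\<close>
    have merge: "\<exists>c\<in>coxeter_elements n. abs_le n u c"
      if e: "abs_distinct (x # xs @ y # ys)" "set (x # xs @ y # ys) \<subseteq> ?D"
        "signed_support (x # xs @ y # ys) = signed_support (a # as) \<union> signed_support (m # bs)"
        "u = signed_cycle \<delta> (x # ys) \<circ> (signed_cycle False (y # xs) \<circ> u'')" for x xs y ys \<delta>
    proof -
      define w where "w = signed_cycle \<delta> (x # xs @ y # ys) \<circ> u''"
      have "?E - signed_support (m # bs) = ?D - signed_support (x # xs @ y # ys)" using e(3) by blast
      then have u'': "u'' \<in> signed_perms (?D - signed_support (x # xs @ y # ys))" using dec(3) by simp
      have uw: "u = w \<circ> signed_swap x y"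
        unfolding e(4) w_def cycle_comp_swap_same[OF D e(1,2) u''] ..
      have w: "w \<in> signed_perms ?D" unfolding w_def by (rule cycle_comp_signed_perms[OF D e(1,2) u''])
      have "abs_length n w = Suc (abs_length n u)"
        unfolding w_def abs_length_signed_cycle[OF e(1,2) u''] e(4)
          abs_length_two_cycles[OF D e(1,2) u'' refl] by simp
      then have le: "abs_le n u w"
        unfolding uw using e(2) by (intro abs_le_comp_swap w) auto
      have "num_balanced ?D w = num_balanced ?D u"
        unfolding w_def num_balanced_cycle[OF D e(1,2) u''] e(4)
          num_balanced_two_cycles[OF D e(1,2) u''] by simp
      then have nbw: "num_balanced ?D w \<le> 1" using less.prems(5) by simp
      have "?D - signed_support (x # xs @ y # ys) \<subset> ?E"
        using m e(3) by (auto simp: signed_support_Cons)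
      then have "card (?D - signed_support (x # xs @ y # ys)) < card ?E"
        using D by (intro psubset_card_mono) (auto simp: signed_set_def)
      from less.hyps[OF this e(1,2) u'' w_def nbw] le show ?thesis using abs_le_trans by blast
    qed
    show ?thesis
    proof (cases \<gamma>)
      case False
      show ?thesis
      proof (rule merge[of a bs m as \<beta>])
        show "abs_distinct (a # bs @ m # as)" using da unfolding abs_distinct_def by auto
        show "set (a # bs @ m # as) \<subseteq> ?D" using sub subE by auto
        show "u = signed_cycle \<beta> (a # as) \<circ> (signed_cycle False (m # bs) \<circ> u'')"
          using less.prems(4) dec(4) False by simp
      qed (auto simp: signed_support_Cons signed_support_append)
    next
      case True
      \<comment> \<open>Two balanced cycles are excluded, so with the roles of the two cycles
        exchanged the balanced one supplies the head.\<close>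
      then have \<beta>: "\<not> \<beta>" using nb less.prems(5) by auto
      show ?thesis
      proof (rule merge[of m as a bs True])
        show "abs_distinct (m # as @ a # bs)" using da unfolding abs_distinct_def by auto
        show "set (m # as @ a # bs) \<subseteq> ?D" using sub subE by auto
        have "signed_cycle True (m # bs) \<circ> signed_cycle False (a # as) = signed_cycle False (a # as) \<circ> signed_cycle True (m # bs)"
          by (rule signed_perms_commute_cycle[OF signed_cycle_signed_perms[OF signed_set_Diff[OF D] subE]]) blast
        then show "u = signed_cycle True (m # bs) \<circ> (signed_cycle False (a # as) \<circ> u'')"
          using less.prems(4) dec(4) True \<beta> by (simp add: o_assoc)
      qed (auto simp: signed_support_Cons signed_support_append)
    qed
  qed
qed

lemma coxeter_ideal_eq:
  assumes "n \<ge> 1"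
  shows "coxeter_ideal n = {u \<in> signed_perms (signed_points n). num_balanced (signed_points n) u \<le> 1}"
proof (intro equalityI subsetI)
  fix u assume "u \<in> coxeter_ideal n"
  then obtain c where "c \<in> coxeter_elements n" "abs_le n u c" "u \<in> signed_perms (signed_points n)"
    unfolding coxeter_ideal_def generated_order_ideal_def hyperoctahedral_eq by blast
  then show "u \<in> {u \<in> signed_perms (signed_points n). num_balanced (signed_points n) u \<le> 1}"
    using num_balanced_mono coxeter_element_cases(2)[OF assms] by blast
next
  fix u assume "u \<in> {u \<in> signed_perms (signed_points n). num_balanced (signed_points n) u \<le> 1}"
  then have u: "u \<in> signed_perms (signed_points n)" and nb: "num_balanced (signed_points n) u \<le> 1" by auto
  have one: "1 \<in> signed_points n" using assms by (auto simp: signed_points_def)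
  obtain \<beta> as u' where dec: "abs_distinct (1 # as)" "set as \<subseteq> signed_points n"
    "u' \<in> signed_perms (signed_points n - signed_support (1 # as))" "u = signed_cycle \<beta> (1 # as) \<circ> u'"
    using signed_perms_cycle_decomp[OF signed_set_points u one] .
  have "set (1 # as) \<subseteq> signed_points n" using dec(2) one by simp
  from ex_coxeter_element_above[OF dec(1) this dec(3,4) nb] show "u \<in> coxeter_ideal n"
    using u unfolding coxeter_ideal_def generated_order_ideal_def hyperoctahedral_eq by blast
qed

text \<open>Pick a point \<open>k\<close> moved by \<open>y\<close> and write \<open>y = u \<circ> v\<close>. Replacing \<open>(u, v)\<close> by
  \<open>(u \<circ> s, s \<circ> v)\<close> with \<open>s = signed_swap k (v k)\<close> groups the elements below \<open>y\<close> around those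
  \<open>u\<close> with \<open>u k = y k\<close>, and every group is a sum as in \<open>weight_cut_sum\<close>.\<close>

lemma weight_sum_below:
  assumes y: "y \<in> signed_perms (signed_points n)" "num_balanced (signed_points n) y \<le> 1" "y \<noteq> id"
  shows "(\<Sum>u | abs_le n u y. weight (signed_points n) u) = 0"
proof -
  let ?D = "signed_points n"
  let ?w = "weight ?D"
  have D: "signed_set ?D" by (rule signed_set_points)
  obtain k where k: "y k \<noteq> k" using y(3) by (auto simp: fun_eq_iff)
  have kD: "k \<in> ?D" using k signed_permsD(3)[OF y(1)] by blast
  define U where "U = {u. abs_le n u y}"
  define U0 where "U0 = {u \<in> U. u k = y k}"
  define U1 where "U1 = {u \<in> U. u k \<noteq> y k}"
  have fin: "finite U" unfolding U_def
    by (rule finite_subset[OF _ finite_signed_perms[OF D]]) (auto simp: abs_le_iff)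
  define S where "S = (SIGMA u : U0. orb u k - {k})"
  have "(\<Sum>u\<in>U1. ?w u) = (\<Sum>(u, b)\<in>S. ?w (u \<circ> signed_swap k b))"
  proof (rule sum.reindex_bij_witness[where i = "\<lambda>(u, b). u \<circ> signed_swap k b"
        and j = "\<lambda>u. (u \<circ> signed_swap k ((inv u \<circ> y) k), (inv u \<circ> y) k)"])
    fix u assume "u \<in> U1"
    then have le: "abs_le n u y" and uk: "u k \<noteq> y k" by (auto simp: U1_def U_def)
    obtain v where v: "u \<in> signed_perms ?D" "v \<in> signed_perms ?D" "y = u \<circ> v"
      "abs_length n y = abs_length n u + abs_length n v" using abs_leE[OF le] .
    have iv: "inv u \<circ> y = v" using signed_perms_inv_comp(2)[OF v(1)] v(3) by (simp add: o_assoc)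
    have vk: "v k \<noteq> k" using uk v(3) by auto
    have vkD: "v k \<in> ?D" using signed_permsD(6)[OF v(2)] kD by blast
    let ?s = "signed_swap k (v k)"
    show "(case (u \<circ> signed_swap k ((inv u \<circ> y) k), (inv u \<circ> y) k) of (u, b) \<Rightarrow> u \<circ> signed_swap k b) = u"
      by (simp add: comp_assoc)
    have us: "u \<circ> ?s \<in> signed_perms ?D" and sv: "?s \<circ> v \<in> signed_perms ?D"
      by (intro comp_signed_perms signed_swap_in_points v kD vkD)+
    have y': "y = (u \<circ> ?s) \<circ> (?s \<circ> v)" unfolding v(3) comp_assoc signed_swap_swap_left ..
    have lv: "abs_length n v = Suc (abs_length n (?s \<circ> v))" by (rule abs_length_remove_point[OF v(2) vk])
    \<comment> \<open>Moving \<open>?s\<close> shortens \<open>v\<close> by one and lengthens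
      \<open>u\<close> by at most one. As the product is still \<open>y\<close>, subadditivity
      forces exactly one.\<close>
    have "abs_length n y \<le> abs_length n (u \<circ> ?s) + abs_length n (?s \<circ> v)"
      using abs_length_comp_le[OF us sv] y' by simp
    moreover have "abs_length n (u \<circ> ?s) \<le> Suc (abs_length n u)"
      using abs_length_comp_swap_ge[OF us kD vkD] abs_length_comp_le[OF v(1) signed_swap_in_points[OF kD vkD]]
        abs_length_swap[OF kD vkD] by linarith
    ultimately have lus: "abs_length n (u \<circ> ?s) = Suc (abs_length n u)"
      and ly: "abs_length n y = abs_length n (u \<circ> ?s) + abs_length n (?s \<circ> v)" using v(4) lv by linarith+
    have le': "abs_le n (u \<circ> ?s) y"
      using abs_le_compI[OF us sv] ly unfolding y'[symmetric] by simp
    have "v k \<in> orb (u \<circ> ?s) k"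
    proof (rule lower_length_imp_cut[OF us num_balanced_mono[OF le' y(2)] kD vkD])
      show "abs_length n (u \<circ> ?s) = Suc (abs_length n ((u \<circ> ?s) \<circ> ?s))"
        using lus by (simp add: comp_assoc)
    qed
    moreover have "(u \<circ> ?s) k = y k"
      using signed_set_nz[OF D kD] signed_set_nz[OF D vkD] v(3) by simp
    ultimately show "(u \<circ> signed_swap k ((inv u \<circ> y) k), (inv u \<circ> y) k) \<in> S"
      unfolding iv S_def U0_def U_def using le' vk by simp
    show "(case (u \<circ> signed_swap k ((inv u \<circ> y) k), (inv u \<circ> y) k) of (u, b) \<Rightarrow> ?w (u \<circ> signed_swap k b)) = ?w u"
      by (simp add: comp_assoc)
  next
    fix p assume "p \<in> S"
    then obtain u b where p: "p = (u, b)" and le: "abs_le n u y" and uk: "u k = y k"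
      and b: "b \<in> orb u k - {k}" by (auto simp: S_def U0_def U_def)
    obtain v where v: "u \<in> signed_perms ?D" "v \<in> signed_perms ?D" "y = u \<circ> v"
      "abs_length n y = abs_length n u + abs_length n v" using abs_leE[OF le] .
    let ?s = "signed_swap k b"
    have bD: "b \<in> ?D" using orb_in[OF v(1) kD] b by blast
    have us: "u \<circ> ?s \<in> signed_perms ?D" and sv: "?s \<circ> v \<in> signed_perms ?D"
      by (intro comp_signed_perms signed_swap_in_points v kD bD)+
    have y': "(u \<circ> ?s) \<circ> (?s \<circ> v) = y" unfolding v(3) comp_assoc signed_swap_swap_left ..
    \<comment> \<open>For \<open>u\<close> in \<open>U0\<close> the complement \<open>v\<close>
      fixes \<open>k\<close>, so \<open>?s \<circ> v\<close> sends \<open>k\<close> to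
      \<open>b\<close>. This lengthens \<open>v\<close> by one and also recovers \<open>b\<close>
      from the image of the pair.\<close>
    have vk: "v k = k" using uk v(3) signed_permsD(5)[OF v(1)] by simp
    have svk: "(?s \<circ> v) k = b" using vk signed_set_nz[OF D kD] signed_set_nz[OF D bD] by simp
    have "abs_length n (?s \<circ> v) = Suc (abs_length n (?s \<circ> (?s \<circ> v)))"
      using abs_length_remove_point[OF sv, of k] svk b by auto
    then have "abs_length n (?s \<circ> v) = Suc (abs_length n v)" by (simp only: signed_swap_swap_left)
    moreover have "abs_length n u = Suc (abs_length n (u \<circ> ?s))"
      by (rule cut_lowers_length(1)[OF v(1) kD b])
    ultimately have le': "abs_le n (u \<circ> ?s) y"
      using abs_le_compI[OF us sv] v(4) unfolding y' by simp
    have iv: "inv (u \<circ> ?s) \<circ> y = ?s \<circ> v"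
    proof -
      have "inv (u \<circ> ?s) \<circ> y = (inv (u \<circ> ?s) \<circ> (u \<circ> ?s)) \<circ> (?s \<circ> v)"
        unfolding y'[symmetric] by (simp only: comp_assoc)
      then show ?thesis using signed_perms_inv_comp(2)[OF us] by simp
    qed
    have "u b \<noteq> u k" using b signed_permsD(5)[OF v(1), of b k] by simp
    then have ne: "(u \<circ> ?s) k \<noteq> y k"
      using uk signed_set_nz[OF D kD] signed_set_nz[OF D bD] by simp
    show "(\<lambda>u. (u \<circ> signed_swap k ((inv u \<circ> y) k), (inv u \<circ> y) k)) (case p of (u, b) \<Rightarrow> u \<circ> signed_swap k b) = p"
      unfolding p prod.case iv svk by (simp add: comp_assoc)
    show "(case p of (u, b) \<Rightarrow> u \<circ> signed_swap k b) \<in> U1"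
      unfolding p prod.case U1_def U_def using le' ne by blast
  qed
  also have "\<dots> = (\<Sum>u\<in>U0. \<Sum>b\<in>orb u k - {k}. ?w (u \<circ> signed_swap k b))"
  proof -
    have "finite (orb u k - {k})" if "u \<in> U0" for u
      using that orb_in[of u ?D k] kD D
      by (auto simp: U0_def U_def abs_le_iff signed_set_def intro: finite_subset)
    then show ?thesis unfolding S_def using fin by (subst sum.Sigma) (auto simp: U0_def)
  qed
  also have "\<dots> = (\<Sum>u\<in>U0. - ?w u)"
  proof (rule sum.cong[OF refl])
    fix u assume "u \<in> U0"
    \<comment> \<open>Here \<open>u k\<close> is \<open>y k\<close>, which differs from
      \<open>k\<close> by the choice of \<open>k\<close>; so the cut recurrence applies.\<close>
    then have "u \<in> signed_perms ?D" "u k \<noteq> k" using k by (auto simp: U0_def U_def abs_le_iff)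
    from weight_cut_sum[OF D this(1) kD this(2)]
    show "(\<Sum>b\<in>orb u k - {k}. ?w (u \<circ> signed_swap k b)) = - ?w u" by simp
  qed
  finally have "(\<Sum>u\<in>U0. ?w u) + (\<Sum>u\<in>U1. ?w u) = 0" by (simp add: sum_negf)
  moreover have "U = U0 \<union> U1" "U0 \<inter> U1 = {}" by (auto simp: U0_def U1_def)
  ultimately show ?thesis using fin sum.union_disjoint[of U0 U1 ?w] by (simp add: U_def)
qed

section \<open>Euler characteristic of an order complex\<close>

lemma chain_subset: "Complete_Partial_Order.chain le F \<Longrightarrow> G \<subseteq> F \<Longrightarrow> Complete_Partial_Order.chain le G"
  unfolding Complete_Partial_Order.chain_def by blast

lemma finite_chain_greatest:
  assumes "finite F" "F \<noteq> {}" "Complete_Partial_Order.chain le F"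
    and "\<And>x y z. x \<in> F \<Longrightarrow> y \<in> F \<Longrightarrow> z \<in> F \<Longrightarrow> le x y \<Longrightarrow> le y z \<Longrightarrow> le x z"
  shows "\<exists>x\<in>F. \<forall>y\<in>F. le y x"
proof -
  \<comment> \<open>An element with the most elements below it is the greatest: one above it would
    have the same lower set, hence lie below it too.\<close>
  define g where "g y = card {z \<in> F. le z y}" for y
  have "Max (g ` F) \<in> g ` F" using assms(1,2) by (intro Max_in) auto
  then obtain x where x: "x \<in> F" "g x = Max (g ` F)" by auto
  have "le y x" if y: "y \<in> F" for y
  proof (cases "le x y")
    case True
    have sub: "{z \<in> F. le z x} \<subseteq> {z \<in> F. le z y}"
    proof clarify
      fix z assume "z \<in> F" "le z x"
      then show "le z y" using assms(4)[OF _ x(1) y _ True] by blast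
    qed
    have "g y \<le> g x" unfolding x(2) using assms(1) y by (intro Max_ge) auto
    then have "{z \<in> F. le z x} = {z \<in> F. le z y}"
      unfolding g_def using assms(1) sub by (intro card_seteq) auto
    moreover have "le y y" using chainD[OF assms(3) y y] by blast
    ultimately show ?thesis using y by blast
  next
    case False
    then show ?thesis using chainD[OF assms(3) x(1) y] by blast
  qed
  then show ?thesis using x(1) by blast
qed

text \<open>Nonempty chains are sorted by their greatest element \<open>x\<close>; removing it
  leaves an arbitrary chain strictly below \<open>x\<close> and reverses the sign.\<close>

lemma chain_sum_rec:
  fixes le :: "'a \<Rightarrow> 'a \<Rightarrow> bool"
  assumes fin: "finite Q"
    and refl: "\<And>x. x \<in> Q \<Longrightarrow> le x x"
    and antisym: "\<And>x y. x \<in> Q \<Longrightarrow> y \<in> Q \<Longrightarrow> le x y \<Longrightarrow> le y x \<Longrightarrow> x = y"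
    and trans: "\<And>x y z. x \<in> Q \<Longrightarrow> y \<in> Q \<Longrightarrow> z \<in> Q \<Longrightarrow> le x y \<Longrightarrow> le y z \<Longrightarrow> le x z"
  shows "(\<Sum>F\<in>order_complex le Q. (- 1) ^ card F :: real) =
    1 - (\<Sum>x\<in>Q. \<Sum>F\<in>order_complex le {y \<in> Q. le y x \<and> y \<noteq> x}. (- 1) ^ card F)"
proof -
  define below where "below x = {y \<in> Q. le y x \<and> y \<noteq> x}" for x
  have finC: "finite (order_complex le A)" if "A \<subseteq> Q" for A
    by (rule finite_subset[of _ "Pow A"]) (use that fin in \<open>auto simp: order_complex_def intro: finite_subset\<close>)
  have bQ: "below x \<subseteq> Q" for x by (auto simp: below_def)
  have empty: "{} \<in> order_complex le Q" by (simp add: order_complex_def chain_empty)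
  have "bij_betw (\<lambda>(x, G). insert x G) (SIGMA x : Q. order_complex le (below x)) (order_complex le Q - {{}})"
  proof (rule bij_betw_imageI)
    show "inj_on (\<lambda>(x, G). insert x G) (SIGMA x : Q. order_complex le (below x))"
    proof (rule inj_onI, clarify)
      fix x G x' G'
      assume x: "x \<in> Q" "x' \<in> Q" and G: "G \<in> order_complex le (below x)" "G' \<in> order_complex le (below x')"
        and e: "insert x G = insert x' G'"
      have sub: "G \<subseteq> below x" "G' \<subseteq> below x'" using G by (auto simp: order_complex_def)
      \<comment> \<open>Otherwise each of the two would lie strictly below the other.\<close>
      have xx: "x = x'"
      proof (rule ccontr)
        assume "x \<noteq> x'"
        then have "x \<in> G'" "x' \<in> G" using e by auto
        then show False using sub antisym[of x x'] x \<open>x \<noteq> x'\<close> by (auto simp: below_def)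
      qed
      moreover have "x \<notin> G" "x' \<notin> G'" using sub by (auto simp: below_def)
      ultimately show "x = x' \<and> G = G'" using e by auto
    qed
    show "(\<lambda>(x, G). insert x G) ` (SIGMA x : Q. order_complex le (below x)) = order_complex le Q - {{}}"
    proof (intro equalityI subsetI)
      fix F assume "F \<in> (\<lambda>(x, G). insert x G) ` (SIGMA x : Q. order_complex le (below x))"
      then obtain x G where x: "x \<in> Q" "G \<subseteq> below x" "Complete_Partial_Order.chain le G" "F = insert x G"
        by (auto simp: order_complex_def)
      then have "Complete_Partial_Order.chain le F"
        using refl[OF x(1)] by (auto simp: Complete_Partial_Order.chain_def below_def)
      then show "F \<in> order_complex le Q - {{}}" using x bQ by (auto simp: order_complex_def below_def)
    next
      fix F assume F: "F \<in> order_complex le Q - {{}}"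
      then have FQ: "F \<subseteq> Q" "F \<noteq> {}" "Complete_Partial_Order.chain le F" by (auto simp: order_complex_def)
      have tr: "le x w" if "x \<in> F" "y \<in> F" "w \<in> F" "le x y" "le y w" for x y w
        using trans[of x y w] that FQ(1) by blast
      have "\<exists>x\<in>F. \<forall>y\<in>F. le y x"
        by (rule finite_chain_greatest[OF finite_subset[OF FQ(1) fin] FQ(2,3) tr])
      then obtain x where x: "x \<in> F" "\<forall>y\<in>F. le y x" by blast
      have "F - {x} \<in> order_complex le (below x)"
        using x FQ chain_subset[OF FQ(3), of "F - {x}"] by (auto simp: order_complex_def below_def)
      then show "F \<in> (\<lambda>(x, G). insert x G) ` (SIGMA x : Q. order_complex le (below x))"
        using x FQ by (intro image_eqI[of _ _ "(x, F - {x})"]) auto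
    qed
  qed
  then have "(\<Sum>F\<in>order_complex le Q - {{}}. (- 1) ^ card F :: real)
      = (\<Sum>(x, G)\<in>(SIGMA x : Q. order_complex le (below x)). (- 1) ^ card (insert x G))"
    by (simp add: sum.reindex_bij_betw[symmetric] case_prod_unfold)
  also have "\<dots> = (\<Sum>x\<in>Q. \<Sum>G\<in>order_complex le (below x). (- 1) ^ card (insert x G))"
    using fin finC[OF bQ] by (subst sum.Sigma) auto
  also have "\<dots> = (\<Sum>x\<in>Q. \<Sum>G\<in>order_complex le (below x). - ((- 1) ^ card G))"
  proof (intro sum.cong HOL.refl)
    fix x G assume "G \<in> order_complex le (below x)"
    then have G: "G \<subseteq> below x" by (simp add: order_complex_def)
    then have "finite G" "x \<notin> G" using finite_subset[OF bQ[of x] fin] by (auto simp: below_def intro: finite_subset)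
    then show "(- 1) ^ card (insert x G) = - ((- 1) ^ card G :: real)" by simp
  qed
  finally show ?thesis
    unfolding below_def using sum.remove[OF finC[OF subset_refl] empty, of "\<lambda>F. (- 1) ^ card F :: real"]
    by (simp add: sum_negf)
qed

text \<open>A form of Philip Hall's theorem. The hypotheses on \<open>f\<close> are the defining
  equations of the Moebius function \<open>\<mu>(z, \<cdot>)\<close>.\<close>

lemma reduced_euler_char_moebius:
  fixes le :: "'a \<Rightarrow> 'a \<Rightarrow> bool" and f :: "'a \<Rightarrow> real"
  assumes fin: "finite P"
    and refl: "\<And>x. x \<in> P \<Longrightarrow> le x x"
    and antisym: "\<And>x y. x \<in> P \<Longrightarrow> y \<in> P \<Longrightarrow> le x y \<Longrightarrow> le y x \<Longrightarrow> x = y"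
    and trans: "\<And>x y z. x \<in> P \<Longrightarrow> y \<in> P \<Longrightarrow> z \<in> P \<Longrightarrow> le x y \<Longrightarrow> le y z \<Longrightarrow> le x z"
    and z: "z \<in> P" "\<And>x. x \<in> P \<Longrightarrow> le z x" "f z = 1"
    and f: "\<And>y. y \<in> P \<Longrightarrow> y \<noteq> z \<Longrightarrow> (\<Sum>x | x \<in> P \<and> le x y. f x) = 0"
  shows "real_of_int (reduced_euler_char (order_complex le (P - {z}))) = - (\<Sum>x\<in>P. f x)"
proof -
  \<comment> \<open>Stated for all down-closed subsets, since the sets strictly below an element, to
    which the recursion leads, are of this kind.\<close>
  have E: "(\<Sum>F\<in>order_complex le Q. (- 1) ^ card F :: real) = 1 + (\<Sum>x\<in>Q. f x)"
    if "Q \<subseteq> P - {z}" "\<And>x y. x \<in> P - {z} \<Longrightarrow> y \<in> Q \<Longrightarrow> le x y \<Longrightarrow> x \<in> Q" for Q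
    using that
  proof (induction "card Q" arbitrary: Q rule: less_induct)
    case less
    note Q = less.prems
    have finQ: "finite Q" using Q(1) fin by (meson finite_Diff finite_subset)
    have "(\<Sum>F\<in>order_complex le {y \<in> Q. le y x \<and> y \<noteq> x}. (- 1) ^ card F :: real) = - f x" if x: "x \<in> Q" for x
    proof -
      let ?B = "{y \<in> Q. le y x \<and> y \<noteq> x}"
      have xP: "x \<in> P" "x \<noteq> z" using x Q(1) by auto
      have "card ?B < card Q" using x finQ by (intro psubset_card_mono) auto
      then have "(\<Sum>F\<in>order_complex le ?B. (- 1) ^ card F :: real) = 1 + (\<Sum>y\<in>?B. f y)"
      proof (rule less.hyps)
        show "?B \<subseteq> P - {z}" using Q(1) by blast
        fix v y assume v: "v \<in> P - {z}" and y: "y \<in> ?B" and vy: "le v y"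
        have yP: "y \<in> P" using y Q(1) by auto
        have "v \<in> Q" using Q(2)[OF v _ vy] y by blast
        moreover have "le v x" using trans[of v y x] v y vy yP xP by auto
        moreover have "v \<noteq> x" using antisym[of x y] y vy yP xP by auto
        ultimately show "v \<in> ?B" by blast
      qed
      \<comment> \<open>The lower set of \<open>x\<close> is \<open>?B\<close> with \<open>z\<close>
        and \<open>x\<close> added, and \<open>f\<close> sums to 0 over it; so \<open>1\<close> plus
        the sum over \<open>?B\<close> is \<open>- f x\<close>.\<close>
      moreover have "{y. y \<in> P \<and> le y x} = insert z (insert x ?B)"
        using Q x xP refl z(1,2) by auto
      then have "(\<Sum>y | y \<in> P \<and> le y x. f y) = f z + (f x + (\<Sum>y\<in>?B. f y))"
      proof -
        have B: "finite (insert x ?B)" "finite ?B" "x \<notin> ?B" "z \<notin> insert x ?B" using finQ xP Q(1) by auto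
        show ?thesis
          unfolding \<open>{y. y \<in> P \<and> le y x} = insert z (insert x ?B)\<close>
            sum.insert[OF B(1,4)] sum.insert[OF B(2,3)] ..
      qed
      ultimately show ?thesis using f[OF xP] z(3) by simp
    qed
    moreover have "(\<Sum>F\<in>order_complex le Q. (- 1) ^ card F :: real) =
        1 - (\<Sum>x\<in>Q. \<Sum>F\<in>order_complex le {y \<in> Q. le y x \<and> y \<noteq> x}. (- 1) ^ card F)"
    proof (rule chain_sum_rec[OF finQ])
      show "le x x" if "x \<in> Q" for x using that Q(1) refl by blast
      show "x = y" if "x \<in> Q" "y \<in> Q" "le x y" "le y x" for x y
        using antisym[of x y] that Q(1) by blast
      show "le x w" if "x \<in> Q" "y \<in> Q" "w \<in> Q" "le x y" "le y w" for x y w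
        using trans[of x y w] that Q(1) by blast
    qed
    ultimately show ?case by (simp add: sum_negf)
  qed
  have "real_of_int (reduced_euler_char (order_complex le (P - {z})))
      = - (\<Sum>F\<in>order_complex le (P - {z}). (- 1) ^ card F)"
    by (simp add: reduced_euler_char_def sum_negf)
  also have "(\<Sum>F\<in>order_complex le (P - {z}). (- 1) ^ card F :: real) = (\<Sum>x\<in>P. f x)"
    using E[of "P - {z}"] sum.remove[OF fin z(1), of f] z(3) by simp
  finally show ?thesis .
qed

section \<open>Enumeration\<close>

definition signed_lists :: "int set \<Rightarrow> nat \<Rightarrow> int list set" where
  "signed_lists D k = {as. length as = k \<and> set as \<subseteq> D \<and> abs_distinct as}"

lemma finite_signed_lists: "finite D \<Longrightarrow> finite (signed_lists D k)"
  by (rule finite_subset[OF _ finite_lists_length_eq[of D k]]) (auto simp: signed_lists_def)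

lemma card_Diff_support:
  assumes "signed_set D" "card D = 2 * m" "set as \<subseteq> D" "abs_distinct as"
  shows "card (D - signed_support as) = 2 * (m - length as)"
proof -
  have "card (D - signed_support as) = card D - card (signed_support as)"
    by (rule card_Diff_subset[OF _ signed_support_subset[OF assms(1,3)]]) (simp add: signed_support_def)
  then show ?thesis using assms(2) card_signed_support[OF assms(4)] by simp
qed

lemma card_signed_lists:
  assumes "signed_set D" "card D = 2 * m" "k \<le> m"
  shows "real (card (signed_lists D k)) = 2 ^ k * fact m / fact (m - k)"
  using assms
proof (induction k arbitrary: D m)
  case 0
  have "signed_lists D 0 = {[]}" by (auto simp: signed_lists_def)
  then show ?case by simp
next
  case (Suc k)
  note D = Suc.prems(1)
  have fin: "finite D" using D by (simp add: signed_set_def)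
  obtain l where m: "m = Suc l" using Suc.prems(3) by (cases m) auto
  have eq: "signed_lists D (Suc k) = (\<Union>a\<in>D. (#) a ` signed_lists (D - signed_support [a]) k)"
  proof (intro equalityI subsetI)
    fix bs assume "bs \<in> signed_lists D (Suc k)"
    then obtain a as where b: "bs = a # as" "length as = k" "set (a # as) \<subseteq> D" "abs_distinct (a # as)"
      by (cases bs) (auto simp: signed_lists_def)
    have "- x \<noteq> a \<and> x \<noteq> a" if "x \<in> set as" for x using b(4) that by auto
    then have "as \<in> signed_lists (D - signed_support [a]) k"
      using b by (auto simp: signed_lists_def mem_signed_support)
    then show "bs \<in> (\<Union>a\<in>D. (#) a ` signed_lists (D - signed_support [a]) k)" using b by auto
  next
    fix bs assume "bs \<in> (\<Union>a\<in>D. (#) a ` signed_lists (D - signed_support [a]) k)"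
    then obtain a as where "bs = a # as" "a \<in> D" "as \<in> signed_lists (D - signed_support [a]) k" by blast
    then show "bs \<in> signed_lists D (Suc k)"
      using signed_set_nz[OF D] by (auto simp: signed_lists_def mem_signed_support)
  qed
  have "card (signed_lists D (Suc k)) = (\<Sum>a\<in>D. card ((#) a ` signed_lists (D - signed_support [a]) k))"
    unfolding eq by (rule card_UN_disjoint) (use fin in \<open>auto intro: finite_signed_lists\<close>)
  also have "\<dots> = (\<Sum>a\<in>D. card (signed_lists (D - signed_support [a]) k))"
    by (intro sum.cong refl card_image) simp
  also have "real \<dots> = (\<Sum>a\<in>D. 2 ^ k * fact l / fact (l - k))"
    unfolding of_nat_sum
  proof (intro sum.cong refl)
    fix a assume a: "a \<in> D"
    then have "card (D - signed_support [a]) = 2 * (m - length [a])"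
      using signed_set_nz[OF D a] by (intro card_Diff_support[OF D Suc.prems(2)]) auto
    then show "real (card (signed_lists (D - signed_support [a]) k)) = 2 ^ k * fact l / fact (l - k)"
      using Suc.prems(3) m by (intro Suc.IH signed_set_Diff[OF D]) auto
  qed
  finally show ?case using Suc.prems(2) m by (simp add: algebra_simps)
qed

definition balanced_at_most :: "int set \<Rightarrow> bool \<Rightarrow> (int \<Rightarrow> int) set" where
  "balanced_at_most D b = {u \<in> signed_perms D. num_balanced D u \<le> of_bool b}"

lemma finite_balanced_at_most: "signed_set D \<Longrightarrow> finite (balanced_at_most D b)"
  by (rule finite_subset[OF _ finite_signed_perms]) (auto simp: balanced_at_most_def)

text \<open>The cycle through \<open>n\<close>, listed from \<open>n\<close>, is unique. If it is
  balanced, the remaining points may carry no further balanced cycle.\<close>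

lemma balanced_at_most_bij:
  assumes D: "signed_set D" and n: "n \<in> D"
  defines "A \<equiv> {as. set as \<subseteq> D \<and> abs_distinct (n # as)}"
  shows "bij_betw (\<lambda>((\<beta>, as), u). signed_cycle \<beta> (n # as) \<circ> u)
    (SIGMA (\<beta>, as) : {\<beta>. \<beta> \<longrightarrow> b} \<times> A. balanced_at_most (D - signed_support (n # as)) (b \<and> \<not> \<beta>))
    (balanced_at_most D b)"
proof (rule bij_betw_imageI)
  let ?S = "SIGMA (\<beta>, as) : {\<beta>. \<beta> \<longrightarrow> b} \<times> A. balanced_at_most (D - signed_support (n # as)) (b \<and> \<not> \<beta>)"
  show "inj_on (\<lambda>((\<beta>, as), u). signed_cycle \<beta> (n # as) \<circ> u) ?S"
  proof (rule inj_onI)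
    fix p q assume p: "p \<in> ?S" and q: "q \<in> ?S"
      and e: "(\<lambda>((\<beta>, as), u). signed_cycle \<beta> (n # as) \<circ> u) p = (\<lambda>((\<beta>, as), u). signed_cycle \<beta> (n # as) \<circ> u) q"
    obtain \<beta> as u where pe: "p = ((\<beta>, as), u)" by (metis surj_pair)
    obtain \<gamma> bs v where qe: "q = ((\<gamma>, bs), v)" by (metis surj_pair)
    have as: "abs_distinct (n # as)" "u \<in> signed_perms (D - signed_support (n # as))"
      using p unfolding pe A_def balanced_at_most_def by auto
    have bs: "abs_distinct (n # bs)" "v \<in> signed_perms (D - signed_support (n # bs))"
      using q unfolding qe A_def balanced_at_most_def by auto
    have "\<beta> = \<gamma> \<and> as = bs \<and> u = v"
    proof (rule cycle_decomp_unique[OF as(1) bs(1)])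
      show "u i = i" if "i \<in> signed_support (n # as)" for i using signed_permsD(3)[OF as(2)] that by blast
      show "v i = i" if "i \<in> signed_support (n # bs)" for i using signed_permsD(3)[OF bs(2)] that by blast
      show "signed_cycle \<beta> (n # as) \<circ> u = signed_cycle \<gamma> (n # bs) \<circ> v" using e unfolding pe qe prod.case .
    qed
    then show "p = q" unfolding pe qe by simp
  qed
  show "(\<lambda>((\<beta>, as), u). signed_cycle \<beta> (n # as) \<circ> u) ` ?S = balanced_at_most D b"
  proof (intro equalityI subsetI)
    fix w assume "w \<in> (\<lambda>((\<beta>, as), u). signed_cycle \<beta> (n # as) \<circ> u) ` ?S"
    then obtain \<beta> as u where w: "w = signed_cycle \<beta> (n # as) \<circ> u" "\<beta> \<longrightarrow> b" "set as \<subseteq> D" "abs_distinct (n # as)"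
      "u \<in> signed_perms (D - signed_support (n # as))"
      "num_balanced (D - signed_support (n # as)) u \<le> of_bool (b \<and> \<not> \<beta>)"
      unfolding A_def balanced_at_most_def by auto
    have sub: "set (n # as) \<subseteq> D" using w(3) n by simp
    have "num_balanced D w \<le> of_bool b"
      unfolding w(1) num_balanced_cycle[OF D w(4) sub w(5)] using w(2,6) by (auto split: if_splits)
    then show "w \<in> balanced_at_most D b"
      using cycle_comp_signed_perms[OF D w(4) sub w(5), of \<beta>] unfolding balanced_at_most_def w(1) by blast
  next
    fix w assume "w \<in> balanced_at_most D b"
    then have w: "w \<in> signed_perms D" "num_balanced D w \<le> of_bool b" by (auto simp: balanced_at_most_def)
    obtain \<beta> as u where dec: "abs_distinct (n # as)" "set as \<subseteq> D"
      "u \<in> signed_perms (D - signed_support (n # as))" "w = signed_cycle \<beta> (n # as) \<circ> u"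
      using signed_perms_cycle_decomp[OF D w(1) n] .
    have sub: "set (n # as) \<subseteq> D" using dec(2) n by simp
    have "of_bool \<beta> + num_balanced (D - signed_support (n # as)) u \<le> of_bool b"
      using w(2) unfolding dec(4) num_balanced_cycle[OF D dec(1) sub dec(3)] .
    then have "\<beta> \<longrightarrow> b" "num_balanced (D - signed_support (n # as)) u \<le> of_bool (b \<and> \<not> \<beta>)"
      by (cases \<beta>; cases b; simp)+
    then have "((\<beta>, as), u) \<in> ?S" unfolding A_def balanced_at_most_def using dec by auto
    moreover have "w = (\<lambda>((\<beta>, as), u). signed_cycle \<beta> (n # as) \<circ> u) ((\<beta>, as), u)"
      using dec(4) by simp
    ultimately show "w \<in> (\<lambda>((\<beta>, as), u). signed_cycle \<beta> (n # as) \<circ> u) ` ?S" by (rule rev_image_eqI)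
  qed
qed

lemma sum_weight_balanced_at_most:
  assumes "signed_set D" "card D = 2 * m"
  shows "(\<Sum>u\<in>balanced_at_most D b. weight D u) = ideal_weight b m"
  using assms
proof (induction m arbitrary: D b rule: less_induct)
  case (less m)
  note D = less.prems(1)
  have fin: "finite D" using D by (simp add: signed_set_def)
  show ?case
  proof (cases m)
    case 0
    then have "D = {}" using less.prems(2) fin by simp
    then have "balanced_at_most D b = {id}" by (auto simp: balanced_at_most_def signed_perms_empty)
    then show ?thesis using \<open>D = {}\<close> 0 by simp
  next
    case (Suc l)
    then obtain n where n: "n \<in> D" using less.prems(2) by fastforce
    let ?E = "D - signed_support [n]"
    have nz: "n \<noteq> 0" using signed_set_nz[OF D n] by simp
    have cE: "card ?E = 2 * l"
      using card_Diff_support[OF D less.prems(2), of "[n]"] n nz Suc by simp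
    define A where "A = {as. set as \<subseteq> D \<and> abs_distinct (n # as)}"
    have A_k: "{as \<in> A. length as = k} = signed_lists ?E k" for k
      using nz by (auto simp: A_def signed_lists_def mem_signed_support)
    have len: "length as \<le> l" if "as \<in> A" for as
    proof -
      have d: "abs_distinct (n # as)" "set (n # as) \<subseteq> D" using that n by (auto simp: A_def)
      have "card (signed_support (n # as)) \<le> card D"
        by (rule card_mono[OF fin signed_support_subset[OF D d(2)]])
      then show ?thesis using card_signed_support[OF d(1)] less.prems(2) Suc by simp
    qed
    have finA: "finite A"
    proof (rule finite_subset)
      show "A \<subseteq> (\<Union>k\<le>l. signed_lists ?E k)" using len unfolding A_k[symmetric] by auto
      show "finite (\<Union>k\<le>l. signed_lists ?E k)" using fin by (auto intro: finite_signed_lists)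
    qed
    let ?R = "\<lambda>as. D - signed_support (n # as)"
    let ?B = "{\<beta>. \<beta> \<longrightarrow> b}"
    \<comment> \<open>Removing \<open>n\<close> and the entries of \<open>as\<close> from
      \<open>l + 1\<close> pairs leaves \<open>l - length as\<close> pairs, to which the induction
      hypothesis applies.\<close>
    have W: "(\<Sum>u\<in>balanced_at_most (?R as) c. weight D (signed_cycle \<beta> (n # as) \<circ> u))
        = cycle_weight \<beta> (length as) * ideal_weight c (l - length as)" if "as \<in> A" for as \<beta> c
    proof -
      have d: "abs_distinct (n # as)" "set (n # as) \<subseteq> D" using that n by (auto simp: A_def)
      have "card (?R as) = 2 * (m - length (n # as))" by (rule card_Diff_support[OF D less.prems(2) d(2,1)])
      then have "card (?R as) = 2 * (l - length as)" using Suc by simp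
      then have IH: "(\<Sum>u\<in>balanced_at_most (?R as) c. weight (?R as) u) = ideal_weight c (l - length as)"
        using Suc by (intro less.IH signed_set_Diff[OF D]) auto
      have "(\<Sum>u\<in>balanced_at_most (?R as) c. weight D (signed_cycle \<beta> (n # as) \<circ> u))
          = (\<Sum>u\<in>balanced_at_most (?R as) c. cycle_weight \<beta> (length as) * weight (?R as) u)"
        by (intro sum.cong refl weight_cycle[OF D d]) (simp add: balanced_at_most_def)
      then show ?thesis unfolding sum_distrib_left[symmetric] IH .
    qed
    have "(\<Sum>u\<in>balanced_at_most D b. weight D u)
        = (\<Sum>(\<beta>as, u)\<in>(SIGMA (\<beta>, as) : ?B \<times> A. balanced_at_most (?R as) (b \<and> \<not> \<beta>)).
            weight D (signed_cycle (fst \<beta>as) (n # snd \<beta>as) \<circ> u))"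
      using sum.reindex_bij_betw[OF balanced_at_most_bij[OF D n, of b], of "weight D"]
      by (simp add: A_def case_prod_unfold)
    also have "\<dots> = (\<Sum>p\<in>?B \<times> A. \<Sum>u\<in>balanced_at_most (?R (snd p)) (b \<and> \<not> fst p).
        weight D (signed_cycle (fst p) (n # snd p) \<circ> u))"
      using finA finite_balanced_at_most[OF signed_set_Diff[OF D]]
      by (subst sum.Sigma) (auto simp: case_prod_unfold)
    also have "\<dots> = (\<Sum>p\<in>?B \<times> A. cycle_weight (fst p) (length (snd p))
        * ideal_weight (b \<and> \<not> fst p) (l - length (snd p)))"
      by (intro sum.cong refl W) auto
    also have "\<dots> = (\<Sum>\<beta>\<in>?B. \<Sum>as\<in>A. cycle_weight \<beta> (length as) * ideal_weight (b \<and> \<not> \<beta>) (l - length as))"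
      by (simp add: sum.cartesian_product case_prod_unfold)
    also have "\<dots> = (\<Sum>as\<in>A. \<Sum>\<beta>\<in>?B. cycle_weight \<beta> (length as) * ideal_weight (b \<and> \<not> \<beta>) (l - length as))"
      by (rule sum.swap)
    also have "\<dots> = (\<Sum>as\<in>A. paired_weight (length as) * ideal_weight b (l - length as)
        + of_bool b * balanced_weight (length as) * ideal_weight False (l - length as))"
    proof (intro sum.cong refl)
      fix as
      have "?B = (if b then {False, True} else {False})" by auto
      then show "(\<Sum>\<beta>\<in>?B. cycle_weight \<beta> (length as) * ideal_weight (b \<and> \<not> \<beta>) (l - length as)) =
        paired_weight (length as) * ideal_weight b (l - length as)
        + of_bool b * balanced_weight (length as) * ideal_weight False (l - length as)"
        by (simp add: cycle_weight_def)
    qed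
    \<comment> \<open>The summand depends only on the length, and the tails of length
      \<open>k\<close> are the signed lists on the points other than \<open>n\<close> and
      \<open>- n\<close>.\<close>
    also have "\<dots> = (\<Sum>k\<le>l. \<Sum>as | as \<in> A \<and> length as = k. paired_weight (length as) * ideal_weight b (l - length as)
        + of_bool b * balanced_weight (length as) * ideal_weight False (l - length as))"
      using len by (intro sum.group[OF finA, symmetric]) auto
    also have "\<dots> = (\<Sum>k\<le>l. real (card (signed_lists ?E k)) * (paired_weight k * ideal_weight b (l - k)
        + of_bool b * balanced_weight k * ideal_weight False (l - k)))"
      unfolding A_k[symmetric] by (intro sum.cong refl) simp
    also have "\<dots> = (\<Sum>k\<le>l. 2 ^ k * fact l / fact (l - k) * (paired_weight k * ideal_weight b (l - k)
        + of_bool b * balanced_weight k * ideal_weight False (l - k)))"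
      by (intro sum.cong refl) (simp add: card_signed_lists[OF signed_set_Diff[OF D] cE])
    finally show ?thesis by (simp only: ideal_weight_Suc Suc)
  qed
qed

lemma weight_id:
  assumes "signed_set D" shows "weight D id = 1"
proof -
  have "orb id i = {i}" for i unfolding orb_def by auto
  then have b: "signed_block id i = {i, - i}" for i by (auto simp: signed_block_def)
  have "cycle_weight (balanced_block id B) (card B div 2 - 1) = 1" if B: "B \<in> blocks D id" for B
  proof -
    obtain i where i: "i \<in> D" "B = {i, - i}" using B by (auto simp: blocks_def b)
    have "i \<noteq> - i" using signed_set_nz[OF assms i(1)] by simp
    moreover from this have "\<not> balanced_block id B"
      unfolding balanced_block_def i \<open>\<And>i. orb id i = {i}\<close> by auto
    ultimately show ?thesis unfolding i by (simp add: cycle_weight_def)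
  qed
  then show ?thesis unfolding weight_def by simp
qed

lemma reduced_euler_char_coxeter_ideal:
  assumes "n \<ge> 1"
  shows "real_of_int (reduced_euler_char (order_complex (abs_le n) (proper_coxeter_ideal n)))
    = - ideal_weight True n"
proof -
  let ?D = "signed_points n"
  let ?P = "balanced_at_most ?D True"
  have D: "signed_set ?D" by (rule signed_set_points)
  have P: "coxeter_ideal n = ?P" unfolding coxeter_ideal_eq[OF assms] balanced_at_most_def by simp
  have id: "id \<in> ?P"
  proof -
    \<comment> \<open>Some Coxeter element is exhibited; the identity lies below it and thus in the
      ideal.\<close>
    have "[1..int n] \<in> {as. length as = n \<and> set as \<subseteq> ?D \<and> abs_distinct as}"
      by (auto simp: signed_points_def abs_distinct_def distinct_map inj_on_def)
    then have c: "signed_cycle True [1..int n] \<in> coxeter_elements n" unfolding coxeter_elements_eq by blast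
    have "num_balanced ?D id \<le> 1"
      by (rule num_balanced_mono[OF abs_le_id[OF coxeter_element_cases(1)[OF assms c]] coxeter_element_cases(2)[OF assms c]])
    then show ?thesis by (simp add: balanced_at_most_def id_signed_perms)
  qed
  have "real_of_int (reduced_euler_char (order_complex (abs_le n) (?P - {id}))) = - (\<Sum>u\<in>?P. weight ?D u)"
  proof (rule reduced_euler_char_moebius)
    show "finite ?P" by (rule finite_balanced_at_most[OF D])
    show "abs_le n u u" if "u \<in> ?P" for u using that abs_le_refl by (simp add: balanced_at_most_def)
    show "u = v" if "abs_le n u v" "abs_le n v u" for u v using that abs_le_antisym by blast
    show "abs_le n u w" if "abs_le n u v" "abs_le n v w" for u v w using that abs_le_trans by blast
    show "id \<in> ?P" by (rule id)
    show "abs_le n id u" if "u \<in> ?P" for u using that abs_le_id by (simp add: balanced_at_most_def)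
    show "weight ?D id = 1" by (rule weight_id[OF D])
    show "(\<Sum>u | u \<in> ?P \<and> abs_le n u y. weight ?D u) = 0" if y: "y \<in> ?P" "y \<noteq> id" for y
    proof -
      have y': "y \<in> signed_perms ?D" "num_balanced ?D y \<le> 1" using y by (auto simp: balanced_at_most_def)
      \<comment> \<open>Everything below an element of the ideal is in the ideal, so the sum runs
        over the whole principal ideal of \<open>y\<close>.\<close>
      have "{u. u \<in> ?P \<and> abs_le n u y} = {u. abs_le n u y}"
        using num_balanced_mono[OF _ y'(2)] by (auto simp: balanced_at_most_def abs_le_iff)
      then show ?thesis using weight_sum_below[OF y' y(2)] by simp
    qed
  qed
  then show ?thesis
    unfolding proper_coxeter_ideal_def P
    using sum_weight_balanced_at_most[OF D card_signed_points] by simp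
qed

theorem theorem1p4:
  shows "Abs_fps (\<lambda>n. if n \<ge> 2
             then (- 1) ^ n *
                  real_of_int (reduced_euler_char (order_complex (abs_le n) (proper_coxeter_ideal n)))
                  / fact n
             else 0)
         = 1 - fps_sqrt (fps_compose catalan_fps (2 * fps_X))
               * fps_compose (fps_exp 1) (- 2 * fps_X * fps_compose catalan_fps (2 * fps_X))
               * (1 + Abs_fps (\<lambda>n. if n \<ge> 1
                    then 2 ^ (n - 1) * real ((2 * n - 1) choose n) / real n
                    else 0))"
  (is "?L = ?R")
proof (rule fps_ext)
  fix n :: nat
  have R: "?R = 1 - paired_fps * balanced_fps" unfolding paired_fps_def balanced_fps_def ..
  \<comment> \<open>This linear coefficient cancels the coefficient 1 of the balanced factor, so
    both sides vanish at \<open>n = 1\<close>. The formula for the ideal is used from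
    \<open>n = 2\<close> on.\<close>
  have "fps_nth (fps_deriv paired_fps) 0 = - 1"
    unfolding paired_fps_deriv by (simp add: paired_fps_0 catalan2_nth catalan_nth_0)
  then have p1: "fps_nth paired_fps (Suc 0) = - 1" by simp
  consider "n = 0" | "n = 1" | "n \<ge> 2" by linarith
  then show "fps_nth ?L n = fps_nth ?R n"
  proof cases
    case 1
    then show ?thesis unfolding R by (simp add: paired_fps_0 balanced_fps_def)
  next
    case 2
    then show ?thesis unfolding R by (simp add: fps_mult_nth p1 paired_fps_0 balanced_fps_def)
  next
    case 3
    then have "fps_nth ?L n = - ((- 1) ^ n * ideal_weight True n / fact n)"
      using reduced_euler_char_coxeter_ideal[of n] by simp
    also have "\<dots> = - fps_nth (paired_fps * balanced_fps) n"
      by (simp add: ideal_weight_def flip: power_mult_distrib)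
    finally show ?thesis unfolding R using 3 by simp
  qed
qed

end
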